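(* Let $W$ be an FI-module over $\mathbb{Z}$. For each integer $p\ge 0$ let $H_p(W)$ denote the $p$-th FI-homology of $W$ and set $f_p(W) := \deg H_p(W) - p \in \mathbb{Z}\cup\{-\infty,+\infty\}$. Then for every integer $p\geq 1$, $$f_p(W)\le f_0(W)+f_1(W).$$
   Context: FI is the category whose objects are finite sets and whose morphisms are injective maps. FB is the category whose objects are finite sets and whose morphisms are bijections. An FI-module (over $\mathbb{Z}$) is a functor from FI to abelian groups, and an FB-module is a functor from FB to abelian groups; each forms an abelian category (with natural transformations as morphisms, and with kernels and cokernels computed pointwise), and the category of FI-modules has enough projectives. For a functor $V$ of either kind, write $V_T$ for its value on a finite set $T$ and $V_n$ for its value on $\{1,\dots,n\}$ (with $V_0$ the value on $\emptyset$). The functor $H_0$ from FI-modules to FB-modules is defined by $$H_0(W)_T := W_T \Big/ \sum_{f:S\hookrightarrow T,\ |S|<|T|} \operatorname{im}\bigl(f_*: W_S\to W_T\bigr),$$ the sum being over all injections $f$ from finite sets $S$ with $|S|<|T|$ (bijections of $T$ act on the quotient in the evident way). This functor is right exact. The FI-homology functor $H_p$ is its $p$-th left derived functor; thus $H_p(W)$ is the $p$-th homology of the complex of FB-modules obtained by applying $H_0$ to a projective resolution of $W$ in the category of FI-modules. The degree of an FB-module $V$ is $\deg V := \sup\{n\ge 0 : V_n\neq 0\}\in\{-\infty\}\cup\mathbb{Z}_{\geq 0}\cup\{+\infty\}$, with $\deg 0 = -\infty$. Subtraction of $p$ leaves $\pm\infty$ unchanged. In sums, $(-\infty)+a=-\infty$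 for $a\in\mathbb{Z}\cup\{-\infty\}$ and $(+\infty)+a=+\infty$ for every $a$, including $a=-\infty$; so the inequality is vacuous whenever its right-hand side is $+\infty$. *)

theory Defs
  imports
    "HOL-Algebra.Coset"
    "HOL-Algebra.Generated_Groups"
    "HOL-Library.Infinite_Typeclass"
    "HOL-Library.Extended_Real"
begin

text \<open>
  The objects of FI and FB are represented by the finite subsets of \<^typ>\<open>nat\<close>; this is a full
  subcategory, equivalent to the category on all finite sets. A morphism from \<open>S\<close> to \<open>T\<close> is a
  function that is \<^const>\<open>undefined\<close> outside \<open>S\<close>, so that equality of morphisms is equality in HOL.
\<close>

type_synonym mor_sets = "nat set \<Rightarrow> nat set \<Rightarrow> (nat \<Rightarrow> nat) set"

definition FI_mor :: mor_sets where
  "FI_mor S T = {f \<in> S \<rightarrow>\<^sub>E T. inj_on f S}"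

definition FB_mor :: mor_sets where
  "FB_mor S T = {f \<in> S \<rightarrow>\<^sub>E T. bij_betw f S T}"

text \<open>
  Abelian groups are the (multiplicatively written) \<^const>\<open>comm_group\<close>s, with \<open>\<one>\<close> as their zero.
  Values of \<open>Ob\<close> and \<open>Ar\<close> at infinite sets or at non-morphisms are irrelevant.
\<close>

record 'a set_functor =
  Ob :: "nat set \<Rightarrow> 'a monoid"
  Ar :: "nat set \<Rightarrow> nat set \<Rightarrow> (nat \<Rightarrow> nat) \<Rightarrow> 'a \<Rightarrow> 'a"

locale ab_functor =
  fixes mor :: mor_sets and V :: "'a set_functor"
  assumes ab_group: "finite T \<Longrightarrow> comm_group (Ob V T)"
    and ar_hom: "finite S \<Longrightarrow> finite T \<Longrightarrow> f \<in> mor S T \<Longrightarrow> Ar V S T f \<in> hom (Ob V S) (Ob V T)"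
    and ar_id: "finite T \<Longrightarrow> x \<in> carrier (Ob V T) \<Longrightarrow> Ar V T T (restrict id T) x = x"
    and ar_comp: "finite R \<Longrightarrow> finite S \<Longrightarrow> finite T \<Longrightarrow> f \<in> mor R S \<Longrightarrow> g \<in> mor S T \<Longrightarrow>
      x \<in> carrier (Ob V R) \<Longrightarrow> Ar V R T (compose R g f) x = Ar V S T g (Ar V R S f x)"

abbreviation FI_module :: "'a set_functor \<Rightarrow> bool" where
  "FI_module \<equiv> ab_functor FI_mor"

abbreviation FB_module :: "'a set_functor \<Rightarrow> bool" where
  "FB_module \<equiv> ab_functor FB_mor"

definition natural :: "mor_sets \<Rightarrow> 'a set_functor \<Rightarrow> 'b set_functor \<Rightarrow> (nat set \<Rightarrow> 'a \<Rightarrow> 'b) \<Rightarrow> bool"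
  where
  "natural mor V W \<eta> \<longleftrightarrow>
     (\<forall>T. finite T \<longrightarrow> \<eta> T \<in> hom (Ob V T) (Ob W T)) \<and>
     (\<forall>S T f x. finite S \<longrightarrow> finite T \<longrightarrow> f \<in> mor S T \<longrightarrow> x \<in> carrier (Ob V S) \<longrightarrow>
        \<eta> T (Ar V S T f x) = Ar W S T f (\<eta> S x))"

definition pointwise_surj :: "'a set_functor \<Rightarrow> 'b set_functor \<Rightarrow> (nat set \<Rightarrow> 'a \<Rightarrow> 'b) \<Rightarrow> bool" where
  "pointwise_surj V W \<eta> \<longleftrightarrow> (\<forall>T. finite T \<longrightarrow> \<eta> T ` carrier (Ob V T) = carrier (Ob W T))"

text \<open>
  The test modules \<open>M\<close>, \<open>N\<close> live in the same type as \<open>P\<close>. Because that type is infinite, it can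
  accommodate the free FI-module on all elements of \<open>P\<close> (its values have at most the cardinality
  of the type). A \<open>P\<close> that lifts against surjections in this type is hence a direct summand of a
  free FI-module, i.e. projective in the category of all FI-modules.
\<close>

definition FI_projective :: "'u::infinite set_functor \<Rightarrow> bool" where
  "FI_projective P \<longleftrightarrow> FI_module P \<and>
     (\<forall>(M :: 'u set_functor) (N :: 'u set_functor) \<pi> \<phi>.
        FI_module M \<longrightarrow> FI_module N \<longrightarrow> natural FI_mor M N \<pi> \<longrightarrow> pointwise_surj M N \<pi> \<longrightarrow>
        natural FI_mor P N \<phi> \<longrightarrow>
        (\<exists>\<psi>. natural FI_mor P M \<psi> \<and>
             (\<forall>T x. finite T \<longrightarrow> x \<in> carrier (Ob P T) \<longrightarrow> \<pi> T (\<psi> T x) = \<phi> T x)))"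

text \<open>The resolution \<open>\<dots> \<rightarrow> P 2 \<rightarrow> P 1 \<rightarrow> P 0 \<rightarrow> W \<rightarrow> 0\<close>, with \<open>d n : P (n + 1) \<rightarrow> P n\<close>.\<close>

definition projective_resolution ::
  "'a set_functor \<Rightarrow> (nat \<Rightarrow> 'u::infinite set_functor) \<Rightarrow> (nat \<Rightarrow> nat set \<Rightarrow> 'u \<Rightarrow> 'u) \<Rightarrow>
   (nat set \<Rightarrow> 'u \<Rightarrow> 'a) \<Rightarrow> bool" where
  "projective_resolution W P d \<epsilon> \<longleftrightarrow>
     (\<forall>n. FI_projective (P n)) \<and>
     (\<forall>n. natural FI_mor (P (Suc n)) (P n) (d n)) \<and>
     natural FI_mor (P 0) W \<epsilon> \<and>
     pointwise_surj (P 0) W \<epsilon> \<and>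
     (\<forall>T. finite T \<longrightarrow>
        d 0 T ` carrier (Ob (P 1) T) = kernel (Ob (P 0) T) (Ob W T) (\<epsilon> T)) \<and>
     (\<forall>n T. finite T \<longrightarrow>
        d (Suc n) T ` carrier (Ob (P (Suc (Suc n))) T)
          = kernel (Ob (P (Suc n)) T) (Ob (P n) T) (d n T))"

text \<open>
  The map \<open>G / K \<rightarrow> H / N\<close> induced on cosets by a homomorphism \<open>\<phi> : G \<rightarrow> H\<close> with \<open>\<phi>(K) \<subseteq> N\<close>:
  it sends the coset of \<open>x\<close> to the coset of \<open>\<phi> x\<close>, all the sets in the union being equal.
\<close>

definition coset_map :: "'b monoid \<Rightarrow> 'b set \<Rightarrow> ('a \<Rightarrow> 'b) \<Rightarrow> 'a set \<Rightarrow> 'b set" where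
  "coset_map H N \<phi> X = (\<Union>x\<in>X. N #>\<^bsub>H\<^esub> \<phi> x)"

definition lower_images :: "'a set_functor \<Rightarrow> nat set \<Rightarrow> 'a set" where
  "lower_images W T = generate (Ob W T)
     (\<Union>S \<in> {S. finite S \<and> card S < card T}. \<Union>f \<in> FI_mor S T. Ar W S T f ` carrier (Ob W S))"

definition H0 :: "'a set_functor \<Rightarrow> 'a set set_functor" where
  "H0 W = \<lparr>Ob = (\<lambda>T. Ob W T Mod lower_images W T),
           Ar = (\<lambda>S T f. coset_map (Ob W T) (lower_images W T) (Ar W S T f))\<rparr>"

definition H0_map :: "'b set_functor \<Rightarrow> (nat set \<Rightarrow> 'a \<Rightarrow> 'b) \<Rightarrow> nat set \<Rightarrow> 'a set \<Rightarrow> 'b set" where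
  "H0_map W \<eta> T = coset_map (Ob W T) (lower_images W T) (\<eta> T)"

text \<open>Homology of a complex with \<open>\<delta> n : C (n + 1) \<rightarrow> C n\<close>, extended by zero in negative degrees.\<close>

fun cycles :: "(nat \<Rightarrow> 'c set_functor) \<Rightarrow> (nat \<Rightarrow> nat set \<Rightarrow> 'c \<Rightarrow> 'c) \<Rightarrow> nat \<Rightarrow> nat set \<Rightarrow> 'c set" where
  "cycles C \<delta> 0 T = carrier (Ob (C 0) T)"
| "cycles C \<delta> (Suc n) T = kernel (Ob (C (Suc n)) T) (Ob (C n) T) (\<delta> n T)"

definition boundaries :: "(nat \<Rightarrow> 'c set_functor) \<Rightarrow> (nat \<Rightarrow> nat set \<Rightarrow> 'c \<Rightarrow> 'c) \<Rightarrow> nat \<Rightarrow> nat set \<Rightarrow> 'c set"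
  where
  "boundaries C \<delta> n T = \<delta> n T ` carrier (Ob (C (Suc n)) T)"

definition complex_homology ::
  "(nat \<Rightarrow> 'c set_functor) \<Rightarrow> (nat \<Rightarrow> nat set \<Rightarrow> 'c \<Rightarrow> 'c) \<Rightarrow> nat \<Rightarrow> 'c set set_functor" where
  "complex_homology C \<delta> n =
     \<lparr>Ob = (\<lambda>T. (Ob (C n) T)\<lparr>carrier := cycles C \<delta> n T\<rparr> Mod boundaries C \<delta> n T),
      Ar = (\<lambda>S T f. coset_map ((Ob (C n) T)\<lparr>carrier := cycles C \<delta> n T\<rparr>) (boundaries C \<delta> n T)
                      (Ar (C n) S T f))\<rparr>"

text \<open>\<open>H\<^sub>p(W)\<close>, computed from a projective resolution \<open>(P, d)\<close> of \<open>W\<close>.\<close>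

definition FI_homology ::
  "(nat \<Rightarrow> 'u set_functor) \<Rightarrow> (nat \<Rightarrow> nat set \<Rightarrow> 'u \<Rightarrow> 'u) \<Rightarrow> nat \<Rightarrow> 'u set set set_functor" where
  "FI_homology P d p = complex_homology (\<lambda>n. H0 (P n)) (\<lambda>n. H0_map (P n) (d n)) p"

text \<open>
  In \<^typ>\<open>ereal\<close> the supremum of the empty set is \<open>-\<infinity>\<close>, and \<open>\<infinity> + a = a + \<infinity> = \<infinity>\<close> also for \<open>a = -\<infinity>\<close>.
\<close>

definition FB_degree :: "'a set_functor \<Rightarrow> ereal" where
  "FB_degree V = (SUP n \<in> {n. carrier (Ob V {1..n}) \<noteq> {\<one>\<^bsub>Ob V {1..n}\<^esub>}}. ereal (real n))"

definition FI_f :: "(nat \<Rightarrow> 'u set_functor) \<Rightarrow> (nat \<Rightarrow> nat set \<Rightarrow> 'u \<Rightarrow> 'u) \<Rightarrow> nat \<Rightarrow> ereal" where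
  "FI_f P d p = FB_degree (FI_homology P d p) - ereal (real p)"

end

theory Submission
  imports Defs "HOL-Algebra.Free_Abelian_Groups" "HOL-Algebra.Weak_Morphisms"
begin

text \<open>
  FI-homology is computed by a Koszul complex: \<open>H\<^sub>p(W)\<^sub>T\<close> is the homology of the complex with terms
  \<open>\<Oplus>\<^bsub>|U| = p\<^esub> W\<^bsub>T - U\<^esub>\<close>. Let \<open>S W\<close> be the shift of \<open>W\<close> by one point, and let \<open>K W\<close> and \<open>D W\<close> be the kernel
  and the cokernel of \<open>W \<rightarrow> S W\<close>. The Koszul complex at a set with one more point is a mapping cone,
  which gives the long exact sequence
  \<open>H\<^bsub>p-1\<^esub>(K W)\<^sub>n \<rightarrow> H\<^sub>p(W)\<^bsub>n+1\<^esub> \<rightarrow> H\<^sub>p(D W)\<^sub>n \<rightarrow> H\<^bsub>p-2\<^esub>(K W)\<^sub>n \<rightarrow> H\<^bsub>p-1\<^esub>(W)\<^bsub>n+1\<^esub>\<close>.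
  All non-bijective maps of \<open>K W\<close> are zero, so \<open>deg H\<^sub>p(K W) \<le> deg (K W) + p\<close>, and the sequence yields
  \<open>f\<^sub>0(D W) \<le> f\<^sub>0(W) - 1\<close>, \<open>f\<^sub>1(D W) \<le> f\<^sub>1(W) - 1\<close>, \<open>deg (K W) \<le> max (f\<^sub>2(D W) + 2) (f\<^sub>1(W))\<close> and
  \<open>f\<^sub>p(W) \<le> max (f\<^sub>p(D W) + 1) (deg (K W))\<close>. The theorem follows by induction on \<open>f\<^sub>0(W)\<close>.
  A projective is a summand of an induced module and hence Koszul acyclic, so the Koszul homology
  agrees with that of a resolution by dimension shifting.
\<close>

subsection \<open>The Koszul complex\<close>

text \<open>The bound reproduces itself because the losses balance: passing to \<open>D W\<close>
  lowers both \<open>f\<^sub>0\<close> and \<open>f\<^sub>1\<close> by one, so the inductive bound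
  for \<open>f\<^sub>2(D W) + 2\<close> is again \<open>f\<^sub>0(W) + f\<^sub>1(W)\<close>, and
  that for \<open>f\<^sub>p(D W) + 1\<close> is even one smaller. The remaining term
  \<open>f\<^sub>1(W)\<close> is harmless since \<open>f\<^sub>0(W) \<ge> 0\<close> for nonzero
  \<open>W\<close>. As \<open>f\<^sub>2(D W)\<close> occurs for every \<open>p\<close>, one
  induction has to treat all homological degrees together; it starts where
  \<open>f\<^sub>0 = -\<infinity>\<close>, that is, at the zero module. Two properties of
  \<open>K W\<close> enter: its non-bijective maps vanish, and whether it vanishes at a set depends
  only on the cardinality. Both come from exchanging one point for another, so what is carried
  through the iterated derivatives is the one-point inclusions together with such exchanges, away
  from the points already shifted.\<close>

definition koszul_sign :: "nat \<Rightarrow> nat set \<Rightarrow> 'b::ab_group_add \<Rightarrow> 'b" where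
  "koszul_sign u U x = (if even (card {v \<in> U. v < u}) then x else - x)"

lemma koszul_sign_insert_less:
  assumes "finite U" "u \<notin> U" "u < v"
  shows "koszul_sign v (insert u U) x = - koszul_sign v U x"
proof -
  have "{w \<in> insert u U. w < v} = insert u {w \<in> U. w < v}"
    using assms by auto
  with assms show ?thesis
    by (simp add: koszul_sign_def)
qed

lemma koszul_sign_insert_greater: "v < u \<Longrightarrow> koszul_sign v (insert u U) x = koszul_sign v U x"
proof -
  assume "v < u"
  then have "{w \<in> insert u U. w < v} = {w \<in> U. w < v}"
    by auto
  then show ?thesis
    by (simp add: koszul_sign_def)
qed

lemma koszul_sign_below: "\<forall>v\<in>U. s < v \<Longrightarrow> koszul_sign s U x = x"
proof -
  assume "\<forall>v\<in>U. s < v"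
  then have "{v \<in> U. v < s} = {}"
    by auto
  then show ?thesis
    unfolding koszul_sign_def by (metis card.empty even_zero)
qed

lemma koszul_sign_zero [simp]: "koszul_sign u U 0 = 0"
  and koszul_sign_diff: "koszul_sign u U (x - y) = koszul_sign u U x - koszul_sign u U y"
  and koszul_sign_uminus: "koszul_sign u U (- x) = - koszul_sign u U x"
  and koszul_sign_koszul_sign [simp]: "koszul_sign u U (koszul_sign u U x) = x"
  by (simp_all add: koszul_sign_def)

lemma koszul_sign_sum: "koszul_sign u U (sum f I) = (\<Sum>i\<in>I. koszul_sign u U (f i))"
  by (simp add: koszul_sign_def sum_negf)

text \<open>Each unordered pair contributes \<open>g u v + g v u = 0\<close>. Cancelling pairs,
  instead of showing that the sum equals its own negative, keeps the argument valid in the presence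
  of 2-torsion.\<close>

lemma sum_antisym:
  fixes g :: "nat \<Rightarrow> nat \<Rightarrow> 'b::ab_group_add"
  assumes "finite A" and "\<And>u v. u \<in> A \<Longrightarrow> v \<in> A \<Longrightarrow> u < v \<Longrightarrow> g v u = - g u v"
  shows "(\<Sum>u\<in>A. \<Sum>v\<in>A - {u}. g u v) = 0"
  using assms
proof (induction A rule: finite_induct)
  case (insert a A)
  have flip: "g b a = - g a b" if "b \<in> A" for b
    using insert.prems[of a b] insert.prems[of b a] that insert.hyps
    by (cases a b rule: linorder_cases) auto
  have "(\<Sum>v\<in>insert a A - {u}. g u v) = g u a + (\<Sum>v\<in>A - {u}. g u v)" if "u \<in> A" for u
  proof -
    have "insert a A - {u} = insert a (A - {u})"
      using that insert.hyps by auto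
    then show ?thesis
      using insert.hyps by simp
  qed
  then have "(\<Sum>u\<in>insert a A. \<Sum>v\<in>insert a A - {u}. g u v)
      = (\<Sum>v\<in>A. g a v) + (\<Sum>u\<in>A. g u a + (\<Sum>v\<in>A - {u}. g u v))"
    using insert.hyps by (simp add: insert_Diff_if)
  also have "\<dots> = (\<Sum>v\<in>A. g a v) + (\<Sum>u\<in>A. g u a)"
    using insert by (simp add: sum.distrib)
  also have "\<dots> = 0"
    using flip by (simp add: sum_negf)
  finally show ?case .
qed simp

text \<open>
  The chains are \<open>\<Oplus>\<^bsub>U \<subseteq> T, |U| = p\<^esub> V\<^bsub>T - U\<^esub>\<close>, a chain \<open>c\<close> having the component \<open>c U\<close> in
  \<open>V\<^bsub>T - U\<^esub>\<close>; for an FI-module \<open>V\<close> its homology is \<open>H\<^sub>p(V)\<^sub>T\<close>. The values of \<open>c\<close> at other sets are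
  irrelevant.
\<close>

definition koszul_bd :: "(nat set \<Rightarrow> nat \<Rightarrow> 'b \<Rightarrow> 'b) \<Rightarrow> nat set \<Rightarrow> (nat set \<Rightarrow> 'b) \<Rightarrow> nat set \<Rightarrow>
  'b::ab_group_add"
  where "koszul_bd X T c U = (\<Sum>u\<in>T - U. koszul_sign u U (X (T - U - {u}) u (c (insert u U))))"

text \<open>Vanishing of the homology in degree \<open>q + 1\<close>, the chain groups being taken modulo \<open>R\<close>.\<close>

definition koszul_exact :: "(nat set \<Rightarrow> 'b::ab_group_add set) \<Rightarrow> (nat set \<Rightarrow> nat \<Rightarrow> 'b \<Rightarrow> 'b) \<Rightarrow> nat set
  \<Rightarrow> nat \<Rightarrow> bool"
  where "koszul_exact R X T q \<longleftrightarrow>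
    (\<forall>c. (\<forall>U\<subseteq>T. card U = q \<longrightarrow> koszul_bd X T c U \<in> R (T - U)) \<longrightarrow>
      (\<exists>b. \<forall>U\<subseteq>T. card U = Suc q \<longrightarrow> c U - koszul_bd X T b U \<in> R (T - U)))"

text \<open>The preimage in \<open>'b\<close> of the image of the Koszul boundary in degree 0; that
  it is \<open>UNIV\<close> means that H_0 vanishes at \<open>T\<close>.\<close>

definition decomposable :: "(nat set \<Rightarrow> 'b::ab_group_add set) \<Rightarrow> (nat set \<Rightarrow> nat \<Rightarrow> 'b \<Rightarrow> 'b) \<Rightarrow> nat set
  \<Rightarrow> 'b set"
  where "decomposable R X T = {x. \<exists>b. x - (\<Sum>u\<in>T. X (T - {u}) u (b u)) \<in> R T}"

text \<open>
  The derivative \<open>D V = coker (V \<rightarrow> S V)\<close>, where \<open>(S V)\<^sub>S = V\<^bsub>S \<union> {s}\<^esub>\<close>.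
\<close>

definition deriv_rel :: "nat \<Rightarrow> (nat set \<Rightarrow> 'b::ab_group_add set) \<Rightarrow> (nat set \<Rightarrow> nat \<Rightarrow> 'b \<Rightarrow> 'b) \<Rightarrow> nat
  set \<Rightarrow> 'b set"
  where "deriv_rel s R X S = {x. \<exists>y. x - X S s y \<in> R (insert s S)}"

definition deriv_map :: "nat \<Rightarrow> (nat set \<Rightarrow> nat \<Rightarrow> 'b \<Rightarrow> 'b) \<Rightarrow> nat set \<Rightarrow> nat \<Rightarrow> 'b \<Rightarrow> 'b"
  where "deriv_map s X S u = X (insert s S) u"

text \<open>
  The group \<open>V\<^sub>S\<close> is presented as the quotient of the whole type \<open>'b\<close> by \<open>R S\<close>, and \<open>X S u\<close> lifts
  \<open>V\<^sub>S \<rightarrow> V\<^bsub>S \<union> {u}\<^esub>\<close>. In this form a derivative lives in the same type as the module, which makes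
  induction over iterated derivatives possible.
\<close>

locale presented_module =
  fixes R :: "nat set \<Rightarrow> 'b::ab_group_add set" and X :: "nat set \<Rightarrow> nat \<Rightarrow> 'b \<Rightarrow> 'b"
  assumes R_zero [simp]: "0 \<in> R S"
    and R_diff: "x \<in> R S \<Longrightarrow> y \<in> R S \<Longrightarrow> x - y \<in> R S"
    and X_diff: "X S u (x - y) = X S u x - X S u y"
    and X_R: "x \<in> R S \<Longrightarrow> X S u x \<in> R (insert u S)"
    and X_comm: "X (insert u S) v (X S u x) = X (insert v S) u (X S v x)"
begin

lemma R_uminus: "x \<in> R S \<Longrightarrow> - x \<in> R S"
  using R_diff[of 0 S x] by simp

lemma R_uminus_iff [simp]: "- x \<in> R S \<longleftrightarrow> x \<in> R S"
  using R_uminus by fastforce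

lemma R_add: "x \<in> R S \<Longrightarrow> y \<in> R S \<Longrightarrow> x + y \<in> R S"
  using R_diff[of x S "- y"] by (simp add: R_uminus)

lemma R_add_left: "x \<in> R S \<Longrightarrow> x + y \<in> R S \<longleftrightarrow> y \<in> R S"
  using R_add[of x S y] R_diff[of "x + y" S x] by auto

lemma R_add_right: "y \<in> R S \<Longrightarrow> x + y \<in> R S \<longleftrightarrow> x \<in> R S"
  using R_add_left[of y S x] by (simp add: add.commute)

lemma R_diff_left: "x \<in> R S \<Longrightarrow> x - y \<in> R S \<longleftrightarrow> y \<in> R S"
  using R_add_left[of x S "- y"] by simp

lemma R_diff_right: "y \<in> R S \<Longrightarrow> x - y \<in> R S \<longleftrightarrow> x \<in> R S"
  using R_add_right[of "- y" S x] by simp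

lemma R_sum: "(\<And>i. i \<in> I \<Longrightarrow> f i \<in> R S) \<Longrightarrow> sum f I \<in> R S"
  by (induction I rule: infinite_finite_induct) (auto intro: R_add)

lemma R_koszul_sign [simp]: "koszul_sign u U x \<in> R S \<longleftrightarrow> x \<in> R S"
  by (simp add: koszul_sign_def)

lemma X_zero [simp]: "X S u 0 = 0"
  using X_diff[of S u 0 0] by simp

lemma X_uminus: "X S u (- x) = - X S u x"
  using X_diff[of S u 0 x] by simp

lemma X_add: "X S u (x + y) = X S u x + X S u y"
  using X_diff[of S u x "- y"] by (simp add: X_uminus)

lemma X_sum: "X S u (sum f I) = (\<Sum>i\<in>I. X S u (f i))"
  by (induction I rule: infinite_finite_induct) (auto simp: X_add)

lemma X_koszul_sign: "X S u (koszul_sign v U x) = koszul_sign v U (X S u x)"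
  by (simp add: koszul_sign_def X_uminus)

lemma koszul_bd_diff: "koszul_bd X T (\<lambda>U. c U - e U) U = koszul_bd X T c U - koszul_bd X T e U"
  by (simp add: koszul_bd_def X_diff koszul_sign_diff sum_subtractf)

lemma koszul_bd_R:
  assumes "finite T" "U \<subseteq> T" "\<And>u. u \<in> T - U \<Longrightarrow> c (insert u U) \<in> R (T - insert u U)"
  shows "koszul_bd X T c U \<in> R (T - U)"
  unfolding koszul_bd_def
proof (rule R_sum)
  fix u assume u: "u \<in> T - U"
  have "T - insert u U = T - U - {u}" "insert u (T - U - {u}) = T - U"
    using u by auto
  with assms(3)[OF u] X_R show "koszul_sign u U (X (T - U - {u}) u (c (insert u U))) \<in> R (T - U)"
    by (metis R_koszul_sign)
qed

text \<open>Since \<open>X_comm\<close> is an identity of the lifts themselves, the cancellation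
  takes place in \<open>'b\<close> and not just modulo \<open>R\<close>; the two orders of adding
  \<open>u\<close> and \<open>v\<close> carry opposite signs.\<close>

lemma koszul_bd_koszul_bd:
  assumes "finite T" "U \<subseteq> T"
  shows "koszul_bd X T (koszul_bd X T c) U = 0"
proof -
  define g where "g u v = koszul_sign u U (koszul_sign v (insert u U)
      (X (T - U - {u}) u (X (T - U - {u} - {v}) v (c (insert v (insert u U))))))" for u v
  have fin: "finite U"
    using assms finite_subset by blast
  have "koszul_bd X T (koszul_bd X T c) U = (\<Sum>u\<in>T - U. \<Sum>v\<in>T - U - {u}. g u v)"
    unfolding koszul_bd_def g_def X_sum koszul_sign_sum X_koszul_sign by (simp add: Diff_insert[of
      T _ U])
  also have "\<dots> = 0"
  proof (rule sum_antisym)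
    fix u v assume uv: "u \<in> T - U" "v \<in> T - U" "u < v"
    define S where "S = T - U - {u} - {v}"
    have S: "T - U - {u} = insert v S" "T - U - {v} = insert u S"
        "insert v S - {v} = S" "insert u S - {u} = S"
      using uv by (auto simp: S_def)
    have "X (insert v S) u (X S v x) = X (insert u S) v (X S u x)" for x
      by (rule X_comm)
    moreover have "koszul_sign u U (koszul_sign v (insert u U) y) = - koszul_sign v U (koszul_sign
      u (insert v U) y)" for y :: 'b
      using uv fin by (simp add: koszul_sign_insert_less koszul_sign_insert_greater
        koszul_sign_uminus) (simp add: koszul_sign_def)
    ultimately show "g v u = - g u v"
      unfolding g_def S insert_commute[of v u U] by simp
  qed (use assms in simp)
  finally show ?thesis .
qed

lemma presented_module_der: "presented_module (deriv_rel s R X) (deriv_map s X)"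
proof
  fix S x y u
  show "0 \<in> deriv_rel s R X S"
    by (auto simp: deriv_rel_def intro!: exI[of _ 0])
  {
    assume "x \<in> deriv_rel s R X S" "y \<in> deriv_rel s R X S"
    then obtain x' y' where "x - X S s x' \<in> R (insert s S)" "y - X S s y' \<in> R (insert s S)"
      by (auto simp: deriv_rel_def)
    then have "(x - X S s x') - (y - X S s y') \<in> R (insert s S)"
      by (rule R_diff)
    then show "x - y \<in> deriv_rel s R X S"
      unfolding deriv_rel_def by (auto intro!: exI[of _ "x' - y'"] simp: X_diff algebra_simps)
  }
  show "deriv_map s X S u (x - y) = deriv_map s X S u x - deriv_map s X S u y"
    by (simp add: deriv_map_def X_diff)
  {
    assume "x \<in> deriv_rel s R X S"
    then obtain x' where "x - X S s x' \<in> R (insert s S)"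
      by (auto simp: deriv_rel_def)
    then have "X (insert s S) u x - X (insert s S) u (X S s x') \<in> R (insert u (insert s S))"
      using X_R X_diff by metis
    then show "deriv_map s X S u x \<in> deriv_rel s R X (insert u S)"
      unfolding deriv_rel_def deriv_map_def X_comm[of s S u]
      by (auto simp: insert_commute)
  }
  fix v
  show "deriv_map s X (insert u S) v (deriv_map s X S u x) = deriv_map s X (insert v S) u
    (deriv_map s X S v x)"
    unfolding deriv_map_def using X_comm[of u "insert s S" v x] by (simp add: insert_commute)
qed

end

text \<open>
  As \<open>s\<close> lies below \<open>T\<close>, the Koszul complex at \<open>T \<union> {s}\<close> is, with these signs, the mapping cone of the
  map of complexes at \<open>T\<close> induced by \<open>V \<rightarrow> S V\<close>.
\<close>

locale derivative_step = presented_module R X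
  for R :: "nat set \<Rightarrow> 'b::ab_group_add set" and X +
  fixes s :: nat and T :: "nat set"
  assumes fin: "finite T" and below: "\<And>t. t \<in> T \<Longrightarrow> s < t"
begin

abbreviation "R' \<equiv> deriv_rel s R X"
abbreviation "X' \<equiv> deriv_map s X"
abbreviation "Ts \<equiv> insert s T"

lemma s_notin: "s \<notin> T"
  using below by blast

text \<open>The components at sets without \<open>s\<close> form the \<open>S V\<close> part of the
  cone. The formula \<open>X'\<close> serves both \<open>S V\<close> and \<open>D V\<close>, which
  differ only in their relations, \<open>R (insert s S)\<close> against \<open>R' S\<close>.\<close>

lemma koszul_bd_bottom:
  assumes "U \<subseteq> T"
  shows "koszul_bd X Ts c U = X (T - U) s (c (insert s U)) + koszul_bd X' T c U"
proof -
  have "Ts - U = insert s (T - U)" "Ts - U - {s} = T - U" and s: "s \<notin> T - U"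
    using assms s_notin by auto
  moreover have "Ts - U - {u} = insert s (T - U - {u})" if "u \<in> T - U" for u
    using that assms s_notin by auto
  moreover have "koszul_sign s U x = x" for x :: 'b
    by (rule koszul_sign_below) (use assms below in auto)
  ultimately show ?thesis
    using fin by (simp add: koszul_bd_def deriv_map_def)
qed

lemma koszul_bd_top:
  assumes "U \<subseteq> T"
  shows "koszul_bd X Ts c (insert s U) = - koszul_bd X T (\<lambda>U. c (insert s U)) U"
proof -
  have "Ts - insert s U = T - U" "finite U" "s \<notin> U"
    using assms s_notin fin finite_subset by auto
  moreover have "koszul_sign u (insert s U) x = - koszul_sign u U x" if "u \<in> T - U" for u and x ::
    'b
    by (rule koszul_sign_insert_less) (use calculation that below in auto)
  ultimately show ?thesis
    by (simp add: koszul_bd_def sum_negf insert_commute)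
qed

lemma Ts_diff: "U \<subseteq> T \<Longrightarrow> Ts - U = insert s (T - U)" "U \<subseteq> T \<Longrightarrow> Ts - insert s U = T - U"
  using s_notin by auto

text \<open>The components of \<open>b\<close> at subsets of \<open>T\<close> form a cycle of
  \<open>D V\<close>, hence a boundary; lifting it to \<open>e\<close> clears them and forces the
  other components into \<open>K V\<close>. The cycle condition is imposed only at subsets of
  \<open>T\<close> because \<open>kernel_zero\<close> applies this to a chain whose boundary at
  \<open>{s}\<close> is still to be determined.\<close>

lemma reduce_to_kernel:
  assumes van': "koszul_exact R' X' T q"
    and cyc: "\<And>U. U \<subseteq> T \<Longrightarrow> card U = q \<Longrightarrow> koszul_bd X Ts b U \<in> R (Ts - U)"
  obtains e where
    "\<And>U. U \<subseteq> T \<Longrightarrow> card U = Suc q \<Longrightarrow> b U - koszul_bd X Ts e U \<in> R (Ts - U)"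
    "\<And>U. U \<subseteq> T \<Longrightarrow> card U = q \<Longrightarrow>
      X (T - U) s (b (insert s U) - koszul_bd X Ts e (insert s U)) \<in> R (insert s (T - U))"
proof -
  have "koszul_bd X' T b U \<in> R' (T - U)" if "U \<subseteq> T" "card U = q" for U
  proof -
    have "X (T - U) s (b (insert s U)) + koszul_bd X' T b U \<in> R (insert s (T - U))"
      using cyc[OF that] that by (simp add: koszul_bd_bottom Ts_diff)
    then show ?thesis
      unfolding deriv_rel_def
      by (auto intro!: exI[of _ "- b (insert s U)"] simp: X_uminus add.commute)
  qed
  then obtain e0 where "\<forall>U\<subseteq>T. card U = Suc q \<longrightarrow> b U - koszul_bd X' T e0 U \<in> R' (T - U)"
    using van' unfolding koszul_exact_def by blast
  then have "\<forall>U. \<exists>y. U \<subseteq> T \<longrightarrow> card U = Suc q \<longrightarrow>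
      b U - koszul_bd X' T e0 U - X (T - U) s y \<in> R (insert s (T - U))"
    by (auto simp: deriv_rel_def)
  then obtain y where y: "\<And>U. U \<subseteq> T \<Longrightarrow> card U = Suc q \<Longrightarrow>
      b U - koszul_bd X' T e0 U - X (T - U) s (y U) \<in> R (insert s (T - U))"
    by metis
  \<comment> \<open>The component \<open>y U\<close> at \<open>insert s U\<close> absorbs the error
    \<open>X (T - U) s (y U)\<close> by which the boundary of \<open>e0\<close> misses
    \<open>b U\<close> in \<open>S V\<close>.\<close>
  define e where "e W = (if s \<in> W then y (W - {s}) else e0 W)" for W
  have e: "koszul_bd X Ts e U = X (T - U) s (y U) + koszul_bd X' T e0 U" if "U \<subseteq> T" for U
  proof -
    have "s \<notin> U"
      using that s_notin by auto
    moreover have "koszul_bd X' T e U = koszul_bd X' T e0 U"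
      unfolding koszul_bd_def
    proof (rule sum.cong)
      fix u assume "u \<in> T - U"
      then have "s \<notin> insert u U"
        using \<open>s \<notin> U\<close> s_notin by auto
      then show "koszul_sign u U (X' (T - U - {u}) u (e (insert u U)))
          = koszul_sign u U (X' (T - U - {u}) u (e0 (insert u U)))"
        unfolding e_def by presburger
    qed simp
    ultimately show ?thesis
      using koszul_bd_bottom[OF that, of e] by (simp add: e_def)
  qed
  have 1: "b U - koszul_bd X Ts e U \<in> R (Ts - U)" if "U \<subseteq> T" "card U = Suc q" for U
    using y[OF that] that(1) by (simp add: e Ts_diff algebra_simps)
  have 2: "X (T - U) s (b (insert s U) - koszul_bd X Ts e (insert s U)) \<in> R (insert s (T - U))"
    if U: "U \<subseteq> T" "card U = q" for U
  proof -
    let ?b = "\<lambda>U. b U - koszul_bd X Ts e U"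
    have "koszul_bd X Ts ?b U = koszul_bd X Ts b U"
      using koszul_bd_koszul_bd[of Ts U e] U fin by (simp add: koszul_bd_diff subset_insertI2)
    then have "X (T - U) s (?b (insert s U)) + koszul_bd X' T ?b U \<in> R (insert s (T - U))"
      using cyc[OF U] koszul_bd_bottom[OF U(1), of ?b] U by (simp add: Ts_diff)
    moreover have "koszul_bd X' T ?b U \<in> R (insert s (T - U))"
      unfolding koszul_bd_def[of X' T ?b]
    proof (rule R_sum)
      fix u assume u: "u \<in> T - U"
      have *: "insert u U \<subseteq> T" "card (insert u U) = Suc q"
        using u U fin finite_subset[OF U(1) fin] by auto
      have "Ts - insert u U = insert s (T - U - {u})"
        "insert u (insert s (T - U - {u})) = insert s (T - U)"
        using u U s_notin by auto
      then have "X (insert s (T - U - {u})) u (?b (insert u U)) \<in> R (insert s (T - U))"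
        using X_R[OF 1[OF *], of u] by simp
      then show "koszul_sign u U (X' (T - U - {u}) u (?b (insert u U))) \<in> R (insert s (T - U))"
        by (simp add: deriv_map_def)
    qed
    ultimately show ?thesis
      by (simp add: R_add_right)
  qed
  show ?thesis
    using that 1 2 by blast
qed

text \<open>Exactness of H_q(K V) -> H_{q+1}(V) -> H_{q+1}(D V), the outer terms at
  \<open>T\<close>, the middle one at \<open>Ts\<close>. The chains of \<open>K V\<close> in degree
  q are its values at \<open>T - U\<close> with \<open>card U = q\<close>, and \<open>inj\<close>
  makes them zero.\<close>

lemma koszul_exact_step:
  assumes van': "koszul_exact R' X' T q"
    and inj: "\<And>U x. U \<subseteq> T \<Longrightarrow> card U = q \<Longrightarrow> X (T - U) s x \<in> R (insert s (T - U)) \<Longrightarrow> x \<in> R (T - U)"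
  shows "koszul_exact R X Ts q"
  unfolding koszul_exact_def
proof (intro allI impI)
  fix c assume "\<forall>U\<subseteq>Ts. card U = q \<longrightarrow> koszul_bd X Ts c U \<in> R (Ts - U)"
  then have "koszul_bd X Ts c U \<in> R (Ts - U)" if "U \<subseteq> T" "card U = q" for U
    using that by (simp add: subset_insertI2)
  then obtain e where e: "\<And>U. U \<subseteq> T \<Longrightarrow> card U = Suc q \<Longrightarrow> c U - koszul_bd X Ts e U \<in> R (Ts - U)"
    "\<And>U. U \<subseteq> T \<Longrightarrow> card U = q \<Longrightarrow>
      X (T - U) s (c (insert s U) - koszul_bd X Ts e (insert s U)) \<in> R (insert s (T - U))"
    using reduce_to_kernel[OF van'] by blast
  have "c U - koszul_bd X Ts e U \<in> R (Ts - U)" if U: "U \<subseteq> Ts" "card U = Suc q" for U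
  proof (cases "s \<in> U")
    case True
    define V where "V = U - {s}"
    have V: "V \<subseteq> T" "U = insert s V"
      using U True by (auto simp: V_def)
    have "finite U"
      using U(1) fin finite_subset by auto
    then have "card V = q"
      using U True by (simp add: V_def)
    then show ?thesis
      unfolding V(2) Ts_diff(2)[OF V(1)] using inj[OF V(1) _ e(2)[OF V(1)]] by simp
  next
    case False
    then show ?thesis
      using U by (intro e(1)) auto
  qed
  then show "\<exists>b. \<forall>U\<subseteq>Ts. card U = Suc q \<longrightarrow> c U - koszul_bd X Ts b U \<in> R (Ts - U)"
    by blast
qed

text \<open>There is no H_{-1}(K V), so H_1(V) maps onto H_1(D V): a cycle of \<open>D V\<close>
  becomes a cycle of \<open>V\<close> once a component at \<open>{s}\<close> is supplied.\<close>

lemma koszul_exact_0_der: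
  assumes "koszul_exact R X Ts 0"
  shows "koszul_exact R' X' T 0"
  unfolding koszul_exact_def
proof (intro allI impI)
  fix c assume "\<forall>U\<subseteq>T. card U = 0 \<longrightarrow> koszul_bd X' T c U \<in> R' (T - U)"
  then obtain y where y: "koszul_bd X' T c {} - X T s y \<in> R (insert s T)"
    unfolding deriv_rel_def by fastforce
  \<comment> \<open>The component \<open>- y\<close> cancels the part of the boundary that is zero
    only modulo the image of \<open>V\<close>.\<close>
  define c' where "c' W = (if W = {s} then - y else c W)" for W
  have "koszul_bd X' T c' {} = koszul_bd X' T c {}"
    unfolding koszul_bd_def by (rule sum.cong) (use s_notin in \<open>auto simp: c'_def\<close>)
  then have "koszul_bd X Ts c' {} \<in> R (Ts - {})"
    using y koszul_bd_bottom[of "{}" c'] by (simp add: c'_def X_uminus)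
  moreover have "U = {}" if "U \<subseteq> Ts" "card U = 0" for U
    using that fin finite_subset[of U Ts] by auto
  ultimately have "\<exists>b. \<forall>U\<subseteq>Ts. card U = Suc 0 \<longrightarrow> c' U - koszul_bd X Ts b U \<in> R (Ts - U)"
    using assms unfolding koszul_exact_def by metis
  then obtain b where b: "\<forall>U\<subseteq>Ts. card U = Suc 0 \<longrightarrow> c' U - koszul_bd X Ts b U \<in> R (Ts - U)"
    by blast
  have "c U - koszul_bd X' T b U \<in> R' (T - U)" if U: "U \<subseteq> T" "card U = Suc 0" for U
  proof -
    have "c' U - koszul_bd X Ts b U \<in> R (insert s (T - U))"
      using b U by (metis Ts_diff(1) subset_insertI2)
    moreover have "c' U = c U"
      using U s_notin by (auto simp: c'_def)
    ultimately show ?thesis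
      using koszul_bd_bottom[OF U(1), of b] unfolding deriv_rel_def
      by (auto intro!: exI[of _ "b (insert s U)"] simp: algebra_simps)
  qed
  then show "\<exists>b. \<forall>U\<subseteq>T. card U = Suc 0 \<longrightarrow> c U - koszul_bd X' T b U \<in> R' (T - U)"
    by blast
qed

text \<open>Exactness of H_2(D V) -> H_0(K V) -> H_1(V), the last term at \<open>Ts\<close>. By
  \<open>sym\<close>, what is killed by \<open>s\<close> is killed by every other point, so the
  non-bijective maps of \<open>K V\<close> vanish and H_0(K V) is \<open>K V\<close> itself.\<close>

lemma kernel_zero:
  assumes van': "koszul_exact R' X' T 1" and "koszul_exact R X Ts 0"
    and sym: "\<And>S u x. S \<subseteq> T \<Longrightarrow> u \<in> T - S \<Longrightarrow> X S s x \<in> R (insert s S) \<Longrightarrow> X S u x \<in> R (insert u S)"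
    and x: "X T s x \<in> R Ts"
  shows "x \<in> R T"
proof -
  \<comment> \<open>The image of \<open>x\<close> in H_1(V): a single component at
    \<open>{s}\<close>, which is a cycle because \<open>s\<close> kills \<open>x\<close>.\<close>
  define c where "c W = (if W = {s} then x else 0)" for W
  have "koszul_bd X Ts c {} = X T s x"
    using koszul_bd_bottom[of "{}" c] s_notin by (auto simp: c_def koszul_bd_def deriv_map_def
      intro!: sum.neutral)
  moreover have "U = {}" if "U \<subseteq> Ts" "card U = 0" for U
    using that fin finite_subset[of U Ts] by auto
  ultimately have "\<forall>U\<subseteq>Ts. card U = 0 \<longrightarrow> koszul_bd X Ts c U \<in> R (Ts - U)"
    using x by (metis Diff_empty)
  then obtain b where b: "\<forall>U\<subseteq>Ts. card U = Suc 0 \<longrightarrow> c U - koszul_bd X Ts b U \<in> R (Ts - U)"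
    using assms(2) unfolding koszul_exact_def by blast
  have "koszul_bd X Ts b U \<in> R (Ts - U)" if U: "U \<subseteq> T" "card U = 1" for U
  proof -
    have "c U = 0" "U \<subseteq> Ts"
      using U s_notin by (auto simp: c_def)
    then show ?thesis
      using b U by (metis One_nat_def R_uminus_iff diff_0)
  qed
  then obtain e where e: "\<And>U. U \<subseteq> T \<Longrightarrow> card U = Suc 1 \<Longrightarrow> b U - koszul_bd X Ts e U \<in> R (Ts - U)"
    "\<And>U. U \<subseteq> T \<Longrightarrow> card U = 1 \<Longrightarrow>
      X (T - U) s (b (insert s U) - koszul_bd X Ts e (insert s U)) \<in> R (insert s (T - U))"
    using reduce_to_kernel[OF van'] by blast
  let ?b = "\<lambda>U. b U - koszul_bd X Ts e U"
  \<comment> \<open>The components of \<open>?b\<close> at \<open>{s, u}\<close> lie in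
    \<open>K V\<close>, so \<open>sym\<close> annihilates each term; on the other hand this boundary
    agrees with \<open>x\<close> modulo \<open>R T\<close>.\<close>
  have "koszul_bd X Ts ?b {s} \<in> R T"
  proof -
    have "koszul_bd X Ts ?b {s} = - koszul_bd X T (\<lambda>U. ?b (insert s U)) {}"
      using koszul_bd_top[of "{}" ?b] by simp
    moreover have "koszul_bd X T (\<lambda>U. ?b (insert s U)) {} \<in> R T"
      unfolding koszul_bd_def[of X T "\<lambda>U. ?b (insert s U)"]
    proof (rule R_sum)
      fix u assume u: "u \<in> T - {}"
      then have "X (T - {u}) s (?b {s, u}) \<in> R (insert s (T - {u}))"
        using e(2)[of "{u}"] by simp
      then have "X (T - {u}) u (?b {s, u}) \<in> R (insert u (T - {u}))"
        using u sym[of "T - {u}" u] by auto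
      then show "koszul_sign u {} (X (T - {} - {u}) u (?b (insert s {u}))) \<in> R T"
        using u by (simp add: insert_absorb)
    qed
    ultimately show ?thesis
      by simp
  qed
  moreover have "koszul_bd X Ts ?b {s} = koszul_bd X Ts b {s}"
    using koszul_bd_koszul_bd[of Ts "{s}" e] fin by (simp add: koszul_bd_diff)
  moreover have "x - koszul_bd X Ts b {s} \<in> R T"
    using b[rule_format, of "{s}"] s_notin by (simp add: c_def)
  ultimately show ?thesis
    using R_diff_right by auto
qed

end

subsection \<open>Iterated derivatives and regularity\<close>

text \<open>
  Writing \<open>G\<^sub>S = 'b / R S\<close>, \<open>\<theta>\<close> is a map \<open>G\<^bsub>S \<union> {u}\<^esub> \<rightarrow> G\<^bsub>S \<union> V\<^esub>\<close>, natural in \<open>S\<close> away from \<open>B\<close>,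
  whose restriction to \<open>G\<^sub>S\<close> is \<open>j\<close>. With \<open>V = {v}\<close> it is a transposition, with \<open>V = {}\<close> a
  retraction of \<open>G\<^sub>S \<rightarrow> G\<^bsub>S \<union> {u}\<^esub>\<close>. Unlike the kernel of the latter map, such maps are inherited
  by derivatives.
\<close>

definition shift_map ::
  "(nat set \<Rightarrow> 'b::ab_group_add set) \<Rightarrow> (nat set \<Rightarrow> nat \<Rightarrow> 'b \<Rightarrow> 'b) \<Rightarrow> nat set \<Rightarrow> nat \<Rightarrow> nat set \<Rightarrow>
   (nat set \<Rightarrow> 'b \<Rightarrow> 'b) \<Rightarrow> (nat set \<Rightarrow> 'b \<Rightarrow> 'b) \<Rightarrow> bool"
  where "shift_map R X B u V j \<theta> \<longleftrightarrow> (\<forall>S. S \<inter> B = {} \<longrightarrow>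
     (\<forall>x y. \<theta> S (x - y) = \<theta> S x - \<theta> S y) \<and>
     (\<forall>x\<in>R (insert u S). \<theta> S x \<in> R (S \<union> V)) \<and>
     (\<forall>x. \<theta> S (X S u x) - j S x \<in> R (S \<union> V)) \<and>
     (\<forall>w y. w \<notin> S \<union> B \<longrightarrow>
        \<theta> (insert w S) (X (insert u S) w y) - X (S \<union> V) w (\<theta> S y) \<in> R (insert w (S \<union> V))))"

lemma shift_mapD:
  assumes "shift_map R X B u V j \<theta>" "S \<inter> B = {}"
  shows "\<theta> S (x - y) = \<theta> S x - \<theta> S y"
    and "x \<in> R (insert u S) \<Longrightarrow> \<theta> S x \<in> R (S \<union> V)"
    and "\<theta> S (X S u x) - j S x \<in> R (S \<union> V)"
    and "w \<notin> S \<Longrightarrow> w \<notin> B \<Longrightarrow>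
      \<theta> (insert w S) (X (insert u S) w y) - X (S \<union> V) w (\<theta> S y) \<in> R (insert w (S \<union> V))"
  using assms(1)[unfolded shift_map_def, rule_format, OF assms(2)] by simp_all

context presented_module
begin

lemma deriv_rel_I: "x \<in> R (insert s S) \<Longrightarrow> x \<in> deriv_rel s R X S"
  unfolding deriv_rel_def by (auto intro!: exI[of _ 0])

text \<open>\<open>\<theta>\<close> carries the vanishing element \<open>X S u x\<close> to
  \<open>j S x\<close>. For a transposition this says that the maps of the kernel vanish, for a
  retraction that the kernel itself is zero.\<close>

lemma shift_map_kernel:
  assumes "shift_map R X B u V j \<theta>" "S \<inter> B = {}" "X S u x \<in> R (insert u S)"
  shows "j S x \<in> R (S \<union> V)"
  using shift_mapD(2)[OF assms] shift_mapD(3)[OF assms(1,2), of x] by (simp add: R_diff_left)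

text \<open>Naturality at \<open>w = s\<close> makes \<open>\<theta> (insert s S)\<close> respect
  the image of the module in its shift, so it descends to the cokernel. The point \<open>s\<close>
  is then used up and joins the excluded set.\<close>

lemma shift_map_der:
  assumes tr: "shift_map R X B u V j \<theta>" and s: "s \<notin> B"
  shows "shift_map (deriv_rel s R X) (deriv_map s X) (insert s B) u V (\<lambda>S. j (insert s S)) (\<lambda>S. \<theta>
    (insert s S))"
  unfolding shift_map_def
proof (intro allI impI conjI ballI)
  fix S x y assume "S \<inter> insert s B = {}"
  then have S: "S \<inter> B = {}" "insert s S \<inter> B = {}" "s \<notin> S"
    using s by auto
  have eq: "insert s S \<union> V = insert s (S \<union> V)"
    by simp
  note t = shift_mapD[OF tr S(2), unfolded eq]
  show "\<theta> (insert s S) (x - y) = \<theta> (insert s S) x - \<theta> (insert s S) y"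
    by (rule t(1))
  show "\<theta> (insert s S) (deriv_map s X S u x) - j (insert s S) x \<in> deriv_rel s R X (S \<union> V)"
    unfolding deriv_map_def by (rule deriv_rel_I) (rule t(3))
  {
    assume "x \<in> deriv_rel s R X (insert u S)"
    then obtain z where "x - X (insert u S) s z \<in> R (insert u (insert s S))"
      by (auto simp: deriv_rel_def insert_commute)
    then have "\<theta> (insert s S) x - \<theta> (insert s S) (X (insert u S) s z) \<in> R (insert s (S \<union> V))"
      using t(1,2) by metis
    from R_add[OF this shift_mapD(4)[OF tr S(1) S(3) s, of z]]
    show "\<theta> (insert s S) x \<in> deriv_rel s R X (S \<union> V)"
      unfolding deriv_rel_def by auto
  }
  fix w assume w: "w \<notin> S \<union> insert s B"
  then have "w \<notin> insert s S" "w \<notin> B"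
    by auto
  from t(4)[OF this, of y]
  have "\<theta> (insert s (insert w S)) (X (insert s (insert u S)) w y)
      - X (insert s (S \<union> V)) w (\<theta> (insert s S) y) \<in> R (insert s (insert w (S \<union> V)))"
    by (simp add: insert_commute)
  then show "\<theta> (insert s (insert w S)) (deriv_map s X (insert u S) w y)
      - deriv_map s X (S \<union> V) w (\<theta> (insert s S) y) \<in> deriv_rel s R X (insert w (S \<union> V))"
    unfolding deriv_map_def by (rule deriv_rel_I)
qed

end

text \<open>One exchange is a left inverse of the other modulo relations; this one side is what
  reflects vanishing from \<open>insert v S\<close> back to \<open>insert u S\<close>.\<close>

definition sym_pair ::
  "(nat set \<Rightarrow> 'b::ab_group_add set) \<Rightarrow> (nat set \<Rightarrow> nat \<Rightarrow> 'b \<Rightarrow> 'b) \<Rightarrow> nat set \<Rightarrow> nat \<Rightarrow> nat \<Rightarrow> bool"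
  where "sym_pair R X B u v \<longleftrightarrow> (\<exists>\<theta> \<theta>'. shift_map R X B u {v} (\<lambda>S. X S v) \<theta> \<and>
     shift_map R X B v {u} (\<lambda>S. X S u) \<theta>' \<and>
     (\<forall>S x. S \<inter> B = {} \<longrightarrow> \<theta>' S (\<theta> S x) - x \<in> R (insert u S)))"

definition retractable ::
  "(nat set \<Rightarrow> 'b::ab_group_add set) \<Rightarrow> (nat set \<Rightarrow> nat \<Rightarrow> 'b \<Rightarrow> 'b) \<Rightarrow> nat set \<Rightarrow> nat \<Rightarrow> bool"
  where "retractable R X B u \<longleftrightarrow> (\<exists>\<theta>. shift_map R X B u {} (\<lambda>S x. x) \<theta>)"

text \<open>The points 1, ..., k are shifted in turn, and the k-th derivative is considered at
  subsets of \<open>{Suc k..}\<close>. The block \<open>{Suc k..k + m}\<close> stands for a set with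
  m elements; its least point \<open>Suc k\<close> is shifted next, as the sign convention of the
  cone demands.\<close>

primrec iter_deriv_map :: "nat \<Rightarrow> (nat set \<Rightarrow> nat \<Rightarrow> 'b \<Rightarrow> 'b) \<Rightarrow> nat set \<Rightarrow> nat \<Rightarrow> 'b \<Rightarrow> 'b" where
  "iter_deriv_map 0 X = X"
| "iter_deriv_map (Suc k) X = deriv_map (Suc k) (iter_deriv_map k X)"

primrec iter_deriv_rel :: "nat \<Rightarrow> (nat set \<Rightarrow> 'b::ab_group_add set) \<Rightarrow> (nat set \<Rightarrow> nat \<Rightarrow> 'b \<Rightarrow> 'b) \<Rightarrow>
  nat set \<Rightarrow> 'b set"
  where
  "iter_deriv_rel 0 R X = R"
| "iter_deriv_rel (Suc k) R X = deriv_rel (Suc k) (iter_deriv_rel k R X) (iter_deriv_map k X)"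

lemma atLeastAtMost_step: "insert (Suc k) {Suc (Suc k)..Suc k + m} = {Suc k..k + Suc m}"
  by auto

lemma koszul_exact_trivial:
  assumes "\<And>U. U \<subseteq> T \<Longrightarrow> card U = Suc q \<Longrightarrow> R (T - U) = UNIV"
  shows "koszul_exact R X T q"
  unfolding koszul_exact_def using assms by blast

context presented_module
begin

lemma sym_pair_der:
  assumes "sym_pair R X B u v" "s \<notin> B"
  shows "sym_pair (deriv_rel s R X) (deriv_map s X) (insert s B) u v"
proof -
  obtain \<theta> \<theta>' where t: "shift_map R X B u {v} (\<lambda>S. X S v) \<theta>" "shift_map R X B v {u} (\<lambda>S. X S u) \<theta>'"
    and i: "\<And>S x. S \<inter> B = {} \<Longrightarrow> \<theta>' S (\<theta> S x) - x \<in> R (insert u S)"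
    using assms(1) unfolding sym_pair_def by blast
  have "\<theta>' (insert s S) (\<theta> (insert s S) x) - x \<in> deriv_rel s R X (insert u S)"
    if "S \<inter> insert s B = {}" for S x
    by (rule deriv_rel_I) (use i[of "insert s S" x] that assms(2) in \<open>simp add: insert_commute\<close>)
  moreover note t[THEN shift_map_der, OF assms(2)]
  ultimately show ?thesis
    unfolding sym_pair_def deriv_map_def by blast
qed

lemma retractable_der:
  "retractable R X B u \<Longrightarrow> s \<notin> B \<Longrightarrow> retractable (deriv_rel s R X) (deriv_map s X) (insert s B) u"
  unfolding retractable_def using shift_map_der by fastforce

text \<open>Exchanging \<open>u\<close> for \<open>v\<close> commutes with adding \<open>s\<close>,
  so it takes the kernel at \<open>insert u S\<close> to the kernel at \<open>insert v S\<close>;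
  the one-sided inverse brings the vanishing back.\<close>

lemma kernel_move:
  assumes "sym_pair R X B u v" and S: "S \<inter> B = {}" and s: "s \<notin> B" "s \<notin> S"
    and zero: "\<And>x. X (insert v S) s x \<in> R (insert s (insert v S)) \<Longrightarrow> x \<in> R (insert v S)"
    and x: "X (insert u S) s x \<in> R (insert s (insert u S))"
  shows "x \<in> R (insert u S)"
proof -
  obtain \<theta> \<theta>' where t: "shift_map R X B u {v} (\<lambda>S. X S v) \<theta>" "shift_map R X B v {u} (\<lambda>S. X S u) \<theta>'"
    and i: "\<And>S x. S \<inter> B = {} \<Longrightarrow> \<theta>' S (\<theta> S x) - x \<in> R (insert u S)"
    using assms(1) unfolding sym_pair_def by blast
  have "insert s S \<inter> B = {}"
    using S s by auto
  then have "\<theta> (insert s S) (X (insert u S) s x) \<in> R (insert s (insert v S))"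
    using shift_mapD(2)[OF t(1), of "insert s S" "X (insert u S) s x"] x
    by (simp add: insert_commute)
  moreover have "\<theta> (insert s S) (X (insert u S) s x) - X (insert v S) s (\<theta> S x) \<in> R (insert s
    (insert v S))"
    using shift_mapD(4)[OF t(1) S s(2,1), of x] by (simp add: Un_commute)
  ultimately have "X (insert v S) s (\<theta> S x) \<in> R (insert s (insert v S))"
    using R_diff_left by blast
  then have "\<theta> S x \<in> R (insert v S)"
    by (rule zero)
  then have "\<theta>' S (\<theta> S x) \<in> R (insert u S)"
    using shift_mapD(2)[OF t(2) S] by (simp add: Un_commute)
  then show ?thesis
    using i[OF S] R_diff_left by blast
qed

text \<open>\<open>S\<close> is turned into \<open>T\<close> one point at a time, so exchanges of
  two points take the place of arbitrary bijections. \<open>C\<close> holds the points already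
  shifted, \<open>A\<close> those still free.\<close>

lemma kernel_transport:
  assumes sym: "\<And>u v. u \<in> A \<Longrightarrow> v \<in> A \<Longrightarrow> u \<noteq> v \<Longrightarrow> sym_pair R X (C \<union> {u, v}) u v"
    and A: "A \<inter> C = {}" "s \<notin> A" "s \<notin> C"
    and "finite S" "finite T" "S \<subseteq> A" "T \<subseteq> A" "card S = card T"
    and zero: "\<And>x. X T s x \<in> R (insert s T) \<Longrightarrow> x \<in> R T"
    and x: "X S s x \<in> R (insert s S)"
  shows "x \<in> R S"
  using assms(5-9) x
proof (induction "card (S - T)" arbitrary: S x)
  case 0
  then have "S = T"
    by (simp add: card_subset_eq)
  then show ?case
    using 0 zero by blast
next
  case (Suc n)
  then obtain u where u: "u \<in> S" "u \<notin> T"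
    by (metis Diff_iff card.empty ex_in_conv nat.distinct(1))
  have "\<not> T \<subseteq> S"
    using Suc.prems u by (metis card_subset_eq)
  then obtain v where v: "v \<in> T" "v \<notin> S"
    by blast
  define S0 where "S0 = S - {u}"
  have S0: "S = insert u S0" "u \<notin> S0" "v \<notin> S0" "finite S0" "S0 \<subseteq> A"
    using u v Suc.prems by (auto simp: S0_def)
  have "card (S - T) = Suc (card (insert v S0 - T))"
    unfolding S0(1) using S0 u v by (simp add: insert_Diff_if)
  then have *: "n = card (insert v S0 - T)"
    using Suc.hyps(2) by simp
  have "card (insert v S0) = card T"
    using S0 Suc.prems by simp
  then have zero': "y \<in> R (insert v S0)" if "X (insert v S0) s y \<in> R (insert s (insert v S0))" for y
    using Suc.hyps(1)[OF *] S0 v Suc.prems that by auto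
  show ?case
    unfolding S0(1)
  proof (rule kernel_move[where s = s and v = v and B = "C \<union> {u, v}"])
    show "sym_pair R X (C \<union> {u, v}) u v"
      using sym u v Suc.prems by auto
    show "S0 \<inter> (C \<union> {u, v}) = {}" "s \<notin> C \<union> {u, v}" "s \<notin> S0"
      using S0 A u v Suc.prems by auto
    show "X (insert u S0) s x \<in> R (insert s (insert u S0))"
      using Suc.prems S0(1) by simp
  qed (rule zero')
qed

text \<open>The summand at \<open>u = s\<close> lies in the image of the module in its shift and
  dies in the derivative; the other summands are already of the required form.\<close>

lemma decomposable_der:
  assumes "decomposable R X (insert s T) = UNIV" "finite T" "s \<notin> T"
  shows "decomposable (deriv_rel s R X) (deriv_map s X) T = UNIV"
proof -
  have "x \<in> decomposable (deriv_rel s R X) (deriv_map s X) T" for x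
  proof -
    have "x \<in> decomposable R X (insert s T)"
      using assms(1) by simp
    then obtain b where b: "x - (\<Sum>u\<in>insert s T. X (insert s T - {u}) u (b u)) \<in> R (insert s T)"
      unfolding decomposable_def by blast
    have "(\<Sum>u\<in>T. X (insert s T - {u}) u (b u)) = (\<Sum>u\<in>T. deriv_map s X (T - {u}) u (b u))"
    proof (rule sum.cong)
      fix u assume "u \<in> T"
      then have "insert s T - {u} = insert s (T - {u})"
        using assms(3) by auto
      then show "X (insert s T - {u}) u (b u) = deriv_map s X (T - {u}) u (b u)"
        by (simp add: deriv_map_def)
    qed simp
    then have "x - (\<Sum>u\<in>T. deriv_map s X (T - {u}) u (b u)) - X T s (b s) \<in> R (insert s T)"
      using b assms(2,3) by (simp add: algebra_simps)
    then show ?thesis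
      unfolding decomposable_def deriv_rel_def by blast
  qed
  then show ?thesis
    by blast
qed

text \<open>Nakayama for FI-modules: where H_0 vanishes at all finite sets, every element comes from
  smaller sets, and the value at the empty set is zero.\<close>

lemma R_UNIV:
  assumes decomposable: "\<And>T. finite T \<Longrightarrow> T \<subseteq> A \<Longrightarrow> decomposable R X T = UNIV" and "finite T" "T \<subseteq> A"
  shows "R T = UNIV"
  using assms(2,3)
proof (induction T rule: finite_psubset_induct)
  case (psubset T)
  have "x \<in> R T" for x
  proof -
    have "x \<in> decomposable R X T"
      using decomposable psubset by blast
    then obtain b where b: "x - (\<Sum>u\<in>T. X (T - {u}) u (b u)) \<in> R T"
      unfolding decomposable_def by blast
    have "X (T - {u}) u (b u) \<in> R T" if "u \<in> T" for u
    proof -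
      have "R (T - {u}) = UNIV"
        using psubset that by blast
      then show ?thesis
        using X_R[of "b u" "T - {u}" u] that by (simp add: insert_absorb)
    qed
    then have "(\<Sum>u\<in>T. X (T - {u}) u (b u)) \<in> R T"
      by (rule R_sum)
    then show ?thesis
      using b R_diff_right by blast
  qed
  then show ?case
    by blast
qed

lemma presented_module_it: "presented_module (iter_deriv_rel k R X) (iter_deriv_map k X)"
  by (induction k) (auto intro: presented_module.presented_module_der presented_module_axioms)

lemma derivative_step_it: "derivative_step (iter_deriv_rel k R X) (iter_deriv_map k X) (Suc k)
    {Suc (Suc k)..Suc k + m}"
  unfolding derivative_step_def derivative_step_axioms_def using presented_module_it by auto

lemma sym_pair_it:
  assumes "sym_pair R X {u, v} u v" "k < u" "k < v"
  shows "sym_pair (iter_deriv_rel k R X) (iter_deriv_map k X) ({1..k} \<union> {u, v}) u v"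
  using assms(2,3)
proof (induction k)
  case (Suc k)
  then have "sym_pair (iter_deriv_rel k R X) (iter_deriv_map k X) ({1..k} \<union> {u, v}) u v" "Suc k \<notin>
    {1..k} \<union> {u, v}"
    by auto
  note presented_module.sym_pair_der[OF presented_module_it this]
  moreover have "{1..Suc k} \<union> {u, v} = insert (Suc k) ({1..k} \<union> {u, v})"
    by auto
  ultimately show ?case
    by simp
qed (use assms in simp)

lemma retractable_it:
  assumes "retractable R X {u} u" "k < u"
  shows "retractable (iter_deriv_rel k R X) (iter_deriv_map k X) ({1..k} \<union> {u}) u"
  using assms(2)
proof (induction k)
  case (Suc k)
  then have "retractable (iter_deriv_rel k R X) (iter_deriv_map k X) ({1..k} \<union> {u}) u" "Suc k \<notin>
    {1..k} \<union> {u}"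
    by auto
  note presented_module.retractable_der[OF presented_module_it this]
  moreover have "{1..Suc k} \<union> {u} = insert (Suc k) ({1..k} \<union> {u})"
    by auto
  ultimately show ?case
    by simp
qed (use assms in simp)

text \<open>Retractions survive derivatives and make each kernel zero, so
  \<open>koszul_exact_step\<close> passes from m + 1 points to the next derivative at m points, down
  to the empty set, where there are no chains of positive degree.\<close>

theorem retractable_acyclic:
  assumes "\<And>u. u > 0 \<Longrightarrow> retractable R X {u} u"
  shows "koszul_exact R X {1..n} q"
proof -
  have "koszul_exact (iter_deriv_rel k R X) (iter_deriv_map k X) {Suc k..k + m} q" for m k
  proof (induction m arbitrary: k)
    case 0
    then show ?case
      by (intro koszul_exact_trivial) auto
  next
    case (Suc m)
    let ?T = "{Suc (Suc k)..Suc k + m}"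
    obtain \<theta> where t: "shift_map (iter_deriv_rel k R X) (iter_deriv_map k X) ({1..k} \<union> {Suc k})
      (Suc k) {} (\<lambda>S x. x) \<theta>"
      using retractable_it[OF assms, of "Suc k" k] unfolding retractable_def by auto
    have "koszul_exact (iter_deriv_rel k R X) (iter_deriv_map k X) (insert (Suc k) ?T) q"
    proof (rule derivative_step.koszul_exact_step[OF derivative_step_it])
      show "koszul_exact (deriv_rel (Suc k) (iter_deriv_rel k R X) (iter_deriv_map k X))
        (deriv_map (Suc k) (iter_deriv_map k X)) ?T q"
        using Suc[of "Suc k"] by simp
      fix U x
      assume "iter_deriv_map k X (?T - U) (Suc k) x \<in> iter_deriv_rel k R X (insert (Suc k) (?T -
        U))"
      then show "x \<in> iter_deriv_rel k R X (?T - U)"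
        using presented_module.shift_map_kernel[OF presented_module_it t, of "?T - U" x] by (simp
          add: disjoint_iff)
    qed
    then show ?case
      by (simp only: atLeastAtMost_step)
  qed
  from this[of 0 n] show ?thesis
    by simp
qed

text \<open>
  Here \<open>D\<close> and \<open>N\<close> are one more than the degrees of \<open>H\<^sub>0\<close> and \<open>H\<^sub>1\<close>. For the \<open>k\<close>-th derivative both drop
  by \<open>k\<close>, and the derivative vanishes from \<open>k = D\<close> on.
\<close>

theorem regularity:
  assumes sym: "\<And>u v. u > 0 \<Longrightarrow> v > 0 \<Longrightarrow> u \<noteq> v \<Longrightarrow> sym_pair R X {u, v} u v"
    and H0: "\<And>T. finite T \<Longrightarrow> D \<le> card T \<Longrightarrow> decomposable R X T = UNIV"
    and H1: "\<And>n. N \<le> int n \<Longrightarrow> koszul_exact R X {1..n} 0"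
    and n: "D = 0 \<or> int D + N + int q < int n + 2"
  shows "koszul_exact R X {1..n} q"
proof -
  have decomposable_it: "decomposable (iter_deriv_rel k R X) (iter_deriv_map k X) T = UNIV"
    if "finite T" "T \<subseteq> {Suc k..}" "D \<le> card T + k" for k T
    using that
  proof (induction k arbitrary: T)
    case 0
    then show ?case
      using H0 by simp
  next
    case (Suc k)
    have "Suc k \<notin> T"
      using Suc.prems(2) by auto
    moreover have "decomposable (iter_deriv_rel k R X) (iter_deriv_map k X) (insert (Suc k) T) =
      UNIV"
      using Suc.prems \<open>Suc k \<notin> T\<close> by (intro Suc.IH) auto
    ultimately show ?case
      using Suc.prems(1) presented_module.decomposable_der[OF presented_module_it] by simp
  qed
  have H1_it: "koszul_exact (iter_deriv_rel k R X) (iter_deriv_map k X) {Suc k..k + m} 0" if "N \<le>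
    int (m + k)" for k m
    using that
  proof (induction k arbitrary: m)
    case 0
    then show ?case
      using H1[of m] by simp
  next
    case (Suc k)
    have "koszul_exact (iter_deriv_rel k R X) (iter_deriv_map k X) {Suc k..k + Suc m} 0"
      using Suc.prems by (intro Suc.IH) simp
    from derivative_step.koszul_exact_0_der[OF derivative_step_it this[folded atLeastAtMost_step]]
      show ?case
      by simp
  qed
  \<comment> \<open>This is \<open>D' + N' + q < m + 2\<close> with \<open>D' = D - k\<close> and
    \<open>N' = N - k\<close>, written without truncated subtraction. \<open>m\<close> and
    \<open>q\<close> stay arbitrary, since the kernel at one stage calls for \<open>q = 1\<close> at
    the next.\<close>
  have "koszul_exact (iter_deriv_rel k R X) (iter_deriv_map k X) {Suc k..k + m} q"
    if "D \<le> k \<or> int D + N + int q < int m + 2 * int k + 2" for k m q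
    using that
  proof (induction "D - k" arbitrary: k m q)
    case 0
    \<comment> \<open>For \<open>D \<le> k\<close> the bound on H_0 leaves no set at all, not even
      the empty one.\<close>
    have "iter_deriv_rel k R X T = UNIV" if "finite T" "T \<subseteq> {Suc k..}" for T
      by (rule presented_module.R_UNIV[OF presented_module_it decomposable_it that]) (use 0 in auto)
    then show ?case
      by (intro koszul_exact_trivial) (simp add: subset_iff)
  next
    case (Suc l)
    from Suc.hyps(2) have k: "k < D" and l: "l = D - Suc k"
      by auto
    from k Suc.prems have bound: "int D + N + int q < int m + 2 * int k + 2"
      by auto
    show ?case
    proof (cases m)
      case 0
      then show ?thesis
        by (intro koszul_exact_trivial) auto
    next
      case (Suc m')
      let ?T = "\<lambda>m. {Suc (Suc k)..Suc k + m}"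
      have van': "koszul_exact (iter_deriv_rel (Suc k) R X) (iter_deriv_map (Suc k) X) (?T m'') q'"
        if "int D + N + int q' < int m'' + 2 * int k + 4" for m'' q'
        using Suc.hyps(1)[OF l, of q' m''] that by simp
      \<comment> \<open>\<open>kernel_zero\<close> asks for H_2 of the next derivative at
        \<open>m0\<close> points, i.e. \<open>D + N + 1 < m0 + 2k + 4\<close>, and for H_1 of this
        one at \<open>m0 + 1\<close> points, i.e. \<open>N \<le> m0 + 1 + k\<close>. The second
        follows from the first because \<open>k < D\<close>.\<close>
      have zero: "x \<in> iter_deriv_rel k R X (?T m0)"
        if m0: "int D + N < int m0 + 2 * int k + 3"
          and x: "iter_deriv_map k X (?T m0) (Suc k) x \<in> iter_deriv_rel k R X (insert (Suc k) (?T
            m0))" for m0 x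
      proof (rule derivative_step.kernel_zero[OF derivative_step_it])
        show "koszul_exact (deriv_rel (Suc k) (iter_deriv_rel k R X) (iter_deriv_map k X))
          (deriv_map (Suc k) (iter_deriv_map k X)) (?T m0) 1"
          using van'[of 1 m0] m0 by simp
        show "koszul_exact (iter_deriv_rel k R X) (iter_deriv_map k X) (insert (Suc k) (?T m0)) 0"
          unfolding atLeastAtMost_step using m0 k by (intro H1_it) simp
        fix S u y assume S: "S \<subseteq> ?T m0" "u \<in> ?T m0 - S"
          and y: "iter_deriv_map k X S (Suc k) y \<in> iter_deriv_rel k R X (insert (Suc k) S)"
        have "sym_pair (iter_deriv_rel k R X) (iter_deriv_map k X) ({1..k} \<union> {Suc k, u}) (Suc k) u"
          using S by (intro sym_pair_it sym) auto
        then obtain \<theta> where t: "shift_map (iter_deriv_rel k R X) (iter_deriv_map k X) ({1..k} \<union>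
          {Suc k, u}) (Suc k) {u}
            (\<lambda>S. iter_deriv_map k X S u) \<theta>"
          unfolding sym_pair_def by blast
        have "S \<inter> ({1..k} \<union> {Suc k, u}) = {}"
          using S by (fastforce simp: disjoint_iff)
        from presented_module.shift_map_kernel[OF presented_module_it t this y]
        show "iter_deriv_map k X S u y \<in> iter_deriv_rel k R X (insert u S)"
          by simp
      qed (rule x)
      have "koszul_exact (iter_deriv_rel k R X) (iter_deriv_map k X) (insert (Suc k) (?T m')) q"
      proof (rule derivative_step.koszul_exact_step[OF derivative_step_it])
        show "koszul_exact (deriv_rel (Suc k) (iter_deriv_rel k R X) (iter_deriv_map k X))
          (deriv_map (Suc k) (iter_deriv_map k X)) (?T m') q"
          using van'[of q m'] bound Suc by simp
        fix U x
        assume U: "U \<subseteq> ?T m'" "card U = q"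
          and x: "iter_deriv_map k X (?T m' - U) (Suc k) x \<in> iter_deriv_rel k R X (insert (Suc k)
            (?T m' - U))"
        \<comment> \<open>The kernel occurs at sets with \<open>m' - q\<close> points, and for
          \<open>m = m' + 1\<close> the assumed bound is precisely the condition of
          \<open>zero\<close> there.\<close>
        have "q \<le> m'"
          using card_mono[OF _ U(1)] U(2) by simp
        have c: "card (?T m' - U) = card (?T (m' - q))"
          using U finite_subset[OF U(1)] by (simp add: card_Diff_subset)
        show "x \<in> iter_deriv_rel k R X (?T m' - U)"
        proof (rule presented_module.kernel_transport[OF presented_module_it, where A = "{Suc (Suc
          k)..}" and C = "{1..k}"
              and s = "Suc k" and T = "?T (m' - q)"])
          show "sym_pair (iter_deriv_rel k R X) (iter_deriv_map k X) ({1..k} \<union> {u, v}) u v"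
            if "u \<in> {Suc (Suc k)..}" "v \<in> {Suc (Suc k)..}" "u \<noteq> v" for u v
            using that by (intro sym_pair_it sym) auto
          show "y \<in> iter_deriv_rel k R X (?T (m' - q))"
            if "iter_deriv_map k X (?T (m' - q)) (Suc k) y \<in> iter_deriv_rel k R X (insert (Suc k)
              (?T (m' - q)))" for y
            using zero[OF _ that] bound Suc \<open>q \<le> m'\<close> by simp
        qed (use c x in auto)
      qed
      then show ?thesis
        by (simp only: atLeastAtMost_step Suc)
    qed
  qed
  from this[of 0 q n] n show ?thesis
    by auto
qed

end

subsection \<open>Dimension shifting\<close>

text \<open>For \<open>0 \<rightarrow> Z' \<rightarrow> P \<rightarrow> Z \<rightarrow> 0\<close>
  this is injectivity of H_0(Z') -> H_0(P), which for acyclic \<open>P\<close> amounts to H_1(Z) =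
  0. Vanishing homology of a projective resolution appears in this shape.\<close>

definition reflects_decomposable where
  "reflects_decomposable N X R' X' \<delta> T \<longleftrightarrow> (\<forall>z. \<delta> T z \<in> decomposable N X T \<longrightarrow> z \<in> decomposable R' X'
    T)"

text \<open>
  The situation of \<open>0 \<rightarrow> Z' \<rightarrow> P \<rightarrow> Z \<rightarrow> 0\<close> with \<open>P = 'b / N\<close>, \<open>Z = 'b / R\<close> and \<open>Z' = 'b / R'\<close>, the first map
  being induced by \<open>\<delta>\<close>.
\<close>

locale syzygy_sequence = N: presented_module N X + R: presented_module R X + R': presented_module
  R' X'
  for N R R' :: "nat set \<Rightarrow> 'b::ab_group_add set" and X X' +
  fixes \<delta> :: "nat set \<Rightarrow> 'b \<Rightarrow> 'b"
  assumes \<delta>_diff: "\<delta> S (x - y) = \<delta> S x - \<delta> S y"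
    and \<delta>_X: "\<delta> (insert u S) (X' S u x) = X S u (\<delta> S x)"
    and R_iff: "finite S \<Longrightarrow> x \<in> R S \<longleftrightarrow> (\<exists>y. x - \<delta> S y \<in> N S)"
    and R'_iff: "finite S \<Longrightarrow> x \<in> R' S \<longleftrightarrow> \<delta> S x \<in> N S"
begin

lemma \<delta>_zero [simp]: "\<delta> S 0 = 0"
  using \<delta>_diff[of S 0 0] by simp

lemma \<delta>_uminus: "\<delta> S (- x) = - \<delta> S x"
  using \<delta>_diff[of S 0 x] by simp

lemma \<delta>_add: "\<delta> S (x + y) = \<delta> S x + \<delta> S y"
  using \<delta>_diff[of S x "- y"] by (simp add: \<delta>_uminus)

lemma \<delta>_sum: "\<delta> S (sum f I) = (\<Sum>i\<in>I. \<delta> S (f i))"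
  by (induction I rule: infinite_finite_induct) (auto simp: \<delta>_add)

lemma \<delta>_koszul_sign: "\<delta> S (koszul_sign u U x) = koszul_sign u U (\<delta> S x)"
  by (simp add: koszul_sign_def \<delta>_uminus)

lemma \<delta>_koszul_bd:
  assumes "U \<subseteq> T"
  shows "\<delta> (T - U) (koszul_bd X' T c U) = koszul_bd X T (\<lambda>U. \<delta> (T - U) (c U)) U"
  unfolding koszul_bd_def \<delta>_sum \<delta>_koszul_sign
proof (rule sum.cong)
  fix u assume "u \<in> T - U"
  then have "insert u (T - U - {u}) = T - U" "T - insert u U = T - U - {u}"
    by auto
  then show "koszul_sign u U (\<delta> (T - U) (X' (T - U - {u}) u (c (insert u U))))
      = koszul_sign u U (X (T - U - {u}) u (\<delta> (T - insert u U) (c (insert u U))))"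
    using \<delta>_X[of u "T - U - {u}"] by simp
qed simp

text \<open>The connecting map: if the image of \<open>c\<close> bounds \<open>b\<close> in
  \<open>P\<close>, then \<open>b\<close> is a cycle of \<open>Z\<close> one degree higher. Where it
  bounds in \<open>Z\<close>, the error of lifting that to \<open>P\<close> comes from a chain
  \<open>g\<close> of \<open>Z'\<close>, and \<open>g\<close> bounds \<open>c\<close>. The case
  \<open>q = 0\<close>, about which \<open>koszul_exact\<close> for \<open>Z'\<close> says nothing,
  is included.\<close>

lemma boundary_of_lifted:
  assumes T: "finite T" and koszul_exact: "koszul_exact R X T q"
    and b: "\<And>U. U \<subseteq> T \<Longrightarrow> card U = q \<Longrightarrow> \<delta> (T - U) (c U) - koszul_bd X T b U \<in> N (T - U)"
  shows "\<exists>g. \<forall>U\<subseteq>T. card U = q \<longrightarrow> c U - koszul_bd X' T g U \<in> R' (T - U)"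
proof -
  have "koszul_bd X T b U \<in> R (T - U)" if "U \<subseteq> T" "card U = q" for U
  proof -
    have "koszul_bd X T b U - \<delta> (T - U) (c U) \<in> N (T - U)"
      using b[OF that] N.R_uminus by fastforce
    then show ?thesis
      using R_iff T by blast
  qed
  then obtain e where "\<forall>U\<subseteq>T. card U = Suc q \<longrightarrow> b U - koszul_bd X T e U \<in> R (T - U)"
    using koszul_exact unfolding koszul_exact_def by blast
  then have "\<forall>U. \<exists>y. U \<subseteq> T \<longrightarrow> card U = Suc q \<longrightarrow>
      b U - koszul_bd X T e U - \<delta> (T - U) y \<in> N (T - U)"
    using R_iff[OF finite_Diff[OF T]] by meson
  then obtain g where g: "\<And>U. U \<subseteq> T \<Longrightarrow> card U = Suc q \<Longrightarrow>
      b U - koszul_bd X T e U - \<delta> (T - U) (g U) \<in> N (T - U)"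
    by metis
  have "c U - koszul_bd X' T g U \<in> R' (T - U)" if U: "U \<subseteq> T" "card U = q" for U
  proof -
    let ?h = "\<lambda>U. b U - koszul_bd X T e U - \<delta> (T - U) (g U)"
    have "koszul_bd X T ?h U \<in> N (T - U)"
    proof (rule N.koszul_bd_R[OF T U(1)])
      fix u assume "u \<in> T - U"
      then show "?h (insert u U) \<in> N (T - insert u U)"
        using U finite_subset[OF U(1) T] g[of "insert u U"] by simp
    qed
    moreover have "koszul_bd X T ?h U = koszul_bd X T b U - \<delta> (T - U) (koszul_bd X' T g U)"
      by (simp add: N.koszul_bd_diff N.koszul_bd_koszul_bd[OF T U(1)] \<delta>_koszul_bd[OF U(1)])
    ultimately have "koszul_bd X T b U - \<delta> (T - U) (koszul_bd X' T g U) \<in> N (T - U)"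
      by simp
    from N.R_add[OF b[OF U] this] show ?thesis
      using T by (simp add: R'_iff \<delta>_diff)
  qed
  then show ?thesis
    by blast
qed

text \<open>Exactness of H_{q+2}(Z) -> H_{q+1}(Z') -> H_{q+1}(P).\<close>

lemma koszul_exact_shift:
  assumes T: "finite T" and "koszul_exact R X T (Suc q)" "koszul_exact N X T q"
  shows "koszul_exact R' X' T q"
  unfolding koszul_exact_def
proof (intro allI impI)
  fix c assume c: "\<forall>U\<subseteq>T. card U = q \<longrightarrow> koszul_bd X' T c U \<in> R' (T - U)"
  have "koszul_bd X T (\<lambda>U. \<delta> (T - U) (c U)) U \<in> N (T - U)" if "U \<subseteq> T" "card U = q" for U
    using c that T by (simp add: \<delta>_koszul_bd[symmetric] R'_iff[symmetric])
  then obtain b where "\<forall>U\<subseteq>T. card U = Suc q \<longrightarrow> \<delta> (T - U) (c U) - koszul_bd X T b U \<in> N (T - U)"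
    using assms(3) unfolding koszul_exact_def by blast
  then show "\<exists>b. \<forall>U\<subseteq>T. card U = Suc q \<longrightarrow> c U - koszul_bd X' T b U \<in> R' (T - U)"
    using boundary_of_lifted[OF T assms(2)] by blast
qed

lemma koszul_bd_empty: "koszul_bd Y T c {} = (\<Sum>u\<in>T. Y (T - {u}) u (c {u}))"
  by (simp add: koszul_bd_def koszul_sign_def)

text \<open>Exactness of H_1(Z) -> H_0(Z') -> H_0(P).\<close>

lemma reflects_decomposable_if_koszul_exact:
  assumes T: "finite T" and "koszul_exact R X T 0"
  shows "reflects_decomposable N X R' X' \<delta> T"
  unfolding reflects_decomposable_def
proof (intro allI impI)
  fix z assume "\<delta> T z \<in> decomposable N X T"
  then obtain b where b: "\<delta> T z - (\<Sum>u\<in>T. X (T - {u}) u (b u)) \<in> N T"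
    unfolding decomposable_def by blast
  have "\<exists>g. \<forall>U\<subseteq>T. card U = 0 \<longrightarrow> z - koszul_bd X' T g U \<in> R' (T - U)"
  proof (rule boundary_of_lifted[OF assms])
    fix U assume "U \<subseteq> T" "card U = 0"
    then have "U = {}"
      using T finite_subset by fastforce
    then show "\<delta> (T - U) z - koszul_bd X T (\<lambda>U. b (the_elem U)) U \<in> N (T - U)"
      using b by (simp add: koszul_bd_empty)
  qed
  then obtain g where "z - koszul_bd X' T g {} \<in> R' T"
    by (metis Diff_empty card.empty empty_subsetI)
  then show "z \<in> decomposable R' X' T"
    unfolding decomposable_def koszul_bd_empty by (auto intro!: exI[of _ "\<lambda>u. g {u}"])
qed

text \<open>Exactness of H_1(P) -> H_1(Z) -> H_0(Z') -> H_0(P). This converse translates the bound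
  on the first homology of the resolution into one on the Koszul complex.\<close>

lemma koszul_exact_if_reflects_decomposable:
  assumes T: "finite T" and inj: "reflects_decomposable N X R' X' \<delta> T" and N: "koszul_exact N X T 0"
  shows "koszul_exact R X T 0"
  unfolding koszul_exact_def
proof (intro allI impI)
  fix c assume "\<forall>U\<subseteq>T. card U = 0 \<longrightarrow> koszul_bd X T c U \<in> R (T - U)"
  then have "koszul_bd X T c {} \<in> R T"
    by fastforce
  then obtain z where z: "koszul_bd X T c {} - \<delta> T z \<in> N T"
    using R_iff T by blast
  then have "\<delta> T z - (\<Sum>u\<in>T. X (T - {u}) u (c {u})) \<in> N T"
    using N.R_uminus[OF z] by (simp add: koszul_bd_empty)
  then have "\<delta> T z \<in> decomposable N X T"
    unfolding decomposable_def by (auto intro!: exI[of _ "\<lambda>u. c {u}"])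
  then obtain g where "z - (\<Sum>u\<in>T. X' (T - {u}) u (g u)) \<in> R' T"
    using inj unfolding reflects_decomposable_def decomposable_def by blast
  then have g: "\<delta> T z - (\<Sum>u\<in>T. X (T - {u}) u (\<delta> (T - {u}) (g u))) \<in> N T"
    using T \<delta>_koszul_bd[of "{}" T "\<lambda>U. g (the_elem U)"] by (simp add: R'_iff \<delta>_diff koszul_bd_empty)
  \<comment> \<open>The boundary of \<open>c\<close> in \<open>P\<close> comes from \<open>z\<close>
    in \<open>Z'\<close>, which is decomposable there through \<open>g\<close>. Subtracting the
    images of \<open>g\<close>, which vanish in \<open>Z\<close>, turns \<open>c\<close> into a
    cycle of \<open>P\<close>.\<close>
  define c' where "c' U = c U - \<delta> (T - U) (g (the_elem U))" for U
  have "koszul_bd X T c' {} = (koszul_bd X T c {} - \<delta> T z) + (\<delta> T z - (\<Sum>u\<in>T. X (T - {u}) u (\<delta> (T -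
    {u}) (g u))))"
    unfolding c'_def N.koszul_bd_diff by (simp add: koszul_bd_empty)
  then have "koszul_bd X T c' {} \<in> N T"
    using N.R_add[OF z g] by simp
  moreover have "U = {}" if "U \<subseteq> T" "card U = 0" for U
    using that T finite_subset by fastforce
  ultimately have "\<forall>U\<subseteq>T. card U = 0 \<longrightarrow> koszul_bd X T c' U \<in> N (T - U)"
    by (metis Diff_empty)
  then obtain e where e: "\<And>U. U \<subseteq> T \<Longrightarrow> card U = Suc 0 \<Longrightarrow> c' U - koszul_bd X T e U \<in> N (T - U)"
    using N unfolding koszul_exact_def by blast
  have "c U - koszul_bd X T e U \<in> R (T - U)" if "U \<subseteq> T" "card U = Suc 0" for U
  proof -
    have "c U - koszul_bd X T e U - \<delta> (T - U) (g (the_elem U)) \<in> N (T - U)"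
      using e[OF that] by (simp add: c'_def algebra_simps)
    then show ?thesis
      using R_iff T by blast
  qed
  then show "\<exists>b. \<forall>U\<subseteq>T. card U = Suc 0 \<longrightarrow> c U - koszul_bd X T b U \<in> R (T - U)"
    by blast
qed

end

subsection \<open>Presentation of FI-modules by free abelian groups\<close>

definition frag_eval :: "('u, 'm) monoid_scheme \<Rightarrow> ('u \<Rightarrow>\<^sub>0 int) \<Rightarrow> 'u" where
  "frag_eval G = (SOME h. h \<in> hom (free_Abelian_group UNIV) G \<and>
     (\<forall>a. h (frag_of a) = (if a \<in> carrier G then a else \<one>\<^bsub>G\<^esub>)))"

definition frag_lift :: "('u, 'm) monoid_scheme \<Rightarrow> ('u \<Rightarrow> 'v) \<Rightarrow> ('u \<Rightarrow>\<^sub>0 int) \<Rightarrow> ('v \<Rightarrow>\<^sub>0 int)" where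
  "frag_lift G \<phi> = frag_extend (\<lambda>a. if a \<in> carrier G then frag_of (\<phi> a) else 0)"

lemma frag_induct [case_names zero one diff]:
  assumes "P 0" and "\<And>a. P (frag_of a)" and "\<And>x y. P x \<Longrightarrow> P y \<Longrightarrow> P (x - y)"
  shows "P x"
  by (rule frag_induction[of x UNIV]) (use assms in auto)

context comm_group
begin

lemma frag_eval_spec:
  "frag_eval G \<in> hom (free_Abelian_group UNIV) G"
  "frag_eval G (frag_of a) = (if a \<in> carrier G then a else \<one>)"
proof -
  obtain h where "h \<in> hom (free_Abelian_group UNIV) G"
    "\<And>a. a \<in> UNIV \<Longrightarrow> h (frag_of a) = (if a \<in> carrier G then a else \<one>)"
    using free_Abelian_group_universal[of "\<lambda>a. if a \<in> carrier G then a else \<one>" UNIV] by auto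
  then have "\<exists>h. h \<in> hom (free_Abelian_group UNIV) G \<and>
      (\<forall>a. h (frag_of a) = (if a \<in> carrier G then a else \<one>))"
    by blast
  from someI_ex[OF this]
  show "frag_eval G \<in> hom (free_Abelian_group UNIV) G"
    "frag_eval G (frag_of a) = (if a \<in> carrier G then a else \<one>)"
    unfolding frag_eval_def by simp_all
qed

lemma frag_eval_group_hom: "group_hom (free_Abelian_group UNIV) G (frag_eval G)"
  by (simp add: group_hom_def group_hom_axioms_def frag_eval_spec(1) is_group)

lemma frag_eval_closed [simp]: "frag_eval G x \<in> carrier G"
  using group_hom.hom_closed[OF frag_eval_group_hom, of x] by simp

lemma frag_eval_frag_of: "a \<in> carrier G \<Longrightarrow> frag_eval G (frag_of a) = a"
  by (simp add: frag_eval_spec)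

lemma frag_eval_zero [simp]: "frag_eval G 0 = \<one>"
  using group_hom.hom_one[OF frag_eval_group_hom] by simp

lemma frag_eval_add: "frag_eval G (x + y) = frag_eval G x \<otimes> frag_eval G y"
  using group_hom.hom_mult[OF frag_eval_group_hom, of x y] by simp

lemma frag_eval_uminus: "frag_eval G (- x) = inv (frag_eval G x)"
  using group_hom.hom_inv[OF frag_eval_group_hom, of x] by simp

lemma frag_eval_diff: "frag_eval G (x - y) = frag_eval G x \<otimes> inv (frag_eval G y)"
  using frag_eval_add[of x "- y"] by (simp add: frag_eval_uminus)

lemma frag_eval_sum_in_subgroup:
  assumes "subgroup H G" "\<And>i. i \<in> I \<Longrightarrow> frag_eval G (f i) \<in> H"
  shows "frag_eval G (sum f I) \<in> H"
  using assms(2) by (induction I rule: infinite_finite_induct)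
    (auto simp: frag_eval_add subgroup.one_closed[OF assms(1)] subgroup.m_closed[OF assms(1)])

end

lemma frag_lift_zero [simp]: "frag_lift G \<phi> 0 = 0"
  and frag_lift_diff: "frag_lift G \<phi> (x - y) = frag_lift G \<phi> x - frag_lift G \<phi> y"
  and frag_lift_frag_of: "a \<in> carrier G \<Longrightarrow> frag_lift G \<phi> (frag_of a) = frag_of (\<phi> a)"
    "a \<notin> carrier G \<Longrightarrow> frag_lift G \<phi> (frag_of a) = 0"
  by (simp_all add: frag_lift_def frag_extend_diff)

lemma frag_eval_frag_lift:
  assumes "comm_group G" "comm_group H" "\<phi> \<in> hom G H"
  shows "frag_eval H (frag_lift G \<phi> x) = \<phi> (frag_eval G x)"
proof -
  interpret G: comm_group G by fact
  interpret H: comm_group H by fact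
  interpret group_hom G H \<phi>
    by (simp add: group_hom_def group_hom_axioms_def assms G.is_group H.is_group)
  show ?thesis
  proof (induction x rule: frag_induct)
    case (one a)
    then show ?case
      by (cases "a \<in> carrier G") (auto simp: frag_lift_frag_of G.frag_eval_spec H.frag_eval_spec)
  next
    case (diff x y)
    then show ?case
      by (simp add: frag_lift_diff G.frag_eval_diff H.frag_eval_diff)
  qed simp
qed

text \<open>Agreement on basis elements gives equality of formal sums before any evaluation, which
  is what makes \<open>X_comm\<close> exact; basis elements outside the carrier go to 0 on both
  sides.\<close>

lemma frag_lift_frag_lift_eq:
  assumes "\<And>a. a \<in> carrier G \<Longrightarrow> \<phi> a \<in> carrier H \<and> \<phi>' a \<in> carrier H' \<and> \<psi> (\<phi> a) = \<psi>' (\<phi>' a)"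
  shows "frag_lift H \<psi> (frag_lift G \<phi> x) = frag_lift H' \<psi>' (frag_lift G \<phi>' x)"
proof (induction x rule: frag_induct)
  case (one a)
  then show ?case
    by (cases "a \<in> carrier G") (use assms in \<open>auto simp: frag_lift_frag_of\<close>)
qed (auto simp: frag_lift_diff)

abbreviation incl :: "nat set \<Rightarrow> nat \<Rightarrow> nat" where
  "incl S \<equiv> restrict id S"

text \<open>
  \<open>V\<^sub>S\<close> is presented by the free abelian group on the whole carrier type, elements outside the carrier
  being sent to the unit; \<open>frag_kernel V W \<eta>\<close> presents the image of \<open>\<eta>\<close> as a quotient of \<open>V\<close>.
\<close>

definition frag_step :: "'u set_functor \<Rightarrow> nat set \<Rightarrow> nat \<Rightarrow> ('u \<Rightarrow>\<^sub>0 int) \<Rightarrow> ('u \<Rightarrow>\<^sub>0 int)" where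
  "frag_step V S u = (if finite S then frag_lift (Ob V S) (Ar V S (insert u S) (incl S)) else (\<lambda>_.
    0))"

definition frag_kernel :: "'u set_functor \<Rightarrow> 'v set_functor \<Rightarrow> (nat set \<Rightarrow> 'u \<Rightarrow> 'v) \<Rightarrow> nat set \<Rightarrow> ('u
  \<Rightarrow>\<^sub>0 int) set"
  where "frag_kernel V W \<eta> T = {x. finite T \<longrightarrow> \<eta> T (frag_eval (Ob V T) x) = \<one>\<^bsub>Ob W T\<^esub>}"

lemma incl_FI: "S \<subseteq> T \<Longrightarrow> incl S \<in> FI_mor S T"
  by (auto simp: FI_mor_def inj_on_def)

locale fi_module = ab_functor FI_mor V for V :: "'u set_functor"
begin

lemma Ar_closed: "finite S \<Longrightarrow> finite T \<Longrightarrow> f \<in> FI_mor S T \<Longrightarrow> x \<in> carrier (Ob V S) \<Longrightarrow>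
    Ar V S T f x \<in> carrier (Ob V T)"
  using ar_hom by (fastforce simp: hom_def)

lemma Ar_hom_group: "finite S \<Longrightarrow> finite T \<Longrightarrow> f \<in> FI_mor S T \<Longrightarrow> group_hom (Ob V S) (Ob V T) (Ar V S T
    f)"
  using ar_hom ab_group by (simp add: group_hom_def group_hom_axioms_def comm_group_def)

lemma Ar_Ar:
  assumes "finite R" "finite S" "finite T" "f \<in> FI_mor R S" "g \<in> FI_mor S T" "x \<in> carrier (Ob V R)"
    and "\<And>i. i \<in> R \<Longrightarrow> g (f i) = h i" "h \<in> extensional R"
  shows "Ar V S T g (Ar V R S f x) = Ar V R T h x"
proof -
  have "compose R g f = h"
    using assms(7,8) by (auto simp: compose_def fun_eq_iff extensional_def)
  then show ?thesis
    using ar_comp[OF assms(1-6)] by simp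
qed

lemma Ar_Ar_eq:
  assumes "finite R" "finite S" "finite S'" "finite T" "f \<in> FI_mor R S" "g \<in> FI_mor S T"
    "f' \<in> FI_mor R S'" "g' \<in> FI_mor S' T" "x \<in> carrier (Ob V R)"
    and "\<And>i. i \<in> R \<Longrightarrow> g (f i) = g' (f' i)"
  shows "Ar V S T g (Ar V R S f x) = Ar V S' T g' (Ar V R S' f' x)"
proof -
  have "compose R g f = compose R g' f'"
    using assms(10) by (auto simp: compose_def fun_eq_iff)
  then show ?thesis
    using ar_comp[OF assms(1,2,4,5,6,9)] ar_comp[OF assms(1,3,4,7,8,9)] by simp
qed

lemma frag_eval_frag_step: "finite S \<Longrightarrow> frag_eval (Ob V (insert u S)) (frag_step V S u x) = Ar V S
    (insert u S) (incl S) (frag_eval (Ob V S) x)"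
  by (simp add: frag_step_def frag_eval_frag_lift[OF ab_group ab_group ar_hom[OF _ _ incl_FI]]
    subset_insertI)

lemma frag_step_diff: "frag_step V S u (x - y) = frag_step V S u x - frag_step V S u y"
  by (simp add: frag_step_def frag_lift_diff)

lemma frag_step_comm: "frag_step V (insert u S) v (frag_step V S u x) = frag_step V (insert v S) u
    (frag_step V S v x)"
proof (cases "finite S")
  case True
  have i: "incl S \<in> FI_mor S (insert w S)" "incl (insert w S) \<in> FI_mor (insert w S) (insert u
    (insert v S))"
    if "w \<in> {u, v}" for w
    using that by (auto intro!: incl_FI)
  have "frag_lift (Ob V (insert u S)) (Ar V (insert u S) (insert u (insert v S)) (incl (insert u
    S)))
         (frag_lift (Ob V S) (Ar V S (insert u S) (incl S)) x)
      = frag_lift (Ob V (insert v S)) (Ar V (insert v S) (insert u (insert v S)) (incl (insert v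
        S)))
         (frag_lift (Ob V S) (Ar V S (insert v S) (incl S)) x)"
    using True i by (intro frag_lift_frag_lift_eq conjI Ar_closed Ar_Ar_eq) auto
  then show ?thesis
    using True by (simp add: frag_step_def insert_commute)
\<comment> \<open>At infinite sets \<open>frag_step\<close> is 0, which keeps the identity valid for
  every \<open>S\<close>.\<close>
qed (simp add: frag_step_def)

end

section \<open>Natural maps of FI-modules as presented modules\<close>

lemma id_natural: "natural FI_mor V V (\<lambda>T x. x)"
  by (auto simp: natural_def hom_def)

locale fi_map = V: fi_module V + W: fi_module W
  for V :: "'u set_functor" and W :: "'v set_functor" +
  fixes \<eta> :: "nat set \<Rightarrow> 'u \<Rightarrow> 'v"
  assumes nat: "natural FI_mor V W \<eta>"
begin

lemma \<eta>_group_hom: "finite T \<Longrightarrow> group_hom (Ob V T) (Ob W T) (\<eta> T)"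
  using nat V.ab_group W.ab_group
  by (simp add: natural_def group_hom_def group_hom_axioms_def comm_group_def)

lemma \<eta>_Ar: "finite S \<Longrightarrow> finite T \<Longrightarrow> f \<in> FI_mor S T \<Longrightarrow> x \<in> carrier (Ob V S) \<Longrightarrow>
    \<eta> T (Ar V S T f x) = Ar W S T f (\<eta> S x)"
  using nat by (simp add: natural_def)

lemma frag_kernel_diffI:
  assumes "finite T \<Longrightarrow> frag_eval (Ob V T) x = frag_eval (Ob V T) y"
  shows "x - y \<in> frag_kernel V W \<eta> T"
  unfolding frag_kernel_def
proof (intro CollectI impI)
  assume T: "finite T"
  interpret group_hom "Ob V T" "Ob W T" "\<eta> T"
    by (rule \<eta>_group_hom[OF T])
  interpret comm_group "Ob V T"
    by (rule V.ab_group[OF T])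
  show "\<eta> T (frag_eval (Ob V T) (x - y)) = \<one>\<^bsub>Ob W T\<^esub>"
    using assms[OF T] by (simp add: frag_eval_diff)
qed

lemma frag_kernel_Ar:
  assumes "finite S" "finite T" "f \<in> FI_mor S T" "x \<in> frag_kernel V W \<eta> S"
    "frag_eval (Ob V T) y = Ar V S T f (frag_eval (Ob V S) x)"
  shows "y \<in> frag_kernel V W \<eta> T"
proof -
  interpret comm_group "Ob V S"
    by (rule V.ab_group[OF assms(1)])
  show ?thesis
    using assms(4) group_hom.hom_one[OF W.Ar_hom_group[OF assms(1-3)]]
    by (simp add: frag_kernel_def assms(1,2,3,5) \<eta>_Ar)
qed

sublocale presented_module "frag_kernel V W \<eta>" "frag_step V"
proof
  fix S x y u v
  show "frag_step V S u (x - y) = frag_step V S u x - frag_step V S u y" "frag_step V (insert u S)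
    v (frag_step V S u x) = frag_step V (insert v S) u (frag_step V S v x)"
    by (rule V.frag_step_diff V.frag_step_comm)+
  show "0 \<in> frag_kernel V W \<eta> S"
    using frag_kernel_diffI[of S 0 0] by simp
  show "x - y \<in> frag_kernel V W \<eta> S" if xy: "x \<in> frag_kernel V W \<eta> S" "y \<in> frag_kernel V W \<eta> S"
    unfolding frag_kernel_def
  proof (intro CollectI impI)
    assume S: "finite S"
    interpret group_hom "Ob V S" "Ob W S" "\<eta> S"
      by (rule \<eta>_group_hom[OF S])
    interpret comm_group "Ob V S"
      by (rule V.ab_group[OF S])
    show "\<eta> S (frag_eval (Ob V S) (x - y)) = \<one>\<^bsub>Ob W S\<^esub>"
      using xy S by (simp add: frag_eval_diff frag_kernel_def)
  qed
  show "frag_step V S u x \<in> frag_kernel V W \<eta> (insert u S)" if "x \<in> frag_kernel V W \<eta> S"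
  proof (cases "finite S")
    case True
    then show ?thesis
      using frag_kernel_Ar[OF _ _ incl_FI that, of "insert u S"] V.frag_eval_frag_step by auto
  qed (simp add: frag_kernel_def)
qed

lemma frag_kernel_infinite: "infinite T \<Longrightarrow> frag_kernel V W \<eta> T = UNIV"
  by (simp add: frag_kernel_def)

section \<open>Exchanging two points in an FI-module\<close>

definition swap :: "nat \<Rightarrow> nat \<Rightarrow> nat set \<Rightarrow> nat \<Rightarrow> nat" where
  "swap u v S = (\<lambda>i\<in>insert u S. if i = u then v else i)"

lemma swap_FI: "u \<notin> S \<Longrightarrow> v \<notin> S \<Longrightarrow> swap u v S \<in> FI_mor (insert u S) (insert v S)"
  by (auto simp: FI_mor_def swap_def inj_on_def)

definition swap_lift :: "nat \<Rightarrow> nat \<Rightarrow> nat set \<Rightarrow> ('u \<Rightarrow>\<^sub>0 int) \<Rightarrow> ('u \<Rightarrow>\<^sub>0 int)" where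
  "swap_lift u v S = frag_lift (Ob V (insert u S)) (Ar V (insert u S) (insert v S) (swap u v S))"

lemma frag_eval_swap_lift:
  assumes "finite S" "u \<notin> S" "v \<notin> S"
  shows "frag_eval (Ob V (insert v S)) (swap_lift u v S x) = Ar V (insert u S) (insert v S) (swap
    u v S) (frag_eval (Ob V (insert u S)) x)"
  unfolding swap_lift_def using assms by (intro frag_eval_frag_lift V.ab_group V.ar_hom swap_FI)
    auto

lemma frag_eval_carrier [simp]: "finite S \<Longrightarrow> frag_eval (Ob V S) x \<in> carrier (Ob V S)"
  using V.ab_group comm_group.frag_eval_closed by blast

lemma shift_map_swap:
  assumes "u \<noteq> v" "B = {u, v}"
  shows "shift_map (frag_kernel V W \<eta>) (frag_step V) B u {v} (\<lambda>S. frag_step V S v) (swap_lift u v)"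
  unfolding shift_map_def
proof (intro allI impI conjI ballI)
  fix S x y assume S: "S \<inter> B = {}"
  then have uv: "u \<notin> S" "v \<notin> S"
    using assms by auto
  note FI = swap_FI[OF uv]
  show "swap_lift u v S (x - y) = swap_lift u v S x - swap_lift u v S y"
    by (simp add: swap_lift_def frag_lift_diff)
  show "swap_lift u v S x \<in> frag_kernel V W \<eta> (S \<union> {v})" if "x \<in> frag_kernel V W \<eta> (insert u S)"
  proof (cases "finite S")
    case True
    then show ?thesis
      using frag_kernel_Ar[OF _ _ FI that] frag_eval_swap_lift[OF True uv] by simp
  qed (simp add: frag_kernel_infinite)
  show "swap_lift u v S (frag_step V S u x) - frag_step V S v x \<in> frag_kernel V W \<eta> (S \<union> {v})"
  proof (rule frag_kernel_diffI)
    assume "finite (S \<union> {v})"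
    then have fin: "finite S"
      by simp
    have "Ar V (insert u S) (insert v S) (swap u v S) (Ar V S (insert u S) (incl S) (frag_eval (Ob
      V S) x))
        = Ar V S (insert v S) (incl S) (frag_eval (Ob V S) x)"
      using fin uv by (intro V.Ar_Ar incl_FI FI frag_eval_carrier) (auto simp: swap_def)
    then show "frag_eval (Ob V (S \<union> {v})) (swap_lift u v S (frag_step V S u x)) = frag_eval (Ob V
      (S \<union> {v})) (frag_step V S v x)"
      using fin uv by (simp add: frag_eval_swap_lift V.frag_eval_frag_step)
  qed
  fix w assume "w \<notin> S \<union> B"
  then have w: "u \<notin> insert w S" "v \<notin> insert w S" "w \<notin> S"
    using assms uv by auto
  show "swap_lift u v (insert w S) (frag_step V (insert u S) w y) - frag_step V (S \<union> {v}) w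
    (swap_lift u v S y)
      \<in> frag_kernel V W \<eta> (insert w (S \<union> {v}))"
  proof (rule frag_kernel_diffI)
    assume "finite (insert w (S \<union> {v}))"
    then have fin: "finite S"
      by simp
    let ?y = "frag_eval (Ob V (insert u S)) y"
    have "Ar V (insert u (insert w S)) (insert v (insert w S)) (swap u v (insert w S))
           (Ar V (insert u S) (insert u (insert w S)) (incl (insert u S)) ?y)
        = Ar V (insert v S) (insert v (insert w S)) (incl (insert v S))
           (Ar V (insert u S) (insert v S) (swap u v S) ?y)"
      using fin uv w by (intro V.Ar_Ar_eq incl_FI FI swap_FI frag_eval_carrier) (auto simp:
        swap_def)
    moreover have "frag_eval (Ob V (insert v (insert w S))) (swap_lift u v (insert w S) (frag_step
      V (insert u S) w y))
      = Ar V (insert u (insert w S)) (insert v (insert w S)) (swap u v (insert w S))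
         (frag_eval (Ob V (insert u (insert w S))) (frag_step V (insert u S) w y))"
      using fin w by (intro frag_eval_swap_lift) auto
    moreover have "frag_eval (Ob V (insert u (insert w S))) (frag_step V (insert u S) w y)
      = Ar V (insert u S) (insert u (insert w S)) (incl (insert u S)) ?y"
      using V.frag_eval_frag_step[of "insert u S" w y] fin by (simp add: insert_commute)
    moreover have "frag_eval (Ob V (insert v (insert w S))) (frag_step V (insert v S) w (swap_lift
      u v S y))
      = Ar V (insert v S) (insert v (insert w S)) (incl (insert v S)) (frag_eval (Ob V (insert v
        S)) (swap_lift u v S y))"
      using V.frag_eval_frag_step[of "insert v S" w] fin by (simp add: insert_commute)
    ultimately show "frag_eval (Ob V (insert w (S \<union> {v}))) (swap_lift u v (insert w S) (frag_step
      V (insert u S) w y))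
        = frag_eval (Ob V (insert w (S \<union> {v}))) (frag_step V (S \<union> {v}) w (swap_lift u v S y))"
      using frag_eval_swap_lift[OF fin uv, of y] by (simp add: insert_commute)
  qed
qed

lemma sym_pair_FI:
  assumes "u \<noteq> v"
  shows "sym_pair (frag_kernel V W \<eta>) (frag_step V) {u, v} u v"
  unfolding sym_pair_def
proof (intro exI conjI allI impI)
  show "shift_map (frag_kernel V W \<eta>) (frag_step V) {u, v} u {v} (\<lambda>S. frag_step V S v) (swap_lift
    u v)"
    using assms by (rule shift_map_swap) simp
  show "shift_map (frag_kernel V W \<eta>) (frag_step V) {u, v} v {u} (\<lambda>S. frag_step V S u) (swap_lift
    v u)"
    by (rule shift_map_swap) (use assms in auto)
  fix S x assume "S \<inter> {u, v} = {}"
  then have uv: "u \<notin> S" "v \<notin> S"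
    by auto
  show "swap_lift v u S (swap_lift u v S x) - x \<in> frag_kernel V W \<eta> (insert u S)"
  proof (rule frag_kernel_diffI)
    assume "finite (insert u S)"
    then have fin: "finite S"
      by simp
    let ?x = "frag_eval (Ob V (insert u S)) x"
    have "Ar V (insert v S) (insert u S) (swap v u S) (Ar V (insert u S) (insert v S) (swap u v S)
      ?x)
        = Ar V (insert u S) (insert u S) (incl (insert u S)) ?x"
      using fin uv by (intro V.Ar_Ar swap_FI frag_eval_carrier) (auto simp: swap_def)
    then show "frag_eval (Ob V (insert u S)) (swap_lift v u S (swap_lift u v S x)) = ?x"
      using fin uv V.ar_id[of "insert u S" ?x] by (simp add: frag_eval_swap_lift)
  qed
qed

end

section \<open>Decomposable elements and images from smaller sets\<close>

context presented_module
begin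

lemma R_decomposable: "x \<in> R T \<Longrightarrow> x \<in> decomposable R X T"
  unfolding decomposable_def by (auto intro!: exI[of _ "\<lambda>_. 0"])

lemma decomposable_diff:
  assumes "x \<in> decomposable R X T" "y \<in> decomposable R X T"
  shows "x - y \<in> decomposable R X T"
proof -
  obtain b c where "x - (\<Sum>u\<in>T. X (T - {u}) u (b u)) \<in> R T" "y - (\<Sum>u\<in>T. X (T - {u}) u (c u)) \<in> R T"
    using assms unfolding decomposable_def by blast
  then have "(x - (\<Sum>u\<in>T. X (T - {u}) u (b u))) - (y - (\<Sum>u\<in>T. X (T - {u}) u (c u))) \<in> R T"
    by (rule R_diff)
  then have "(x - y) - (\<Sum>u\<in>T. X (T - {u}) u (b u - c u)) \<in> R T"
    by (simp add: X_diff sum_subtractf algebra_simps)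
  then show ?thesis
    unfolding decomposable_def by (auto intro!: exI[of _ "\<lambda>u. b u - c u"])
qed

lemma X_decomposable:
  assumes "finite T" "u \<in> T"
  shows "X (T - {u}) u x \<in> decomposable R X T"
proof -
  have "(\<Sum>v\<in>T. X (T - {v}) v (if v = u then x else 0)) = (\<Sum>v\<in>T. if v = u then X (T - {u}) u x else
    0)"
    by (rule sum.cong) auto
  also have "\<dots> = X (T - {u}) u x"
    using assms by simp
  finally have "X (T - {u}) u x - (\<Sum>v\<in>T. X (T - {v}) v (if v = u then x else 0)) \<in> R T"
    by simp
  then show ?thesis
    unfolding decomposable_def by (intro CollectI exI)
qed

end

lemma (in group) mult_inv_eq_one_iff:
  "x \<in> carrier G \<Longrightarrow> y \<in> carrier G \<Longrightarrow> x \<otimes> inv y = \<one> \<longleftrightarrow> x = y"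
  using inv_solve_right[of \<one> x y] by auto

context fi_module
begin

lemma generators_carrier:
  "finite T \<Longrightarrow> (\<Union>S \<in> {S. finite S \<and> card S < card T}. \<Union>f \<in> FI_mor S T. Ar V S T f ` carrier (Ob V S))
     \<subseteq> carrier (Ob V T)"
  using Ar_closed by blast

lemma lower_images_subgroup: "finite T \<Longrightarrow> subgroup (lower_images V T) (Ob V T)"
  unfolding lower_images_def
  using group.generate_is_subgroup[OF _ generators_carrier] ab_group comm_group.axioms(2) by blast

lemma lower_images_incl:
  "finite S \<Longrightarrow> card S < card T \<Longrightarrow> f \<in> FI_mor S T \<Longrightarrow> x \<in> carrier (Ob V S) \<Longrightarrow>
     Ar V S T f x \<in> lower_images V T"
  unfolding lower_images_def by (rule generate.incl) blast

text \<open>One closure property under \<open>x \<otimes> inv y\<close> replaces products and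
  inverses in \<open>generate\<close>, matching closure of \<open>decomposable\<close> under
  differences.\<close>

lemma lower_images_induct [consumes 2, case_names one Ar mult_Ar_inv]:
  assumes T: "finite T" and x: "x \<in> lower_images V T"
    and one: "Q \<one>\<^bsub>Ob V T\<^esub>"
    and Ar: "\<And>S f y. finite S \<Longrightarrow> card S < card T \<Longrightarrow> f \<in> FI_mor S T \<Longrightarrow> y \<in> carrier (Ob V S) \<Longrightarrow>
      Q (Ar V S T f y)"
    and diff: "\<And>x y. x \<in> carrier (Ob V T) \<Longrightarrow> y \<in> carrier (Ob V T) \<Longrightarrow> Q x \<Longrightarrow> Q y \<Longrightarrow>
      Q (x \<otimes>\<^bsub>Ob V T\<^esub> inv\<^bsub>Ob V T\<^esub> y)"
  shows "Q x"
proof -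
  interpret comm_group "Ob V T"
    by (rule ab_group[OF T])
  have Q_inv: "Q (inv\<^bsub>Ob V T\<^esub> y)" if "Q y" "y \<in> carrier (Ob V T)" for y
    using diff[OF one_closed that(2) one that(1)] that(2) by simp
  have "x \<in> carrier (Ob V T) \<and> Q x"
    using x unfolding lower_images_def
  proof (induction x rule: generate.induct)
    case one
    then show ?case
      using \<open>Q \<one>\<^bsub>Ob V T\<^esub>\<close> by simp
  next
    case (incl h)
    then show ?case
      using Ar Ar_closed T by blast
  next
    case (inv h)
    then have "Q h" "h \<in> carrier (Ob V T)"
      using Ar Ar_closed T by blast+
    then show ?case
      using Q_inv by simp
  next
    case (eng a b)
    then show ?case
      using diff[of a "inv\<^bsub>Ob V T\<^esub> b"] Q_inv by simp
  qed
  then show ?thesis ..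
qed

lemma lower_images_Ar:
  assumes S: "finite S" and T: "finite T" and f: "f \<in> FI_mor S T" and x: "x \<in> lower_images V S"
  shows "Ar V S T f x \<in> lower_images V T"
proof -
  interpret group_hom "Ob V S" "Ob V T" "Ar V S T f"
    by (rule Ar_hom_group[OF S T f])
  interpret L: subgroup "lower_images V T" "Ob V T"
    by (rule lower_images_subgroup[OF T])
  show ?thesis
    using S x
  proof (induction rule: lower_images_induct)
    case one
    then show ?case
      by simp
  next
    case (Ar R g y)
    have "card S \<le> card T"
      using f card_inj_on_le[of f S T] T by (auto simp: FI_mor_def)
    moreover have "compose R f g \<in> FI_mor R T"
      using f Ar(3) by (auto simp: FI_mor_def compose_def inj_on_def PiE_def Pi_def)
    ultimately have "Ar V R T (compose R f g) y \<in> lower_images V T"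
      using Ar by (intro lower_images_incl) auto
    then show ?case
      using ar_comp[OF Ar(1) S T Ar(3) f Ar(4)] by simp
  next
    case (mult_Ar_inv x y)
    then show ?case
      by simp
  qed
qed

sublocale id: fi_map V V "\<lambda>T x. x"
  by unfold_locales (rule id_natural)

abbreviation "frag_relations \<equiv> frag_kernel V V (\<lambda>T x. x)"

text \<open>An injection from a smaller set misses some point \<open>u\<close> of \<open>T\<close>
  and factors through the inclusion of \<open>T - {u}\<close>; hence the one-point inclusions
  already generate \<open>lower_images\<close>.\<close>

lemma decomposable_frag_relations_iff:
  assumes T: "finite T"
  shows "z \<in> decomposable frag_relations (frag_step V) T \<longleftrightarrow> frag_eval (Ob V T) z \<in> lower_images V T"
proof
  interpret comm_group "Ob V T"
    by (rule ab_group[OF T])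
  {
    assume "z \<in> decomposable frag_relations (frag_step V) T"
    then obtain b where "z - (\<Sum>u\<in>T. frag_step V (T - {u}) u (b u)) \<in> frag_relations T"
      unfolding decomposable_def by blast
    then have "frag_eval (Ob V T) z = frag_eval (Ob V T) (\<Sum>u\<in>T. frag_step V (T - {u}) u (b u))"
      using T by (simp add: frag_kernel_def frag_eval_diff mult_inv_eq_one_iff)
    moreover have "frag_eval (Ob V T) (\<Sum>u\<in>T. frag_step V (T - {u}) u (b u)) \<in> lower_images V T"
    proof (rule frag_eval_sum_in_subgroup[OF lower_images_subgroup[OF T]])
      fix u assume u: "u \<in> T"
      then have "insert u (T - {u}) = T"
        by auto
      then have "frag_eval (Ob V T) (frag_step V (T - {u}) u (b u)) = Ar V (T - {u}) T (incl (T -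
        {u})) (frag_eval (Ob V (T - {u})) (b u))"
        using frag_eval_frag_step[of "T - {u}" u] T by simp
      also have "\<dots> \<in> lower_images V T"
        using T u card_Diff1_less[OF T u] by (intro lower_images_incl incl_FI
          id.frag_eval_carrier) auto
      finally show "frag_eval (Ob V T) (frag_step V (T - {u}) u (b u)) \<in> lower_images V T" .
    qed
    ultimately show "frag_eval (Ob V T) z \<in> lower_images V T"
      by simp
  }
  have *: "\<exists>z\<in>decomposable frag_relations (frag_step V) T. frag_eval (Ob V T) z = x" if "x \<in>
    lower_images V T" for x
    using T that
  proof (induction rule: lower_images_induct)
    case one
    then show ?case
      using id.R_decomposable[of 0 T] by (intro bexI[of _ 0]) simp_all
  next
    case (Ar S f y)
    have "card (f ` S) < card T" "f ` S \<subseteq> T"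
      using Ar by (auto simp: FI_mor_def card_image)
    then obtain u where u: "u \<in> T" "u \<notin> f ` S"
      using card_mono[of "f ` S" T] Ar(1) by fastforce
    then have T': "insert u (T - {u}) = T"
      by auto
    have f: "f \<in> FI_mor S (T - {u})"
      using Ar(3) u by (auto simp: FI_mor_def PiE_def Pi_def)
    let ?y = "Ar V S (T - {u}) f y"
    have y: "?y \<in> carrier (Ob V (T - {u}))"
      using Ar f T by (intro Ar_closed) auto
    have "frag_eval (Ob V T) (frag_step V (T - {u}) u (frag_of ?y)) = Ar V (T - {u}) T (incl (T -
      {u})) ?y"
      using frag_eval_frag_step[of "T - {u}" u "frag_of ?y"] T T' y
        comm_group.frag_eval_frag_of[OF ab_group[of "T - {u}"] y] by simp
    also have "\<dots> = Ar V S T f y"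
      using Ar f T u by (intro Ar_Ar incl_FI) (auto simp: FI_mor_def PiE_def)
    finally show ?case
      using id.X_decomposable[OF T u(1)] by blast
  next
    case (mult_Ar_inv x y)
    then obtain a b where "a \<in> decomposable frag_relations (frag_step V) T" "b \<in> decomposable
      frag_relations (frag_step V) T"
      "frag_eval (Ob V T) a = x" "frag_eval (Ob V T) b = y"
      by blast
    then show ?case
      using id.decomposable_diff[of a T b] by (intro bexI[of _ "a - b"]) (simp_all add:
        frag_eval_diff)
  qed
  assume "frag_eval (Ob V T) z \<in> lower_images V T"
  from *[OF this] obtain z' where z': "z' \<in> decomposable frag_relations (frag_step V) T"
    "frag_eval (Ob V T) z' = frag_eval (Ob V T) z"
    by blast
  have "z' - z \<in> decomposable frag_relations (frag_step V) T"
    using z'(2) by (intro id.R_decomposable id.frag_kernel_diffI)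
  from id.decomposable_diff[OF z'(1) this] show "z \<in> decomposable frag_relations (frag_step V) T"
    by simp
qed

end

text \<open>In the image of \<open>\<eta>\<close>, what comes from smaller sets lifts to elements of
  \<open>V\<close> coming from smaller sets. The decomposable elements thus become those congruent
  to \<open>lower_images V T\<close> modulo the kernel of \<open>\<eta>\<close>.\<close>

lemma (in fi_map) decomposable_frag_kernel_iff:
  assumes T: "finite T"
  shows "z \<in> decomposable (frag_kernel V W \<eta>) (frag_step V) T \<longleftrightarrow>
    (\<exists>l\<in>lower_images V T. \<eta> T l = \<eta> T (frag_eval (Ob V T) z))"
proof -
  interpret group_hom "Ob V T" "Ob W T" "\<eta> T"
    by (rule \<eta>_group_hom[OF T])
  interpret G: comm_group "Ob V T"
    by (rule V.ab_group[OF T])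
  have frag_kernel: "x - y \<in> frag_kernel V W \<eta> T \<longleftrightarrow> \<eta> T (frag_eval (Ob V T) x) = \<eta> T (frag_eval (Ob
    V T) y)" for x y
  proof -
    have "x - y \<in> frag_kernel V W \<eta> T \<longleftrightarrow>
        \<eta> T (frag_eval (Ob V T) x) \<otimes>\<^bsub>Ob W T\<^esub> inv\<^bsub>Ob W T\<^esub> \<eta> T (frag_eval (Ob V T) y) = \<one>\<^bsub>Ob W T\<^esub>"
      using T by (simp add: frag_kernel_def G.frag_eval_diff)
    then show ?thesis
      by (simp add: H.mult_inv_eq_one_iff)
  qed
  show ?thesis
  proof
    assume "z \<in> decomposable (frag_kernel V W \<eta>) (frag_step V) T"
    then obtain b where b: "z - (\<Sum>u\<in>T. frag_step V (T - {u}) u (b u)) \<in> frag_kernel V W \<eta> T"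
      unfolding decomposable_def by blast
    let ?z = "\<Sum>u\<in>T. frag_step V (T - {u}) u (b u)"
    have "?z - ?z \<in> V.frag_relations T"
      by (simp only: diff_self V.id.R_zero)
    then have "?z \<in> decomposable V.frag_relations (frag_step V) T"
      unfolding decomposable_def by blast
    then show "\<exists>l\<in>lower_images V T. \<eta> T l = \<eta> T (frag_eval (Ob V T) z)"
      using b V.decomposable_frag_relations_iff[OF T] unfolding frag_kernel by (intro bexI) simp_all
  next
    assume "\<exists>l\<in>lower_images V T. \<eta> T l = \<eta> T (frag_eval (Ob V T) z)"
    then obtain l where l: "l \<in> lower_images V T" "\<eta> T l = \<eta> T (frag_eval (Ob V T) z)"
      by blast
    have evl: "frag_eval (Ob V T) (frag_of l) = l"
      using l(1) subgroup.mem_carrier[OF V.lower_images_subgroup[OF T]] by (intro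
        G.frag_eval_frag_of)
    then have "frag_of l \<in> decomposable V.frag_relations (frag_step V) T"
      using l(1) V.decomposable_frag_relations_iff[OF T] by simp
    moreover have "x \<in> V.frag_relations T \<Longrightarrow> x \<in> frag_kernel V W \<eta> T" for x
      using T by (simp add: frag_kernel_def)
    ultimately have "frag_of l \<in> decomposable (frag_kernel V W \<eta>) (frag_step V) T"
      unfolding decomposable_def by fast
    moreover have "frag_of l - z \<in> decomposable (frag_kernel V W \<eta>) (frag_step V) T"
      using evl l by (intro R_decomposable) (simp add: frag_kernel)
    ultimately show "z \<in> decomposable (frag_kernel V W \<eta>) (frag_step V) T"
      using decomposable_diff[of "frag_of l" T "frag_of l - z"] by simp
  qed
qed

subsection \<open>Homology of a complex of FI-modules\<close>

lemma coset_map_rcos: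
  assumes "group_hom G H \<phi>" and K: "subgroup K G" and N: "subgroup N H" and sub: "\<phi> ` K \<subseteq> N"
    and x: "x \<in> carrier G"
  shows "coset_map H N \<phi> (K #>\<^bsub>G\<^esub> x) = N #>\<^bsub>H\<^esub> \<phi> x"
proof -
  interpret group_hom G H \<phi> by fact
  have "N #>\<^bsub>H\<^esub> \<phi> (k \<otimes>\<^bsub>G\<^esub> x) = N #>\<^bsub>H\<^esub> \<phi> x" if k: "k \<in> K" for k
  proof -
    have kc: "k \<in> carrier G" "\<phi> k \<in> N"
      using k K sub subgroup.mem_carrier by auto
    have "N #>\<^bsub>H\<^esub> \<phi> (k \<otimes>\<^bsub>G\<^esub> x) = (N #>\<^bsub>H\<^esub> \<phi> k) #>\<^bsub>H\<^esub> \<phi> x"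
      using kc x by (simp add: H.coset_mult_assoc[OF subgroup.subset[OF N]])
    then show ?thesis
      using H.coset_join2[OF _ N] kc by simp
  qed
  then have "coset_map H N \<phi> (K #>\<^bsub>G\<^esub> x) = (\<Union>k\<in>K. N #>\<^bsub>H\<^esub> \<phi> x)"
    unfolding coset_map_def r_coset_def[of G] by auto
  then show ?thesis
    using subgroup.one_closed[OF K] by auto
qed

lemma carrier_Mod: "carrier (G Mod K) = (\<lambda>x. K #>\<^bsub>G\<^esub> x) ` carrier G"
  by (auto simp: FactGroup_def RCOSETS_def)

lemma coset_map_group_hom:
  assumes "group_hom G H \<phi>" and K: "K \<lhd> G" and N: "N \<lhd> H" and sub: "\<phi> ` K \<subseteq> N"
  shows "group_hom (G Mod K) (H Mod N) (coset_map H N \<phi>)"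
proof -
  interpret group_hom G H \<phi> by fact
  note r = coset_map_rcos[OF assms(1) normal_imp_subgroup[OF K] normal_imp_subgroup[OF N] sub]
  have "coset_map H N \<phi> \<in> hom (G Mod K) (H Mod N)"
  proof (rule homI)
    show "coset_map H N \<phi> X \<in> carrier (H Mod N)" if "X \<in> carrier (G Mod K)" for X
      using that r by (auto simp: carrier_Mod)
    show "coset_map H N \<phi> (X \<otimes>\<^bsub>G Mod K\<^esub> Y) = coset_map H N \<phi> X \<otimes>\<^bsub>H Mod N\<^esub> coset_map H N \<phi> Y"
      if "X \<in> carrier (G Mod K)" "Y \<in> carrier (G Mod K)" for X Y
    proof -
      obtain x y where "x \<in> carrier G" "y \<in> carrier G" "X = K #>\<^bsub>G\<^esub> x" "Y = K #>\<^bsub>G\<^esub> y"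
        using \<open>X \<in> _\<close> \<open>Y \<in> _\<close> by (auto simp: carrier_Mod)
      then show ?thesis
        by (simp add: r FactGroup_def normal.rcos_sum[OF K] normal.rcos_sum[OF N])
    qed
  qed
  then show ?thesis
    unfolding group_hom_def group_hom_axioms_def
    using normal.factorgroup_is_group[OF K] normal.factorgroup_is_group[OF N] by simp
qed

lemma quotient_trivial_iff:
  assumes "group Q" and B: "subgroup B Q" and "B \<subseteq> Z" "Z \<subseteq> carrier Q"
  shows "carrier (Q\<lparr>carrier := Z\<rparr> Mod B) = {\<one>\<^bsub>Q\<lparr>carrier := Z\<rparr> Mod B\<^esub>} \<longleftrightarrow> Z \<subseteq> B"
proof -
  interpret group Q by fact
  have "carrier (Q\<lparr>carrier := Z\<rparr> Mod B) = (\<lambda>z. B #>\<^bsub>Q\<^esub> z) ` Z"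
    by (simp add: carrier_Mod r_coset_def)
  moreover have "\<one>\<^bsub>Q\<lparr>carrier := Z\<rparr> Mod B\<^esub> = B"
    by (simp add: FactGroup_def)
  moreover have "B #>\<^bsub>Q\<^esub> z = B \<longleftrightarrow> z \<in> B" if "z \<in> Z" for z
    using coset_join1[OF _ _ B] coset_join2[OF _ B] that assms(4) by blast
  moreover have "Z \<noteq> {}"
    using subgroup.one_closed[OF B] assms(3) by blast
  moreover from this have "(\<lambda>z. B #>\<^bsub>Q\<^esub> z) ` Z = {B} \<longleftrightarrow> (\<forall>z\<in>Z. B #>\<^bsub>Q\<^esub> z = B)"
    unfolding set_eq_subset image_subset_iff by (auto simp: image_iff)
  ultimately show ?thesis
    by auto
qed

lemma (in fi_map) \<eta>_lower_images:
  assumes "finite T" "x \<in> lower_images V T"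
  shows "\<eta> T x \<in> lower_images W T"
proof -
  interpret group_hom "Ob V T" "Ob W T" "\<eta> T"
    by (rule \<eta>_group_hom[OF assms(1)])
  interpret L: subgroup "lower_images W T" "Ob W T"
    by (rule W.lower_images_subgroup[OF assms(1)])
  show ?thesis
    using assms
  proof (induction rule: V.lower_images_induct)
    case (Ar S f y)
    then show ?case
      using \<eta>_Ar[OF Ar(1) assms(1)] W.lower_images_incl[OF Ar(1-3)] group_hom.hom_closed[OF
        \<eta>_group_hom[OF Ar(1)]]
      by simp
  qed simp_all
qed

lemma (in fi_module) lower_images_normal: "finite T \<Longrightarrow> lower_images V T \<lhd> Ob V T"
  using comm_group.subgroup_imp_normal ab_group lower_images_subgroup by blast

locale fi_complex =
  fixes P :: "nat \<Rightarrow> 'u set_functor" and d :: "nat \<Rightarrow> nat set \<Rightarrow> 'u \<Rightarrow> 'u"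
  assumes maps: "fi_map (P (Suc n)) (P n) (d n)"
    and dd: "finite T \<Longrightarrow> x \<in> carrier (Ob (P (Suc (Suc n))) T) \<Longrightarrow> d n T (d (Suc n) T x) = \<one>\<^bsub>Ob (P n)
      T\<^esub>"
begin

lemma modules: "fi_module (P n)"
  using maps[of n] by (simp add: fi_map_def)

context
  fixes T :: "nat set"
  assumes T: "finite T"
begin

abbreviation "G n \<equiv> Ob (P n) T"
abbreviation "L n \<equiv> lower_images (P n) T"
abbreviation "\<delta> n \<equiv> H0_map (P n) (d n) T"

lemma L: "L n \<lhd> G n" "subgroup (L n) (G n)"
  using modules T fi_module.lower_images_normal fi_module.lower_images_subgroup by blast+

lemma G: "group (G n)"
  using L(1) by (simp add: normal_def)

lemma d_hom: "group_hom (G (Suc n)) (G n) (d n T)"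
  using fi_map.\<eta>_group_hom[OF maps T] .

lemma d_L: "d n T ` L (Suc n) \<subseteq> L n"
  using fi_map.\<eta>_lower_images[OF maps T] by blast

lemma \<delta>_rcos: "x \<in> carrier (G (Suc n)) \<Longrightarrow> \<delta> n (L (Suc n) #>\<^bsub>G (Suc n)\<^esub> x) = L n #>\<^bsub>G n\<^esub> d n T x"
  unfolding H0_map_def using coset_map_rcos[OF d_hom L(2) L(2) d_L] .

lemma \<delta>_hom: "group_hom (G (Suc n) Mod L (Suc n)) (G n Mod L n) (\<delta> n)"
  unfolding H0_map_def using coset_map_group_hom[OF d_hom L(1) L(1) d_L] .

lemma Ob_H0: "Ob (H0 (P n)) T = G n Mod L n"
  by (simp add: H0_def)

lemma boundaries_eq:
  "boundaries (\<lambda>n. H0 (P n)) (\<lambda>n. H0_map (P n) (d n)) n T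
    = (\<lambda>y. L n #>\<^bsub>G n\<^esub> d n T y) ` carrier (G (Suc n))"
  by (simp add: boundaries_def Ob_H0 carrier_Mod image_image \<delta>_rcos)

lemma boundaries_subgroup:
  "subgroup (boundaries (\<lambda>n. H0 (P n)) (\<lambda>n. H0_map (P n) (d n)) n T) (G n Mod L n)"
  unfolding boundaries_def Ob_H0 using group_hom.img_is_subgroup[OF \<delta>_hom] .

lemma cycles_Suc_eq:
  "cycles (\<lambda>n. H0 (P n)) (\<lambda>n. H0_map (P n) (d n)) (Suc n) T
    = (\<lambda>x. L (Suc n) #>\<^bsub>G (Suc n)\<^esub> x) ` {x \<in> carrier (G (Suc n)). d n T x \<in> L n}"
proof -
  have "L n #>\<^bsub>G n\<^esub> d n T x = L n \<longleftrightarrow> d n T x \<in> L n" if "x \<in> carrier (G (Suc n))" for x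
    using that group.coset_join1[OF G _ _ L(2)]
      group.coset_join2[OF G _ L(2)] group_hom.hom_closed[OF d_hom] by blast
  then show ?thesis
    by (auto simp: kernel_def Ob_H0 carrier_Mod \<delta>_rcos) (auto simp: FactGroup_def \<delta>_rcos)
qed

lemma homology_trivial_iff:
  assumes "boundaries (\<lambda>n. H0 (P n)) (\<lambda>n. H0_map (P n) (d n)) n T
      \<subseteq> cycles (\<lambda>n. H0 (P n)) (\<lambda>n. H0_map (P n) (d n)) n T"
    and "cycles (\<lambda>n. H0 (P n)) (\<lambda>n. H0_map (P n) (d n)) n T \<subseteq> carrier (G n Mod L n)"
  shows "carrier (Ob (FI_homology P d n) T) = {\<one>\<^bsub>Ob (FI_homology P d n) T\<^esub>} \<longleftrightarrow>
     cycles (\<lambda>n. H0 (P n)) (\<lambda>n. H0_map (P n) (d n)) n T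
      \<subseteq> boundaries (\<lambda>n. H0 (P n)) (\<lambda>n. H0_map (P n) (d n)) n T"
  using quotient_trivial_iff[OF normal.factorgroup_is_group[OF L(1)] boundaries_subgroup assms]
  by (simp add: FI_homology_def complex_homology_def Ob_H0)

lemma rcos_mem_iff:
  assumes "x \<in> carrier (G n)" "Y \<subseteq> carrier (G n)"
  shows "L n #>\<^bsub>G n\<^esub> x \<in> (\<lambda>y. L n #>\<^bsub>G n\<^esub> y) ` Y \<longleftrightarrow> (\<exists>y\<in>Y. x \<in> L n #>\<^bsub>G n\<^esub> y)"
  using assms group.repr_independence[OF G _ _ L(2)] group.rcos_self[OF G _ L(2)]
  by (smt (verit) image_iff subsetD)

text \<open>The homology groups consist of cosets of cosets; their triviality is unfolded here to a
  congruence of elements modulo \<open>lower_images\<close>.\<close>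

theorem homology_0_trivial_iff:
  "carrier (Ob (FI_homology P d 0) T) = {\<one>\<^bsub>Ob (FI_homology P d 0) T\<^esub>} \<longleftrightarrow>
     (\<forall>x\<in>carrier (G 0). \<exists>y\<in>carrier (G 1). x \<in> L 0 #>\<^bsub>G 0\<^esub> d 0 T y)"
proof -
  have sub: "d 0 T ` carrier (G 1) \<subseteq> carrier (G 0)"
    using group_hom.hom_closed[OF d_hom[of 0]] by auto
  have "boundaries (\<lambda>n. H0 (P n)) (\<lambda>n. H0_map (P n) (d n)) 0 T
      = (\<lambda>y. L 0 #>\<^bsub>G 0\<^esub> y) ` (d 0 T ` carrier (G 1))"
    by (simp add: boundaries_eq image_image)
  moreover have "cycles (\<lambda>n. H0 (P n)) (\<lambda>n. H0_map (P n) (d n)) 0 T = (\<lambda>x. L 0 #>\<^bsub>G 0\<^esub> x) `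
    carrier (G 0)"
    by (simp add: Ob_H0 carrier_Mod)
  moreover have "boundaries (\<lambda>n. H0 (P n)) (\<lambda>n. H0_map (P n) (d n)) 0 T
      \<subseteq> cycles (\<lambda>n. H0 (P n)) (\<lambda>n. H0_map (P n) (d n)) 0 T"
    using calculation sub by auto
  ultimately show ?thesis
    using homology_trivial_iff[of 0] rcos_mem_iff[OF _ sub]
    by (simp add: carrier_Mod image_subset_iff)
qed

theorem homology_Suc_trivial_iff:
  "carrier (Ob (FI_homology P d (Suc n)) T) = {\<one>\<^bsub>Ob (FI_homology P d (Suc n)) T\<^esub>} \<longleftrightarrow>
     (\<forall>x\<in>carrier (G (Suc n)). d n T x \<in> L n \<longrightarrow>
        (\<exists>y\<in>carrier (G (Suc (Suc n))). x \<in> L (Suc n) #>\<^bsub>G (Suc n)\<^esub> d (Suc n) T y))"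
proof -
  have sub: "d (Suc n) T ` carrier (G (Suc (Suc n))) \<subseteq> carrier (G (Suc n))"
    using group_hom.hom_closed[OF d_hom[of "Suc n"]] by auto
  have b: "boundaries (\<lambda>n. H0 (P n)) (\<lambda>n. H0_map (P n) (d n)) (Suc n) T
      = (\<lambda>y. L (Suc n) #>\<^bsub>G (Suc n)\<^esub> y) ` (d (Suc n) T ` carrier (G (Suc (Suc n))))"
    by (simp add: boundaries_eq image_image)
  have "d (Suc n) T ` carrier (G (Suc (Suc n))) \<subseteq> {x \<in> carrier (G (Suc n)). d n T x \<in> L n}"
    using sub dd[OF T] subgroup.one_closed[OF L(2)] by fastforce
  then have 1: "boundaries (\<lambda>n. H0 (P n)) (\<lambda>n. H0_map (P n) (d n)) (Suc n) T
      \<subseteq> cycles (\<lambda>n. H0 (P n)) (\<lambda>n. H0_map (P n) (d n)) (Suc n) T"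
    unfolding b cycles_Suc_eq by blast
  have 2: "cycles (\<lambda>n. H0 (P n)) (\<lambda>n. H0_map (P n) (d n)) (Suc n) T \<subseteq> carrier (G (Suc n) Mod L
    (Suc n))"
    unfolding cycles_Suc_eq carrier_Mod by blast
  show ?thesis
    unfolding homology_trivial_iff[OF 1 2] unfolding b cycles_Suc_eq image_subset_iff
    using rcos_mem_iff[OF _ sub] by auto
qed

end

end

subsection \<open>Induced modules and projectives\<close>

text \<open>A function on a finite set is determined by the list of its values, and an infinite type
  has as many lists as elements.\<close>

lemma ex_inj_on_PiE:
  assumes "finite I"
  shows "\<exists>e :: ('i \<Rightarrow> 'u::infinite) \<Rightarrow> 'u. inj_on e (I \<rightarrow>\<^sub>E UNIV)"
proof -
  obtain xs where xs: "set xs = I"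
    using finite_list[OF assms] by blast
  have "|UNIV :: 'u list set| =o |UNIV :: 'u set|"
    using card_of_lists_infinite[of "UNIV :: 'u set"] by (simp add: infinite_UNIV)
  then obtain g :: "'u list \<Rightarrow> 'u" where "bij g"
    using card_of_ordIso by blast
  then have g: "inj g"
    by (simp add: bij_def)
  have "inj_on (\<lambda>f. g (map f xs)) (I \<rightarrow>\<^sub>E UNIV)"
  proof (rule inj_onI)
    fix f f' :: "'i \<Rightarrow> 'u"
    assume f: "f \<in> I \<rightarrow>\<^sub>E UNIV" "f' \<in> I \<rightarrow>\<^sub>E UNIV" and "g (map f xs) = g (map f' xs)"
    then have "map f xs = map f' xs"
      using g by (simp add: inj_eq)
    then show "f = f'"
      using f xs by (intro PiE_ext[of f I _ f']) auto
  qed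
  then show ?thesis
    by blast
qed

lemma comm_group_product_group:
  assumes "\<And>i. i \<in> I \<Longrightarrow> comm_group (G i)"
  shows "comm_group (product_group I G)"
proof -
  have g: "\<And>i. i \<in> I \<Longrightarrow> group (G i)"
    using assms comm_group.axioms(2) by blast
  show ?thesis
  proof (rule group.group_comm_groupI)
    show "x \<otimes>\<^bsub>product_group I G\<^esub> y = y \<otimes>\<^bsub>product_group I G\<^esub> x"
      if "x \<in> carrier (product_group I G)" "y \<in> carrier (product_group I G)" for x y
      using that assms by (auto simp: PiE_def Pi_def intro!: restrict_ext comm_group.axioms(1)
        comm_monoid.m_comm)
  qed (use g in simp)
qed

lemma hom_finprod_comm:
  assumes "comm_group G" "comm_group H" "h \<in> hom G H" "f \<in> A \<rightarrow> carrier G"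
  shows "h (finprod G f A) = finprod H (\<lambda>a. h (f a)) A"
proof -
  interpret G: comm_group G by fact
  interpret H: comm_group H by fact
  interpret group_hom G H h
    by (simp add: group_hom_def group_hom_axioms_def assms G.is_group H.is_group)
  show ?thesis
    using assms(4) by (induction A rule: infinite_finite_induct) (auto simp: Pi_iff)
qed

definition preimage :: "nat set \<Rightarrow> (nat \<Rightarrow> nat) \<Rightarrow> nat set \<Rightarrow> nat set" where
  "preimage S f S' = {i \<in> S. f i \<in> S'}"

text \<open>
  The FI-module \<open>T \<mapsto> \<Oplus>\<^bsub>S \<subseteq> T\<^esub> V\<^sub>S\<close> freely generated by the FB-module underlying \<open>V\<close>. It retracts along
  inclusions and maps onto \<open>V\<close>; so a projective \<open>V\<close> inherits the retractions.
\<close>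

definition induced_map :: "'u set_functor \<Rightarrow> nat set \<Rightarrow> nat set \<Rightarrow> (nat \<Rightarrow> nat) \<Rightarrow> (nat set \<Rightarrow> 'u) \<Rightarrow> nat
  set \<Rightarrow> 'u" where
  "induced_map V S T f x = (\<lambda>S'\<in>Pow T. if S' \<subseteq> f ` S
     then Ar V (preimage S f S') S' (restrict f (preimage S f S')) (x (preimage S f S')) else \<one>\<^bsub>Ob
       V S'\<^esub>)"

definition induced_module :: "'u set_functor \<Rightarrow> (nat set \<Rightarrow> 'u) set_functor" where
  "induced_module V = \<lparr>Ob = (\<lambda>T. product_group (Pow T) (Ob V)), Ar = induced_map V\<rparr>"

lemma preimage_subset: "preimage S f S' \<subseteq> S"
  by (auto simp: preimage_def)

context fi_module
begin

lemma induced_module_mem: "x \<in> carrier (Ob (induced_module V) S) \<Longrightarrow> R \<subseteq> S \<Longrightarrow> x R \<in> carrier (Ob V R)"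
  by (auto simp: induced_module_def)

lemma Ar_one: "finite S \<Longrightarrow> finite T \<Longrightarrow> f \<in> FI_mor S T \<Longrightarrow> Ar V S T f \<one>\<^bsub>Ob V S\<^esub> = \<one>\<^bsub>Ob V T\<^esub>"
  using group_hom.hom_one[OF Ar_hom_group] .

lemma V_group: "finite S \<Longrightarrow> group (Ob V S)"
  using ab_group comm_group.axioms(2) by blast

lemma one_carrier: "finite S \<Longrightarrow> \<one>\<^bsub>Ob V S\<^esub> \<in> carrier (Ob V S)"
  using V_group group.is_monoid monoid.one_closed by blast

lemma restrict_preimage_FI: "f \<in> FI_mor S T \<Longrightarrow> restrict f (preimage S f S') \<in> FI_mor (preimage S f
    S') S'"
  by (auto simp: FI_mor_def preimage_def inj_on_def)

lemma finite_preimage: "finite S \<Longrightarrow> finite (preimage S f S')"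
  using finite_subset[OF preimage_subset] .

lemma induced_map_incl:
  assumes "finite T" "S \<subseteq> T" "x \<in> (\<Pi>\<^sub>E S\<in>Pow S. carrier (Ob V S))"
  shows "induced_map V S T (incl S) x = (\<lambda>S'\<in>Pow T. if S' \<subseteq> S then x S' else \<one>\<^bsub>Ob V S'\<^esub>)"
  unfolding induced_map_def
proof (rule restrict_ext)
  fix S' assume S': "S' \<in> Pow T"
  have "preimage S (incl S) S' = S'" "restrict (incl S) S' = incl S'" if "S' \<subseteq> S"
    using that by (auto simp: preimage_def fun_eq_iff)
  moreover have "Ar V S' S' (incl S') (x S') = x S'" if "S' \<subseteq> S"
    using ar_id[of S' "x S'"] finite_subset[of S' T] PiE_mem[OF assms(3), of S'] S' assms(1) that
      by simp
  ultimately show "(if S' \<subseteq> incl S ` S then Ar V (preimage S (incl S) S') S'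
        (restrict (incl S) (preimage S (incl S) S')) (x (preimage S (incl S) S')) else \<one>\<^bsub>Ob V S'\<^esub>)
      = (if S' \<subseteq> S then x S' else \<one>\<^bsub>Ob V S'\<^esub>)"
    by simp
qed

lemma induced_module_FI_module: "FI_module (induced_module V)"
proof (rule ab_functor.intro)
  fix T :: "nat set" assume T: "finite T"
  show "comm_group (Ob (induced_module V) T)"
    using comm_group_product_group[of "Pow T" "Ob V"] ab_group finite_subset[OF _ T] by (simp add:
      induced_module_def)
  fix x assume x: "x \<in> carrier (Ob (induced_module V) T)"
  then show "Ar (induced_module V) T T (incl T) x = x"
    using induced_map_incl[OF T order_refl, of x] PiE_restrict[of x "Pow T" "\<lambda>S. carrier (Ob V S)"]
    by (simp add: induced_module_def cong: restrict_cong)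
next
  fix S T :: "nat set" and f assume S: "finite S" and T: "finite T" and f: "f \<in> FI_mor S T"
  note fin = finite_subset[OF _ T] finite_preimage[OF S]
  have ar: "group_hom (Ob V (preimage S f S')) (Ob V S') (Ar V (preimage S f S') S' (restrict f
    (preimage S f S')))"
    if "S' \<subseteq> T" for S'
    using that fin by (intro Ar_hom_group restrict_preimage_FI[OF f]) auto
  show "Ar (induced_module V) S T f \<in> hom (Ob (induced_module V) S) (Ob (induced_module V) T)"
  proof (rule homI)
    fix x y assume x: "x \<in> carrier (Ob (induced_module V) S)"
    have xc: "x (preimage S f S') \<in> carrier (Ob V (preimage S f S'))" for S'
      using induced_module_mem[OF x preimage_subset] .
    show "Ar (induced_module V) S T f x \<in> carrier (Ob (induced_module V) T)"
      using group_hom.hom_closed[OF ar xc] one_carrier fin(1) by (simp add: induced_module_def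
        induced_map_def)
    assume y: "y \<in> carrier (Ob (induced_module V) S)"
    have yc: "y (preimage S f S') \<in> carrier (Ob V (preimage S f S'))" for S'
      using induced_module_mem[OF y preimage_subset] .
    show "Ar (induced_module V) S T f (x \<otimes>\<^bsub>Ob (induced_module V) S\<^esub> y)
        = Ar (induced_module V) S T f x \<otimes>\<^bsub>Ob (induced_module V) T\<^esub> Ar (induced_module V) S T f y"
      using group_hom.hom_mult[OF ar xc yc] preimage_subset[of S f] monoid.r_one[OF
        group.is_monoid[OF V_group] one_carrier] fin(1)
      by (simp add: induced_module_def induced_map_def fun_eq_iff restrict_def)
  qed
next
  fix R S T :: "nat set" and f g x
  assume fin: "finite R" "finite S" "finite T" and f: "f \<in> FI_mor R S" and g: "g \<in> FI_mor S T"
    and "x \<in> carrier (Ob (induced_module V) R)"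
  then have xc: "x (preimage R f S') \<in> carrier (Ob V (preimage R f S'))" for S'
    using induced_module_mem[OF _ preimage_subset] by blast
  have "induced_map V R T (compose R g f) x = induced_map V S T g (induced_map V R S f x)"
    unfolding induced_map_def[of V R T] induced_map_def[of V S T]
  proof (rule restrict_ext)
    fix S' assume S': "S' \<in> Pow T"
    then have fS': "finite S'"
      using fin finite_subset by blast
    have preimage_in: "preimage S g S' \<in> Pow S"
      using preimage_subset by blast
    have pre2: "preimage R (compose R g f) S' = preimage R f (preimage S g S')"
      using f by (auto simp: preimage_def compose_def FI_mor_def)
    have img: "compose R g f ` R = g ` f ` R"
      by (auto simp: compose_def)
    have fR: "f ` R \<subseteq> S" and injg: "inj_on g S"
      using f g by (auto simp: FI_mor_def)
    \<comment> \<open>Injectivity of \<open>g\<close> makes the vanishing condition in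
      \<open>induced_map\<close> for the composite agree with that for the two maps in
      succession.\<close>
    have sub: "preimage S g S' \<subseteq> f ` R \<longleftrightarrow> S' \<subseteq> g ` f ` R" if S'g: "S' \<subseteq> g ` S"
    proof
      assume *: "preimage S g S' \<subseteq> f ` R"
      show "S' \<subseteq> g ` f ` R"
      proof
        fix i assume "i \<in> S'"
        then obtain j where "j \<in> S" "i = g j"
          using S'g by blast
        then have "j \<in> f ` R"
          using * \<open>i \<in> S'\<close> by (auto simp: preimage_def)
        then show "i \<in> g ` f ` R"
          using \<open>i = g j\<close> by blast
      qed
    next
      assume *: "S' \<subseteq> g ` f ` R"
      show "preimage S g S' \<subseteq> f ` R"
      proof
        fix j assume "j \<in> preimage S g S'"
        then have j: "j \<in> S" "g j \<in> S'"
          by (auto simp: preimage_def)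
        then obtain i where "i \<in> R" "g j = g (f i)"
          using * by blast
        then have "j = f i"
          using injg j fR by (meson image_subset_iff inj_onD)
        then show "j \<in> f ` R"
          using \<open>i \<in> R\<close> by blast
      qed
    qed
    have sub': "S' \<subseteq> g ` S" if "S' \<subseteq> g ` f ` R"
      using that fR by blast
    show "(if S' \<subseteq> compose R g f ` R then Ar V (preimage R (compose R g f) S') S'
          (restrict (compose R g f) (preimage R (compose R g f) S')) (x (preimage R (compose R g
            f) S')) else \<one>\<^bsub>Ob V S'\<^esub>)
        = (if S' \<subseteq> g ` S then Ar V (preimage S g S') S' (restrict g (preimage S g S'))
          (induced_map V R S f x (preimage S g S')) else \<one>\<^bsub>Ob V S'\<^esub>)"
    proof (cases "S' \<subseteq> g ` f ` R")
      case True
      let ?Q = "preimage R f (preimage S g S')"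
      have "induced_map V R S f x (preimage S g S') = Ar V ?Q (preimage S g S') (restrict f ?Q) (x
        ?Q)"
        using preimage_in sub sub' True by (simp add: induced_map_def)
      moreover have "Ar V (preimage S g S') S' (restrict g (preimage S g S')) (Ar V ?Q (preimage S
        g S') (restrict f ?Q) (x ?Q))
          = Ar V ?Q S' (restrict (compose R g f) ?Q) (x ?Q)"
        using fin fS' f g
        by (intro Ar_Ar restrict_preimage_FI finite_preimage xc) (auto simp: preimage_def
          compose_def)
      ultimately show ?thesis
        using True sub' by (simp add: img pre2)
    next
      case False
      have "Ar V (preimage S g S') S' (restrict g (preimage S g S')) (induced_map V R S f x
        (preimage S g S')) = \<one>\<^bsub>Ob V S'\<^esub>" if "S' \<subseteq> g ` S"
        using that sub False preimage_in fin fS' g by (simp add: induced_map_def Ar_one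
          restrict_preimage_FI finite_preimage)
      then show ?thesis
        using False by (simp add: img)
    qed
  qed
  then show "Ar (induced_module V) R T (compose R g f) x = Ar (induced_module V) S T g (Ar
    (induced_module V) R S f x)"
    by (simp add: induced_module_def)
qed

text \<open>The counit of the adjunction between induction and restriction to FB-modules.\<close>

definition induced_sum :: "nat set \<Rightarrow> (nat set \<Rightarrow> 'u) \<Rightarrow> 'u" where
  "induced_sum T x = finprod (Ob V T) (\<lambda>S. Ar V S T (incl S) (x S)) (Pow T)"

lemma induced_sum_terms:
  assumes "finite T" "x \<in> carrier (Ob (induced_module V) T)"
  shows "(\<lambda>S. Ar V S T (incl S) (x S)) \<in> Pow T \<rightarrow> carrier (Ob V T)"
  using assms finite_subset[OF _ assms(1)] by (auto simp: induced_module_def intro!: Ar_closed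
    incl_FI)

lemma induced_sum_hom: "finite T \<Longrightarrow> induced_sum T \<in> hom (Ob (induced_module V) T) (Ob V T)"
proof (rule homI)
  assume T: "finite T"
  interpret comm_group "Ob V T"
    by (rule ab_group[OF T])
  fix x y assume x: "x \<in> carrier (Ob (induced_module V) T)"
  show "induced_sum T x \<in> carrier (Ob V T)"
    unfolding induced_sum_def using induced_sum_terms[OF T x] by simp
  assume y: "y \<in> carrier (Ob (induced_module V) T)"
  have "Ar V S T (incl S) ((x \<otimes>\<^bsub>Ob (induced_module V) T\<^esub> y) S)
      = Ar V S T (incl S) (x S) \<otimes>\<^bsub>Ob V T\<^esub> Ar V S T (incl S) (y S)" if S: "S \<in> Pow T" for S
  proof -
    have "finite S"
      using S T finite_subset by blast
    then interpret group_hom "Ob V S" "Ob V T" "Ar V S T (incl S)"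
      using S T by (intro Ar_hom_group incl_FI) auto
    show ?thesis
      using S PiE_mem[of x "Pow T" "\<lambda>S. carrier (Ob V S)" S] PiE_mem[of y "Pow T" "\<lambda>S. carrier (Ob
        V S)" S] x y
      by (simp add: induced_module_def)
  qed
  then have "induced_sum T (x \<otimes>\<^bsub>Ob (induced_module V) T\<^esub> y)
     = finprod (Ob V T) (\<lambda>S. Ar V S T (incl S) (x S) \<otimes>\<^bsub>Ob V T\<^esub> Ar V S T (incl S) (y S)) (Pow T)"
    unfolding induced_sum_def using induced_sum_terms[OF T x] induced_sum_terms[OF T y]
    by (intro finprod_cong') auto
  then show "induced_sum T (x \<otimes>\<^bsub>Ob (induced_module V) T\<^esub> y) = induced_sum T x \<otimes>\<^bsub>Ob V T\<^esub>
    induced_sum T y"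
    unfolding induced_sum_def using finprod_multf[OF induced_sum_terms[OF T x]
      induced_sum_terms[OF T y]] by simp
qed

lemma induced_sum_natural: "natural FI_mor (induced_module V) V induced_sum"
  unfolding natural_def
proof (intro conjI allI impI)
  fix S T f x
  assume S: "finite S" and T: "finite T" and f: "f \<in> FI_mor S T" and x: "x \<in> carrier (Ob
    (induced_module V) S)"
  interpret group_hom "Ob V S" "Ob V T" "Ar V S T f"
    by (rule Ar_hom_group[OF S T f])
  interpret G: comm_group "Ob V S"
    by (rule ab_group[OF S])
  interpret H: comm_group "Ob V T"
    by (rule ab_group[OF T])
  let ?y = "induced_map V S T f x"
  have y: "?y \<in> carrier (Ob (induced_module V) T)"
    using hom_in_carrier[OF ab_functor.ar_hom[OF induced_module_FI_module S T f] x] by (simp add: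
      induced_module_def)
  have fS: "f ` S \<subseteq> T" and inj: "inj_on f S"
    using f by (auto simp: FI_mor_def)
  have inj': "inj_on (image f) (Pow S)"
    using inj by (simp add: inj_on_image_Pow)
  have "induced_sum T ?y = finprod (Ob V T) (\<lambda>S'. Ar V S' T (incl S') (?y S')) (image f ` Pow S)"
    unfolding induced_sum_def
  proof (rule H.finprod_mono_neutral_cong_left[symmetric])
    show "image f ` Pow S \<subseteq> Pow T"
      using fS by auto
    show "Ar V S' T (incl S') (?y S') = \<one>\<^bsub>Ob V T\<^esub>" if "S' \<in> Pow T - image f ` Pow S" for S'
    proof -
      have "\<not> S' \<subseteq> f ` S"
        using that by (auto simp: subset_image_iff)
      then show ?thesis
        using that T finite_subset[OF _ T] by (simp add: induced_map_def Ar_one incl_FI)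
    qed
  qed (use T induced_sum_terms[OF T y] in auto)
  also have "\<dots> = finprod (Ob V T) (\<lambda>R. Ar V (f ` R) T (incl (f ` R)) (?y (f ` R))) (Pow S)"
    using induced_sum_terms[OF T y] fS by (intro H.finprod_reindex inj') auto
  also have "\<dots> = finprod (Ob V T) (\<lambda>R. Ar V S T f (Ar V R S (incl R) (x R))) (Pow S)"
  proof (rule H.finprod_cong')
    show "(\<lambda>R. Ar V S T f (Ar V R S (incl R) (x R))) \<in> Pow S \<rightarrow> carrier (Ob V T)"
      using induced_sum_terms[OF S x] by (simp add: Pi_iff)
    fix R assume R: "R \<in> Pow S"
    then have fR: "finite R"
      using S finite_subset by blast
    have preimage: "preimage S f (f ` R) = R"
      using R inj by (auto simp: preimage_def inj_on_def)
    have "?y (f ` R) = Ar V R (f ` R) (restrict f R) (x R)"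
      using R fS by (auto simp: induced_map_def preimage)
    moreover have "Ar V (f ` R) T (incl (f ` R)) (Ar V R (f ` R) (restrict f R) (x R))
        = Ar V S T f (Ar V R S (incl R) (x R))"
    proof (rule Ar_Ar_eq)
      show "restrict f R \<in> FI_mor R (f ` R)"
        using restrict_preimage_FI[OF f, of "f ` R"] by (simp add: preimage)
      show "x R \<in> carrier (Ob V R)"
        using induced_module_mem[OF x] R by blast
    qed (use fR S T f R fS in \<open>auto intro!: incl_FI\<close>)
    ultimately show "Ar V (f ` R) T (incl (f ` R)) (?y (f ` R)) = Ar V S T f (Ar V R S (incl R) (x
      R))"
      by simp
  qed simp
  also have "\<dots> = Ar V S T f (induced_sum S x)"
    unfolding induced_sum_def
    using hom_finprod_comm[OF ab_group[OF S] ab_group[OF T] ar_hom[OF S T f] induced_sum_terms[OF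
      S x]] by simp
  finally show "induced_sum T (Ar (induced_module V) S T f x) = Ar V S T f (induced_sum S x)"
    by (simp add: induced_module_def)
qed (rule induced_sum_hom)

text \<open>The summand indexed by \<open>T\<close> itself, mapped by the identity, already covers
  the value at \<open>T\<close>.\<close>

lemma induced_sum_surj:
  assumes T: "finite T" and a: "a \<in> carrier (Ob V T)"
  shows "\<exists>x\<in>carrier (Ob (induced_module V) T). induced_sum T x = a"
proof
  interpret comm_group "Ob V T"
    by (rule ab_group[OF T])
  let ?x = "\<lambda>S\<in>Pow T. if S = T then a else \<one>\<^bsub>Ob V S\<^esub>"
  show x: "?x \<in> carrier (Ob (induced_module V) T)"
    using a finite_subset[OF _ T] by (auto simp: induced_module_def one_carrier)
  have "induced_sum T ?x = finprod (Ob V T) (\<lambda>S. if S = T then a else \<one>\<^bsub>Ob V T\<^esub>) (Pow T)"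
    unfolding induced_sum_def
  proof (rule finprod_cong')
    fix S assume S: "S \<in> Pow T"
    then have "finite S"
      using T finite_subset by blast
    then show "Ar V S T (incl S) (?x S) = (if S = T then a else \<one>\<^bsub>Ob V T\<^esub>)"
      using S T a ar_id[OF T a] by (auto simp: Ar_one incl_FI)
  qed (use a in auto)
  also have "\<dots> = a"
    using finprod_singleton_swap[of T "Pow T" "\<lambda>_. a"] T a by simp
  finally show "induced_sum T ?x = a" .
qed

end

text \<open>Projectivity can only be tested in the type of \<open>V\<close>, into which the induced module is encoded.\<close>

definition image_functor :: "(nat set \<Rightarrow> 'a \<Rightarrow> 'b) \<Rightarrow> 'a set_functor \<Rightarrow> 'b set_functor" where
  "image_functor e M = \<lparr>Ob = (\<lambda>T. image_group (e T) (Ob M T)),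
     Ar = (\<lambda>S T f x. e T (Ar M S T f (inv_into (carrier (Ob M S)) (e S) x)))\<rparr>"

lemma image_functor:
  assumes "FI_module M" and inj: "\<And>T. finite T \<Longrightarrow> inj_on (e T) (carrier (Ob M T))"
  shows "FI_module (image_functor e M)"
    and "natural FI_mor M (image_functor e M) e"
    and "natural FI_mor (image_functor e M) M (\<lambda>T. inv_into (carrier (Ob M T)) (e T))"
proof -
  interpret fi_module M
    using assms(1) by (simp add: fi_module_def)
  have e: "e T \<in> iso (Ob M T) (Ob (image_functor e M) T)" if "finite T" for T
    using inj_imp_image_group_iso[OF inj[OF that]] by (simp add: image_functor_def)
  then have e_hom: "e T \<in> hom (Ob M T) (Ob (image_functor e M) T)" if "finite T" for T
    using that by (simp add: iso_def)
  have i_hom: "inv_into (carrier (Ob M T)) (e T) \<in> hom (Ob (image_functor e M) T) (Ob M T)"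
    if "finite T" for T
    using group.iso_set_sym[OF V_group e] that by (simp add: iso_def)
  have car: "carrier (Ob (image_functor e M) T) = e T ` carrier (Ob M T)" for T
    by (simp add: image_functor_def image_group_def)
  have inv_e: "inv_into (carrier (Ob M T)) (e T) (e T x) = x" if "finite T" "x \<in> carrier (Ob M T)"
    for T x
    using inv_into_f_f[OF inj] that by blast
  have Ar: "Ar (image_functor e M) S T f (e S x) = e T (Ar M S T f x)" if "finite S" "x \<in> carrier
    (Ob M S)" for S T f x
    using inv_e that by (simp add: image_functor_def)
  show "FI_module (image_functor e M)"
  proof (rule ab_functor.intro)
    fix T :: "nat set" assume T: "finite T"
    have "group (Ob (image_functor e M) T)"
      using group.inj_imp_image_group_is_group[OF V_group inj] T by (simp add: image_functor_def)
    moreover have "x \<otimes>\<^bsub>Ob (image_functor e M) T\<^esub> y = y \<otimes>\<^bsub>Ob (image_functor e M) T\<^esub> x"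
      if "x \<in> carrier (Ob (image_functor e M) T)" "y \<in> carrier (Ob (image_functor e M) T)" for x y
      using that comm_monoid.m_comm[OF comm_group.axioms(1)[OF ab_group[OF T]]]
      by (auto simp: car hom_mult[OF e_hom[OF T], symmetric])
    ultimately show "comm_group (Ob (image_functor e M) T)"
      by (rule group.group_comm_groupI)
    show "Ar (image_functor e M) T T (incl T) x = x" if "x \<in> carrier (Ob (image_functor e M) T)"
      for x
      using that T ar_id[OF T] by (auto simp: car Ar)
  next
    fix S T :: "nat set" and f assume ST: "finite S" "finite T" and f: "f \<in> FI_mor S T"
    have "Ar (image_functor e M) S T f = e T \<circ> (Ar M S T f \<circ> inv_into (carrier (Ob M S)) (e S))"
      by (simp add: image_functor_def fun_eq_iff)
    then show "Ar (image_functor e M) S T f \<in> hom (Ob (image_functor e M) S) (Ob (image_functor e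
      M) T)"
      using Group.hom_compose[OF Group.hom_compose[OF i_hom[OF ST(1)] ar_hom[OF ST f]] e_hom[OF
        ST(2)]] by simp
  next
    fix R S T :: "nat set" and f g x
    assume *: "finite R" "finite S" "finite T" "f \<in> FI_mor R S" "g \<in> FI_mor S T"
      "x \<in> carrier (Ob (image_functor e M) R)"
    then show "Ar (image_functor e M) R T (compose R g f) x
        = Ar (image_functor e M) S T g (Ar (image_functor e M) R S f x)"
      using ar_comp[OF *(1-5)] Ar_closed[OF *(1,2,4)] by (auto simp: car Ar)
  qed
  show "natural FI_mor M (image_functor e M) e"
    unfolding natural_def using e_hom Ar by simp
  show "natural FI_mor (image_functor e M) M (\<lambda>T. inv_into (carrier (Ob M T)) (e T))"
    unfolding natural_def using i_hom Ar inv_e Ar_closed by (auto simp: car)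
qed

section \<open>Sections of projectives and the retractions they give\<close>

lemma natural_comp:
  "natural mor U V a \<Longrightarrow> natural mor V W b \<Longrightarrow> natural mor U W (\<lambda>T x. b T (a T x))"
proof -
  assume a: "natural mor U V a" and b: "natural mor V W b"
  have "b T \<circ> a T \<in> hom (Ob U T) (Ob W T)" if "finite T" for T
    by (rule Group.hom_compose[where H = "Ob V T"]) (use a b that in \<open>simp_all add: natural_def\<close>)
  moreover have "a T x \<in> carrier (Ob V T)" if "finite T" "x \<in> carrier (Ob U T)" for T x
    using a that hom_in_carrier[of "a T" "Ob U T" "Ob V T" x] by (simp add: natural_def)
  ultimately show ?thesis
    using a b by (simp add: natural_def o_def)
qed

text \<open>The identity of \<open>V\<close> lifts along the counit \<open>induced_sum\<close>, once
  the induced module has been encoded by \<open>e\<close> as a test module in the type of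
  \<open>V\<close>.\<close>

lemma projective_section:
  fixes V :: "'u::infinite set_functor"
  assumes "FI_projective V"
  obtains \<sigma> where "natural FI_mor V (induced_module V) \<sigma>"
    and "\<And>T x. finite T \<Longrightarrow> x \<in> carrier (Ob V T) \<Longrightarrow> fi_module.induced_sum V T (\<sigma> T x) = x"
proof -
  have V: "FI_module V"
    using assms by (simp add: FI_projective_def)
  interpret fi_module V
    using V by (simp add: fi_module_def)
  have "\<forall>T. \<exists>e :: (nat set \<Rightarrow> 'u) \<Rightarrow> 'u. finite T \<longrightarrow> inj_on e (Pow T \<rightarrow>\<^sub>E UNIV)"
    using ex_inj_on_PiE[of "Pow _", where 'u = 'u] by (metis finite_Pow_iff)
  then obtain e :: "nat set \<Rightarrow> (nat set \<Rightarrow> 'u) \<Rightarrow> 'u"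
    where e: "\<And>T. finite T \<Longrightarrow> inj_on (e T) (Pow T \<rightarrow>\<^sub>E UNIV)"
    by metis
  have inj: "inj_on (e T) (carrier (Ob (induced_module V) T))" if "finite T" for T
    by (rule inj_on_subset[OF e[OF that]]) (auto simp: induced_module_def)
  let ?M = "image_functor e (induced_module V)" and ?i = "\<lambda>T. inv_into (carrier (Ob
    (induced_module V) T)) (e T)"
  have M: "FI_module ?M" and i: "natural FI_mor ?M (induced_module V) ?i"
    using image_functor(1,3)[of "induced_module V" e, OF induced_module_FI_module] inj by blast+
  have \<pi>: "natural FI_mor ?M V (\<lambda>T x. induced_sum T (?i T x))"
    by (rule natural_comp[OF i induced_sum_natural])
  then have \<pi>_hom: "(\<lambda>x. induced_sum T (?i T x)) \<in> hom (Ob ?M T) (Ob V T)" if "finite T" for T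
    using that by (simp add: natural_def)
  have surj: "pointwise_surj ?M V (\<lambda>T x. induced_sum T (?i T x))"
    unfolding pointwise_surj_def
  proof (intro allI impI equalityI subsetI)
    fix T :: "nat set" and a assume T: "finite T"
    show "a \<in> carrier (Ob V T)" if "a \<in> (\<lambda>x. induced_sum T (?i T x)) ` carrier (Ob ?M T)"
      using hom_in_carrier[OF \<pi>_hom[OF T]] that by blast
    assume "a \<in> carrier (Ob V T)"
    then obtain x where x: "x \<in> carrier (Ob (induced_module V) T)" "induced_sum T x = a"
      using induced_sum_surj[OF T] by blast
    then have "e T x \<in> carrier (Ob ?M T)" "?i T (e T x) = x"
      using inv_into_f_f[OF inj[OF T]] by (auto simp: image_functor_def image_group_def)
    then show "a \<in> (\<lambda>x. induced_sum T (?i T x)) ` carrier (Ob ?M T)"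
      using x by force
  qed
  have "\<exists>\<psi>. natural FI_mor V ?M \<psi> \<and>
      (\<forall>T x. finite T \<longrightarrow> x \<in> carrier (Ob V T) \<longrightarrow> induced_sum T (?i T (\<psi> T x)) = x)"
    using assms[unfolded FI_projective_def, THEN conjunct2, rule_format, OF M V \<pi> surj id_natural] .
  then obtain \<psi> where "natural FI_mor V ?M \<psi>"
    "\<And>T x. finite T \<Longrightarrow> x \<in> carrier (Ob V T) \<Longrightarrow> induced_sum T (?i T (\<psi> T x)) = x"
    by blast
  then show ?thesis
    using that[OF natural_comp[OF _ i]] by blast
qed

text \<open>Embed \<open>V\<close> into its induced module, drop the summands at sets containing
  \<open>u\<close>, and sum up again. This is natural only for maps that leave \<open>u\<close>
  alone, hence the excluded set \<open>{u}\<close>.\<close>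

lemma projective_retractable:
  fixes V :: "'u::infinite set_functor"
  assumes "FI_projective V"
  shows "retractable (frag_kernel V V (\<lambda>T x. x)) (frag_step V) {u} u"
proof -
  have V: "FI_module V"
    using assms by (simp add: FI_projective_def)
  interpret fi_module V
    using V by (simp add: fi_module_def)
  obtain \<sigma> where nat: "natural FI_mor V (induced_module V) \<sigma>"
    and \<sigma>: "\<And>T x. finite T \<Longrightarrow> x \<in> carrier (Ob V T) \<Longrightarrow> induced_sum T (\<sigma> T x) = x"
    using projective_section[OF assms] by blast
  have \<sigma>_hom: "\<sigma> T \<in> hom (Ob V T) (Ob (induced_module V) T)" if "finite T" for T
    using nat that by (simp add: natural_def)
  have \<sigma>_mem: "\<sigma> T x \<in> carrier (Ob (induced_module V) T)" if "finite T" "x \<in> carrier (Ob V T)" for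
    T x
    using hom_in_carrier[OF \<sigma>_hom] that .
  have \<sigma>_Ar: "\<sigma> T (Ar V S T (incl S) x) = (\<lambda>S'\<in>Pow T. if S' \<subseteq> S then \<sigma> S x S' else \<one>\<^bsub>Ob V S'\<^esub>)"
    if "finite T" "S \<subseteq> T" "x \<in> carrier (Ob V S)" for S T x
  proof -
    have S: "finite S"
      using that finite_subset by blast
    then have "\<sigma> T (Ar V S T (incl S) x) = induced_map V S T (incl S) (\<sigma> S x)"
      using nat that incl_FI[OF that(2)] by (simp add: natural_def induced_module_def)
    then show ?thesis
      using induced_map_incl[OF that(1,2)] \<sigma>_mem[OF S that(3)] by (simp add: induced_module_def)
  qed
  define \<rho> where "\<rho> S x = induced_sum S (restrict (\<sigma> (insert u S) x) (Pow S))" for S x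
  have trunc: "restrict y (Pow S) \<in> carrier (Ob (induced_module V) S)" if "y \<in> carrier (Ob
    (induced_module V) (insert u S))" for y S
    using that by (auto simp: induced_module_def)
  have \<rho>_hom: "\<rho> S \<in> hom (Ob V (insert u S)) (Ob V S)" if S: "finite S" for S
  proof (rule homI)
    have Sf: "finite (insert u S)"
      using S by simp
    fix x y assume x: "x \<in> carrier (Ob V (insert u S))"
    show "\<rho> S x \<in> carrier (Ob V S)"
      unfolding \<rho>_def by (rule hom_in_carrier[OF induced_sum_hom[OF S] trunc[OF \<sigma>_mem[OF Sf x]]])
    assume y: "y \<in> carrier (Ob V (insert u S))"
    have "restrict (\<sigma> (insert u S) (x \<otimes>\<^bsub>Ob V (insert u S)\<^esub> y)) (Pow S)
        = restrict (\<sigma> (insert u S) x) (Pow S) \<otimes>\<^bsub>Ob (induced_module V) S\<^esub> restrict (\<sigma> (insert u S)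
          y) (Pow S)"
      by (auto simp: hom_mult[OF \<sigma>_hom[OF Sf] x y] induced_module_def fun_eq_iff restrict_def)
    then show "\<rho> S (x \<otimes>\<^bsub>Ob V (insert u S)\<^esub> y) = \<rho> S x \<otimes>\<^bsub>Ob V S\<^esub> \<rho> S y"
      unfolding \<rho>_def
      using hom_mult[OF induced_sum_hom[OF S] trunc[OF \<sigma>_mem[OF Sf x]] trunc[OF \<sigma>_mem[OF Sf y]]]
        by simp
  qed
  have \<rho>_incl: "\<rho> S (Ar V S (insert u S) (incl S) x) = x"
    if "finite S" "u \<notin> S" "x \<in> carrier (Ob V S)" for S x
  proof -
    have "restrict (\<sigma> (insert u S) (Ar V S (insert u S) (incl S) x)) (Pow S) = restrict (\<sigma> S x)
      (Pow S)"
      using that by (simp add: \<sigma>_Ar subset_insertI) (auto simp: fun_eq_iff restrict_def)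
    also have "\<dots> = \<sigma> S x"
      using \<sigma>_mem[OF that(1,3)] by (simp add: induced_module_def)
    finally show ?thesis
      using \<sigma> that by (simp add: \<rho>_def)
  qed
  have \<rho>_Ar: "\<rho> (insert w S) (Ar V (insert u S) (insert u (insert w S)) (incl (insert u S)) x)
      = Ar V S (insert w S) (incl S) (\<rho> S x)"
    if S: "finite S" and w: "u \<notin> S" "w \<notin> S" "w \<noteq> u" and x: "x \<in> carrier (Ob V (insert u S))" for S
      w x
  proof -
    let ?y = "restrict (\<sigma> (insert u S) x) (Pow S)"
    have y: "?y \<in> carrier (Ob (induced_module V) S)"
      using trunc \<sigma>_mem x S by simp
    have "restrict (\<sigma> (insert u (insert w S)) (Ar V (insert u S) (insert u (insert w S)) (incl
      (insert u S)) x)) (Pow (insert w S))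
        = induced_map V S (insert w S) (incl S) ?y"
    proof -
      \<comment> \<open>Among the subsets of \<open>insert w S\<close>, those inside
        \<open>insert u S\<close> are those inside \<open>S\<close>; so dropping summands commutes
        with adding \<open>w\<close>.\<close>
      have "S' \<subseteq> insert u S \<longleftrightarrow> S' \<subseteq> S" if "S' \<subseteq> insert w S" for S'
        using that w by blast
      moreover have "S' \<subseteq> insert u (insert w S)" if "S' \<subseteq> insert w S" for S'
        using that by blast
      moreover have "insert u S \<subseteq> insert u (insert w S)"
        by blast
      ultimately show ?thesis
        using induced_map_incl[of "insert w S" S ?y] y S x
        by (simp add: \<sigma>_Ar induced_module_def subset_insertI) (auto simp: fun_eq_iff restrict_def)
    qed
    moreover have "induced_sum (insert w S) (induced_map V S (insert w S) (incl S) ?y) = Ar V S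
      (insert w S) (incl S) (induced_sum S ?y)"
      using induced_sum_natural S y incl_FI[of S "insert w S"] by (simp add: natural_def
        induced_module_def subset_insertI)
    ultimately show ?thesis
      by (simp add: \<rho>_def)
  qed
  define \<theta> where "\<theta> S = frag_lift (Ob V (insert u S)) (\<rho> S)" for S
  have frag_eval_\<theta>: "frag_eval (Ob V S) (\<theta> S x) = \<rho> S (frag_eval (Ob V (insert u S)) x)" if
    "finite S" for S x
    unfolding \<theta>_def using that by (intro frag_eval_frag_lift ab_group \<rho>_hom) auto
  have "shift_map frag_relations (frag_step V) {u} u {} (\<lambda>S x. x) \<theta>"
    unfolding shift_map_def Un_empty_right
  proof (intro allI impI conjI ballI)
    fix S x y assume "S \<inter> {u} = {}"
    then have u: "u \<notin> S"
      by simp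
    show "\<theta> S (x - y) = \<theta> S x - \<theta> S y"
      by (simp add: \<theta>_def frag_lift_diff)
    show "\<theta> S x \<in> frag_relations S" if "x \<in> frag_relations (insert u S)"
      unfolding frag_kernel_def
    proof (intro CollectI impI)
      assume S: "finite S"
      then have "frag_eval (Ob V S) (\<theta> S x) = \<rho> S \<one>\<^bsub>Ob V (insert u S)\<^esub>"
        using that by (simp add: frag_eval_\<theta> frag_kernel_def)
      also have "\<dots> = \<one>\<^bsub>Ob V S\<^esub>"
        using S hom_one[OF \<rho>_hom] V_group by simp
      finally show "frag_eval (Ob V S) (\<theta> S x) = \<one>\<^bsub>Ob V S\<^esub>" .
    qed
    show "\<theta> S (frag_step V S u x) - x \<in> frag_relations S"
      by (rule id.frag_kernel_diffI) (simp add: frag_eval_\<theta> frag_eval_frag_step \<rho>_incl u)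
    fix w assume w: "w \<notin> S \<union> {u}"
    show "\<theta> (insert w S) (frag_step V (insert u S) w y) - frag_step V S w (\<theta> S y) \<in> frag_relations
      (insert w S)"
    proof (rule id.frag_kernel_diffI)
      assume "finite (insert w S)"
      then have S: "finite S" "finite (insert u S)"
        by auto
      have "frag_eval (Ob V (insert w S)) (\<theta> (insert w S) (frag_step V (insert u S) w y))
          = \<rho> (insert w S) (frag_eval (Ob V (insert w (insert u S))) (frag_step V (insert u S) w
            y))"
        using S by (simp add: frag_eval_\<theta> insert_commute)
      also have "\<dots> = \<rho> (insert w S) (Ar V (insert u S) (insert u (insert w S)) (incl (insert u S))
        (frag_eval (Ob V (insert u S)) y))"
        using frag_eval_frag_step[OF S(2), of w y] by (simp add: insert_commute)
      also have "\<dots> = Ar V S (insert w S) (incl S) (\<rho> S (frag_eval (Ob V (insert u S)) y))"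
        using S u w by (intro \<rho>_Ar) auto
      also have "\<dots> = frag_eval (Ob V (insert w S)) (frag_step V S w (\<theta> S y))"
        using S by (simp add: frag_eval_\<theta> frag_eval_frag_step)
      finally show "frag_eval (Ob V (insert w S)) (\<theta> (insert w S) (frag_step V (insert u S) w y))
          = frag_eval (Ob V (insert w S)) (frag_step V S w (\<theta> S y))" .
    qed
  qed
  then show ?thesis
    unfolding retractable_def by blast
qed

subsection \<open>The regularity theorem\<close>

text \<open>If \<open>l\<close> and \<open>x\<close> have the same image, the quotient of
  \<open>x\<close> by \<open>l\<close> lies in the kernel. As this kernel is the image of the next
  differential of the resolution, the triviality criteria for homology turn into statements about
  decomposability.\<close>

lemma (in fi_map) rcos_kernel_iff:
  assumes T: "finite T" and x: "x \<in> carrier (Ob V T)"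
  shows "(\<exists>y\<in>kernel (Ob V T) (Ob W T) (\<eta> T). x \<in> lower_images V T #>\<^bsub>Ob V T\<^esub> y)
    \<longleftrightarrow> (\<exists>l\<in>lower_images V T. \<eta> T l = \<eta> T x)"
proof -
  interpret group_hom "Ob V T" "Ob W T" "\<eta> T"
    by (rule \<eta>_group_hom[OF T])
  have L: "l \<in> carrier (Ob V T)" if "l \<in> lower_images V T" for l
    using that subgroup.mem_carrier[OF V.lower_images_subgroup[OF T]] by blast
  show ?thesis
  proof
    assume "\<exists>y\<in>kernel (Ob V T) (Ob W T) (\<eta> T). x \<in> lower_images V T #>\<^bsub>Ob V T\<^esub> y"
    then obtain y l where "y \<in> carrier (Ob V T)" "\<eta> T y = \<one>\<^bsub>Ob W T\<^esub>" "l \<in> lower_images V T"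
      "x = l \<otimes>\<^bsub>Ob V T\<^esub> y"
      by (auto simp: kernel_def r_coset_def)
    then show "\<exists>l\<in>lower_images V T. \<eta> T l = \<eta> T x"
      using L by (intro bexI[of _ l]) simp_all
  next
    assume "\<exists>l\<in>lower_images V T. \<eta> T l = \<eta> T x"
    then obtain l where l: "l \<in> lower_images V T" "\<eta> T l = \<eta> T x"
      by blast
    define y where "y = inv\<^bsub>Ob V T\<^esub> l \<otimes>\<^bsub>Ob V T\<^esub> x"
    have "y \<in> kernel (Ob V T) (Ob W T) (\<eta> T)"
      using L[OF l(1)] x l(2) by (simp add: y_def kernel_def)
    moreover have "x = l \<otimes>\<^bsub>Ob V T\<^esub> y"
      using L[OF l(1)] x by (simp add: y_def G.m_assoc[symmetric])
    ultimately show "\<exists>y\<in>kernel (Ob V T) (Ob W T) (\<eta> T). x \<in> lower_images V T #>\<^bsub>Ob V T\<^esub> y"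
      using l(1) by (auto simp: r_coset_def)
  qed
qed

context fi_map
begin

definition \<delta> :: "nat set \<Rightarrow> ('u \<Rightarrow>\<^sub>0 int) \<Rightarrow> ('v \<Rightarrow>\<^sub>0 int)" where
  "\<delta> T = frag_lift (Ob V T) (\<eta> T)"

lemma frag_eval_\<delta>: "finite T \<Longrightarrow> frag_eval (Ob W T) (\<delta> T x) = \<eta> T (frag_eval (Ob V T) x)"
  unfolding \<delta>_def using nat by (intro frag_eval_frag_lift V.ab_group W.ab_group) (auto simp:
    natural_def)

lemma \<delta>_frag_step: "\<delta> (insert u S) (frag_step V S u x) = frag_step W S u (\<delta> S x)"
proof (cases "finite S")
  case True
  have "frag_lift (Ob V (insert u S)) (\<eta> (insert u S)) (frag_lift (Ob V S) (Ar V S (insert u S)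
    (incl S)) x)
      = frag_lift (Ob W S) (Ar W S (insert u S) (incl S)) (frag_lift (Ob V S) (\<eta> S) x)"
  proof (intro frag_lift_frag_lift_eq conjI)
    fix a assume a: "a \<in> carrier (Ob V S)"
    have i: "incl S \<in> FI_mor S (insert u S)"
      by (rule incl_FI) blast
    show "Ar V S (insert u S) (incl S) a \<in> carrier (Ob V (insert u S))"
      "\<eta> (insert u S) (Ar V S (insert u S) (incl S) a) = Ar W S (insert u S) (incl S) (\<eta> S a)"
      using V.Ar_closed[OF True _ i a] \<eta>_Ar[OF True _ i a] True by simp_all
    show "\<eta> S a \<in> carrier (Ob W S)"
      using group_hom.hom_closed[OF \<eta>_group_hom[OF True] a] .
  qed
  with True show ?thesis
    by (simp add: \<delta>_def frag_step_def)
qed (simp add: frag_step_def \<delta>_def)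

lemma ball_frag_eval_iff:
  assumes "finite T"
  shows "(\<forall>x\<in>carrier (Ob V T). Q x) \<longleftrightarrow> (\<forall>z. Q (frag_eval (Ob V T) z))"
proof (intro iffI allI ballI)
  show "Q x" if "\<forall>z. Q (frag_eval (Ob V T) z)" "x \<in> carrier (Ob V T)" for x
    using that(1)[rule_format, of "frag_of x"] comm_group.frag_eval_frag_of[OF V.ab_group[OF
      assms] that(2)] by simp
qed (use frag_eval_carrier[OF assms] in blast)

lemma bex_frag_eval_iff:
  assumes "finite T"
  shows "(\<exists>x\<in>carrier (Ob V T). Q x) \<longleftrightarrow> (\<exists>z. Q (frag_eval (Ob V T) z))"
  using ball_frag_eval_iff[OF assms, of "\<lambda>x. \<not> Q x"] by blast

lemma reflects_decomposable_iff:
  assumes T: "finite T"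
  shows "reflects_decomposable W.frag_relations (frag_step W) (frag_kernel V W \<eta>) (frag_step V) \<delta>
    T \<longleftrightarrow>
    (\<forall>x\<in>carrier (Ob V T). \<eta> T x \<in> lower_images W T \<longrightarrow> (\<exists>l\<in>lower_images V T. \<eta> T l = \<eta> T x))"
  unfolding reflects_decomposable_def ball_frag_eval_iff[OF T]
    W.decomposable_frag_relations_iff[OF T] decomposable_frag_kernel_iff[OF T] frag_eval_\<delta>[OF T] ..

lemma decomposable_UNIV_iff:
  assumes T: "finite T"
  shows "decomposable (frag_kernel V W \<eta>) (frag_step V) T = UNIV \<longleftrightarrow>
    (\<forall>x\<in>carrier (Ob V T). \<exists>l\<in>lower_images V T. \<eta> T l = \<eta> T x)"
  unfolding ball_frag_eval_iff[OF T] using decomposable_frag_kernel_iff[OF T] by blast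

text \<open>Degrees only test the sets \<open>{1..n}\<close>, whereas the induction over derivatives
  runs through all finite sets of positive integers; functoriality along a bijection closes the
  gap.\<close>

lemma decomposable_UNIV_card:
  assumes T: "finite T" and decomposable: "decomposable (frag_kernel V W \<eta>) (frag_step V) {1..card
    T} = UNIV"
  shows "decomposable (frag_kernel V W \<eta>) (frag_step V) T = UNIV"
  unfolding decomposable_UNIV_iff[OF T]
proof
  fix x assume x: "x \<in> carrier (Ob V T)"
  let ?N = "{1..card T}"
  obtain h where h: "bij_betw h ?N T"
    using ex_bij_betw_nat_finite_1[OF T] by blast
  define f where "f = restrict h ?N"
  define g where "g = restrict (inv_into ?N h) T"
  note h' = bij_betw_inv_into[OF h]
  have f: "f \<in> FI_mor ?N T"
    using bij_betwE[OF h] bij_betw_imp_inj_on[OF h]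
    by (simp add: f_def FI_mor_def restrict_PiE_iff inj_on_restrict_eq)
  have g: "g \<in> FI_mor T ?N"
    using bij_betwE[OF h'] bij_betw_imp_inj_on[OF h']
    by (simp add: g_def FI_mor_def restrict_PiE_iff inj_on_restrict_eq)
  have fg: "f (g i) = i" if "i \<in> T" for i
  proof -
    have "inv_into ?N h i \<in> ?N"
      using bij_betwE[OF h'] that by blast
    then show ?thesis
      using that bij_betw_inv_into_right[OF h that] by (simp only: f_def g_def restrict_apply
        if_True)
  qed
  have x': "Ar V T ?N g x \<in> carrier (Ob V ?N)"
    using V.Ar_closed[OF T _ g x] by simp
  then obtain l where l: "l \<in> lower_images V ?N" "\<eta> ?N l = \<eta> ?N (Ar V T ?N g x)"
    using decomposable decomposable_UNIV_iff[of ?N] by blast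
  have lc: "l \<in> carrier (Ob V ?N)"
    using l(1) subgroup.mem_carrier[OF V.lower_images_subgroup] by blast
  have "\<eta> T (Ar V ?N T f l) = \<eta> T (Ar V ?N T f (Ar V T ?N g x))"
    using l(2) \<eta>_Ar[OF _ T f] lc x' by simp
  also have "Ar V ?N T f (Ar V T ?N g x) = Ar V T T (incl T) x"
    by (rule V.Ar_Ar[OF T _ T g f x]) (use fg in simp_all)
  also have "\<dots> = x"
    using V.ar_id[OF T x] .
  finally show "\<exists>l\<in>lower_images V T. \<eta> T l = \<eta> T x"
    using V.lower_images_Ar[OF _ T f l(1)] by blast
qed

end

lemma syzygy_sequence_exact:
  assumes "fi_map A B \<eta>" "fi_map C A \<theta>"
    and exact: "\<And>T. finite T \<Longrightarrow> \<theta> T ` carrier (Ob C T) = kernel (Ob A T) (Ob B T) (\<eta> T)"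
  shows "syzygy_sequence (frag_kernel A A (\<lambda>T x. x)) (frag_kernel A B \<eta>) (frag_kernel C A \<theta>)
    (frag_step A) (frag_step C) (fi_map.\<delta> C \<theta>)"
proof -
  interpret f: fi_map A B \<eta> by fact
  interpret g: fi_map C A \<theta> by fact
  show ?thesis
  proof (intro syzygy_sequence.intro syzygy_sequence_axioms.intro)
    show "presented_module f.V.frag_relations (frag_step A)" "presented_module (frag_kernel A B \<eta>)
      (frag_step A)" "presented_module (frag_kernel C A \<theta>) (frag_step C)"
      by (rule f.V.id.presented_module_axioms f.presented_module_axioms g.presented_module_axioms)+
    fix S x y u
    show "g.\<delta> S (x - y) = g.\<delta> S x - g.\<delta> S y"
      by (simp add: g.\<delta>_def frag_lift_diff)
    show "g.\<delta> (insert u S) (frag_step C S u x) = frag_step A S u (g.\<delta> S x)"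
      by (rule g.\<delta>_frag_step)
    assume S: "finite S"
    interpret comm_group "Ob A S"
      by (rule f.V.ab_group[OF S])
    show "x \<in> frag_kernel C A \<theta> S \<longleftrightarrow> g.\<delta> S x \<in> f.V.frag_relations S" for x
      using S by (simp add: frag_kernel_def g.frag_eval_\<delta>)
    have "x \<in> frag_kernel A B \<eta> S \<longleftrightarrow> frag_eval (Ob A S) x \<in> kernel (Ob A S) (Ob B S) (\<eta> S)"
      using S by (simp add: frag_kernel_def kernel_def)
    also have "\<dots> \<longleftrightarrow> (\<exists>c\<in>carrier (Ob C S). frag_eval (Ob A S) x = \<theta> S c)"
      using exact[OF S] by auto
    also have "\<dots> \<longleftrightarrow> (\<exists>y. frag_eval (Ob A S) x = \<theta> S (frag_eval (Ob C S) y))"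
      by (rule g.bex_frag_eval_iff[OF S])
    also have "\<dots> \<longleftrightarrow> (\<exists>y. x - g.\<delta> S y \<in> f.V.frag_relations S)"
      using S by (simp add: frag_kernel_def frag_eval_diff mult_inv_eq_one_iff
        g.frag_eval_\<delta>[symmetric])
    finally show "x \<in> frag_kernel A B \<eta> S \<longleftrightarrow> (\<exists>y. x - g.\<delta> S y \<in> f.V.frag_relations S)" .
  qed
qed

section \<open>Degrees in the extended reals\<close>

lemma SUP_nat_cases:
  fixes S :: "nat set"
  obtains "S = {}" "(SUP n\<in>S. ereal (real n)) = - \<infinity>"
    | "infinite S" "(SUP n\<in>S. ereal (real n)) = \<infinity>"
    | "finite S" "S \<noteq> {}" "(SUP n\<in>S. ereal (real n)) = ereal (real (Max S))"
proof -
  consider "S = {}" | "infinite S" | "finite S" "S \<noteq> {}"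
    by blast
  then show ?thesis
  proof cases
    case 1
    then show ?thesis
      using that(1) by (simp add: bot_ereal_def)
  next
    case 2
    have "ereal r \<le> (SUP n\<in>S. ereal (real n))" for r
    proof -
      obtain n where "n \<in> S" "nat \<lceil>r\<rceil> < n"
        using 2 unfolding infinite_nat_iff_unbounded by blast
      then have "r \<le> real n"
        by linarith
      then show ?thesis
        using \<open>n \<in> S\<close> by (intro SUP_upper2) auto
    qed
    then show ?thesis
      using that(2) 2 ereal_top by blast
  next
    case 3
    have "(SUP n\<in>S. ereal (real n)) = ereal (real (Max S))"
      using 3 by (intro antisym SUP_least SUP_upper) auto
    then show ?thesis
      using that(3) 3 by blast
  qed
qed

text \<open>\<open>D\<close> and \<open>N\<close> are one more than the degrees, so
  \<open>int D + N + int q < int n + 2\<close> expresses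
  \<open>n - (q + 1) > (D - 1) + (N - 2)\<close>. An empty \<open>S0\<close> is expressed by
  \<open>D = 0\<close>, an empty \<open>S1\<close> by arbitrarily negative \<open>N\<close>, which
  is why \<open>N\<close> is an integer.\<close>

lemma degree_bound:
  fixes S0 S1 Sp :: "nat set"
  assumes bound: "\<And>D N n. (\<And>m. D \<le> m \<Longrightarrow> m \<notin> S0) \<Longrightarrow> (\<And>m. N \<le> int m \<Longrightarrow> m \<notin> S1) \<Longrightarrow>
      D = 0 \<or> int D + N + int q < int n + 2 \<Longrightarrow> n \<notin> Sp"
  shows "(SUP n\<in>Sp. ereal (real n)) - ereal (real (Suc q)) \<le>
    ((SUP n\<in>S0. ereal (real n)) - ereal (real 0)) + ((SUP n\<in>S1. ereal (real n)) - ereal (real 1))"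
proof (cases "infinite S0 \<or> infinite S1")
  \<comment> \<open>The right-hand side is infinite, even if its other summand is
    \<open>- \<infinity>\<close>.\<close>
  case True
  then show ?thesis
    by (cases S0 rule: SUP_nat_cases; cases S1 rule: SUP_nat_cases) auto
next
  case False
  then have fin: "finite S0" "finite S1"
    by auto
  have S1: "m \<notin> S1" if "int (Suc (Max S1)) \<le> int m" for m
  proof
    assume "m \<in> S1"
    then have "m \<le> Max S1"
      using fin by simp
    then show False
      using that by linarith
  qed
  have S0: "m \<notin> S0" if "Suc (Max S0) \<le> m" for m
  proof
    assume "m \<in> S0"
    then have "m \<le> Max S0"
      using fin by simp
    then show False
      using that by linarith
  qed
  show ?thesis
  proof (cases "S0 = {} \<or> S1 = {}")
    case True
    have "n \<notin> Sp" for n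
    proof (cases "S0 = {}")
      case True
      then show ?thesis
        using bound[of 0 "int (Suc (Max S1))"] S1 by blast
    next
      case False
      \<comment> \<open>With these values \<open>int D + N + int q = 0\<close>, so every
        \<open>n\<close> is excluded.\<close>
      then show ?thesis
        using True bound[of "Suc (Max S0)" "- int (Max S0) - int q - 1" n] S0 by auto
    qed
    then have "Sp = {}"
      by blast
    then show ?thesis
      by (simp add: bot_ereal_def)
  next
    case False
    have "n \<le> Max S0 + Max S1 + q" if "n \<in> Sp" for n
      using bound[of "Suc (Max S0)" "int (Suc (Max S1))" n, OF S0 S1] that by (cases "n \<le> Max S0 +
        Max S1 + q") auto
    then have "(SUP n\<in>Sp. ereal (real n)) \<le> ereal (real (Max S0 + Max S1 + q))"
      by (intro SUP_least) (simp del: of_nat_add)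
    then have "(SUP n\<in>Sp. ereal (real n)) - ereal (real (Suc q)) \<le> ereal (real (Max S0 + Max S1 +
      q)) - ereal (real (Suc q))"
      by (intro ereal_minus_mono) auto
    also have "\<dots> = (ereal (real (Max S0)) - ereal (real 0)) + (ereal (real (Max S1)) - ereal (real
      1))"
      by simp
    also have "\<dots> = ((SUP n\<in>S0. ereal (real n)) - ereal (real 0)) + ((SUP n\<in>S1. ereal (real n)) -
      ereal (real 1))"
      using False fin by (cases S0 rule: SUP_nat_cases; cases S1 rule: SUP_nat_cases) auto
    finally show ?thesis .
  qed
qed

theorem theorem1:
  fixes W :: "'a set_functor"
    and P :: "nat \<Rightarrow> 'u::infinite set_functor"
    and d :: "nat \<Rightarrow> nat set \<Rightarrow> 'u \<Rightarrow> 'u"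
    and \<epsilon> :: "nat set \<Rightarrow> 'u \<Rightarrow> 'a"
    and p :: nat
  assumes "FI_module W"
    and "projective_resolution W P d \<epsilon>"
    and "p \<ge> 1"
  shows "FI_f P d p \<le> FI_f P d 0 + FI_f P d 1"
proof -
  have proj: "FI_projective (P n)" for n
    using assms(2) by (simp add: projective_resolution_def)
  have modules: "fi_module (P n)" for n
    using proj by (simp add: FI_projective_def fi_module_def)
  interpret \<epsilon>: fi_map "P 0" W \<epsilon>
    using assms(1,2) modules
    by (simp add: projective_resolution_def fi_map_def fi_map_axioms_def fi_module_def)
  have maps: "fi_map (P (Suc n)) (P n) (d n)" for n
    using assms(2) modules by (simp add: projective_resolution_def fi_map_def fi_map_axioms_def)
  have exact0: "d 0 T ` carrier (Ob (P (Suc 0)) T) = kernel (Ob (P 0) T) (Ob W T) (\<epsilon> T)" if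
    "finite T" for T
    using assms(2) that by (simp add: projective_resolution_def)
  have exact: "d (Suc n) T ` carrier (Ob (P (Suc (Suc n))) T) = kernel (Ob (P (Suc n)) T) (Ob (P
    n) T) (d n T)"
    if "finite T" for n T
    using assms(2) that by (simp add: projective_resolution_def)
  interpret fi_complex P d
  proof (rule fi_complex.intro)
    show "fi_map (P (Suc n)) (P n) (d n)" for n
      by (rule maps)
    show "d n T (d (Suc n) T x) = \<one>\<^bsub>Ob (P n) T\<^esub>" if "finite T" "x \<in> carrier (Ob (P (Suc (Suc n)))
      T)" for T x n
      using exact[OF that(1), of n] that(2) by (auto simp: kernel_def)
  qed
  let ?N = "\<lambda>n. frag_kernel (P n) (P n) (\<lambda>T x. x)"
  \<comment> \<open>\<open>R 0\<close> presents \<open>W\<close> as a quotient of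
    \<open>P 0\<close>, and \<open>R (Suc m)\<close> presents the image of \<open>d m\<close>, a
    syzygy of \<open>W\<close>, as a quotient of \<open>P (Suc m)\<close>. All of these are
    quotients of formal sums over \<open>'u\<close>, whatever the type of \<open>W\<close>.\<close>
  define R where "R n = (case n of 0 \<Rightarrow> frag_kernel (P 0) W \<epsilon> | Suc m \<Rightarrow> frag_kernel (P (Suc m)) (P
    m) (d m))" for n
  let ?X = "\<lambda>n. frag_step (P n)"
  let ?\<delta> = "\<lambda>n. fi_map.\<delta> (P (Suc n)) (d n)"
  have syz: "syzygy_sequence (?N n) (R n) (R (Suc n)) (?X n) (?X (Suc n)) (?\<delta> n)" for n
  proof (cases n)
    case 0
    then show ?thesis
      using syzygy_sequence_exact[OF \<epsilon>.fi_map_axioms maps exact0] by (simp add: R_def)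
  next
    case (Suc m)
    then show ?thesis
      using syzygy_sequence_exact[OF maps maps exact] by (simp add: R_def)
  qed
  have acyclic: "koszul_exact (?N m) (?X m) {1..n} q" for m n q
    using presented_module.retractable_acyclic[OF syzygy_sequence.axioms(1)[OF syz]]
      projective_retractable[OF proj] by blast
  define S where "S p = {n. carrier (Ob (FI_homology P d p) {1..n}) \<noteq> {\<one>\<^bsub>Ob (FI_homology P d p)
    {1..n}\<^esub>}}" for p
  have S0: "n \<notin> S 0 \<longleftrightarrow> decomposable (R 0) (?X 0) {1..n} = UNIV" for n
  proof -
    have "n \<notin> S 0 \<longleftrightarrow> (\<forall>x\<in>carrier (Ob (P 0) {1..n}).
        \<exists>y\<in>d 0 {1..n} ` carrier (Ob (P 1) {1..n}). x \<in> lower_images (P 0) {1..n} #>\<^bsub>Ob (P 0)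
          {1..n}\<^esub> y)"
      by (simp add: S_def homology_0_trivial_iff)
    then show ?thesis
      by (simp add: exact0 \<epsilon>.rcos_kernel_iff \<epsilon>.decomposable_UNIV_iff R_def)
  qed
  have S_Suc: "n \<notin> S (Suc m) \<longleftrightarrow> reflects_decomposable (?N m) (?X m) (R (Suc m)) (?X (Suc m)) (?\<delta> m)
    {1..n}" for m n
  proof -
    have "n \<notin> S (Suc m) \<longleftrightarrow> (\<forall>x\<in>carrier (Ob (P (Suc m)) {1..n}). d m {1..n} x \<in> lower_images (P m)
      {1..n} \<longrightarrow>
        (\<exists>y\<in>d (Suc m) {1..n} ` carrier (Ob (P (Suc (Suc m))) {1..n}).
          x \<in> lower_images (P (Suc m)) {1..n} #>\<^bsub>Ob (P (Suc m)) {1..n}\<^esub> y))"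
      by (simp add: S_def homology_Suc_trivial_iff)
    then show ?thesis
      by (simp add: exact fi_map.rcos_kernel_iff[OF maps] fi_map.reflects_decomposable_iff[OF
        maps] R_def)
  qed
  \<comment> \<open>Dimension shifting passes the vanishing of H_{q+1} of the m-th syzygy on to H_1
    of the (m+q)-th, which the resolution computes in degree m + q + 1.\<close>
  have reflects_decomposable: "reflects_decomposable (?N (m + q)) (?X (m + q)) (R (Suc (m + q)))
    (?X (Suc (m + q))) (?\<delta> (m + q)) {1..n}"
    if "koszul_exact (R m) (?X m) {1..n} q" for m q n
    using that
  proof (induction q arbitrary: m)
    case 0
    then show ?case
      using syzygy_sequence.reflects_decomposable_if_koszul_exact[OF syz] by simp
  next
    case (Suc q)
    have "koszul_exact (R (Suc m)) (?X (Suc m)) {1..n} q"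
      using syzygy_sequence.koszul_exact_shift[OF syz _ Suc.prems acyclic] by simp
    from Suc.IH[OF this] show ?case
      by simp
  qed
  obtain q where q: "p = Suc q"
    using assms(3) by (cases p) auto
  have "(SUP n\<in>S (Suc q). ereal (real n)) - ereal (real (Suc q)) \<le>
    ((SUP n\<in>S 0. ereal (real n)) - ereal (real 0)) + ((SUP n\<in>S 1. ereal (real n)) - ereal (real 1))"
  proof (rule degree_bound)
    fix D N n
    assume D: "\<And>m. D \<le> m \<Longrightarrow> m \<notin> S 0" and N: "\<And>m. N \<le> int m \<Longrightarrow> m \<notin> S 1"
      and n: "D = 0 \<or> int D + N + int q < int n + 2"
    have "koszul_exact (R 0) (?X 0) {1..n} q"
    proof (rule presented_module.regularity[OF syzygy_sequence.axioms(2)[OF syz] _ _ _ n])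
      show "sym_pair (R 0) (?X 0) {u, v} u v" if "u \<noteq> v" for u v
        using \<epsilon>.sym_pair_FI[OF that] by (simp add: R_def)
      show "decomposable (R 0) (?X 0) T = UNIV" if "finite T" "D \<le> card T" for T
        using \<epsilon>.decomposable_UNIV_card[OF that(1)] D[OF that(2)] S0 by (simp add: R_def)
      show "koszul_exact (R 0) (?X 0) {1..n} 0" if "N \<le> int n" for n
        using syzygy_sequence.koszul_exact_if_reflects_decomposable[OF syz _ _ acyclic] N[OF that]
          S_Suc[of n 0] by simp
    qed
    from reflects_decomposable[OF this] show "n \<notin> S (Suc q)"
      by (simp add: S_Suc)
  qed
  then show ?thesis
    by (simp add: FI_f_def FB_degree_def S_def q)
qed

end
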